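(* For $V > 0$ sufficiently small, $\sigma(H^{(2)}_V) = \Sigma_V + \Sigma_V$, and this set is an interval.
   Context: Let $\alpha = \frac{\sqrt{5}-1}{2}$. For $V>0$ and $\omega \in \mathbb{T} = \mathbb{R}/\mathbb{Z}$, the Fibonacci Hamiltonian is the bounded self-adjoint operator on $\ell^2(\mathbb{Z})$ given by $$[H_{V,\omega} \psi](n) = \psi(n+1) + \psi(n-1) + V \chi_{[1-\alpha,1)}(n\alpha + \omega \bmod 1)\, \psi(n).$$ Its spectrum does not depend on $\omega$; $\Sigma_V$ denotes the common spectrum, $\Sigma_V = \sigma(H_{V,\omega})$ for every $\omega \in \mathbb{T}$. The sum set is $\Sigma_V+\Sigma_V = \{E_1+E_2 : E_1,E_2\in\Sigma_V\}$. The square Fibonacci Hamiltonian is the operator on $\ell^2(\mathbb{Z}^2)$ given by $$[H^{(2)}_V \psi](m,n) = \psi(m+1,n) + \psi(m-1,n) + \psi(m,n+1) + \psi(m,n-1) + V\left( \chi_{[1-\alpha,1)}(m\alpha \bmod 1) + \chi_{[1-\alpha,1)}(n\alpha \bmod 1)\right)\psi(m,n).$$ *)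

theory Defs
  imports "HOL-Analysis.Analysis"
begin

text \<open>The Hilbert space of square-summable functions on an index type is represented by a set of
  functions. An operator on it is a function on all of \<open>'a \<Rightarrow> complex\<close> of which only the restriction
  to \<open>ell2\<close> matters.\<close>

definition ell2 :: "('a \<Rightarrow> complex) set" where
  "ell2 = {\<psi>. (\<lambda>x. (cmod (\<psi> x))\<^sup>2) summable_on UNIV}"

definition ell2_norm :: "('a \<Rightarrow> complex) \<Rightarrow> real" where
  "ell2_norm \<psi> = sqrt (\<Sum>\<^sub>\<infinity>x. (cmod (\<psi> x))\<^sup>2)"

definition bounded_operator :: "(('a \<Rightarrow> complex) \<Rightarrow> ('a \<Rightarrow> complex)) \<Rightarrow> bool" where
  "bounded_operator T \<longleftrightarrow>
     (\<forall>\<psi>\<in>ell2. T \<psi> \<in> ell2) \<and>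
     (\<forall>\<phi>\<in>ell2. \<forall>\<psi>\<in>ell2. T (\<lambda>x. \<phi> x + \<psi> x) = (\<lambda>x. T \<phi> x + T \<psi> x)) \<and>
     (\<forall>c. \<forall>\<psi>\<in>ell2. T (\<lambda>x. c * \<psi> x) = (\<lambda>x. c * T \<psi> x)) \<and>
     (\<exists>C. \<forall>\<psi>\<in>ell2. ell2_norm (T \<psi>) \<le> C * ell2_norm \<psi>)"

text \<open>The spectrum is the set of \<open>z\<close> for which \<open>T - z\<close> has no bounded two-sided inverse on
  \<open>ell2\<close>. It is meant for operators \<open>T\<close> that are bounded on \<open>ell2\<close>.\<close>

definition spectrum :: "(('a \<Rightarrow> complex) \<Rightarrow> ('a \<Rightarrow> complex)) \<Rightarrow> complex set" where
  "spectrum T = {z. \<not> (\<exists>R. bounded_operator R \<and>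
     (\<forall>\<psi>\<in>ell2. R (\<lambda>x. T \<psi> x - z * \<psi> x) = \<psi> \<and> (\<lambda>x. T (R \<psi>) x - z * R \<psi> x) = \<psi>))}"

definition fib_alpha :: real where
  "fib_alpha = (sqrt 5 - 1) / 2"

text \<open>Points of the circle are given by real representatives; \<open>frac\<close> is reduction modulo 1.\<close>

definition fib_word :: "real \<Rightarrow> int \<Rightarrow> real" where
  "fib_word \<omega> n = indicator {1 - fib_alpha..<1} (frac (of_int n * fib_alpha + \<omega>))"

definition fib_hamiltonian :: "real \<Rightarrow> real \<Rightarrow> (int \<Rightarrow> complex) \<Rightarrow> (int \<Rightarrow> complex)" where
  "fib_hamiltonian V \<omega> \<psi> =
     (\<lambda>n. \<psi> (n + 1) + \<psi> (n - 1) + complex_of_real (V * fib_word \<omega> n) * \<psi> n)"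

text \<open>The common spectrum of the Fibonacci Hamiltonians with coupling \<open>V\<close>. The description is
  meaningful because the spectrum is the same for all phases.\<close>

definition fib_spectrum :: "real \<Rightarrow> complex set" where
  "fib_spectrum V = (THE S. \<forall>\<omega>. spectrum (fib_hamiltonian V \<omega>) = S)"

definition square_fib_hamiltonian ::
  "real \<Rightarrow> (int \<times> int \<Rightarrow> complex) \<Rightarrow> (int \<times> int \<Rightarrow> complex)" where
  "square_fib_hamiltonian V \<psi> =
     (\<lambda>(m, n). \<psi> (m + 1, n) + \<psi> (m - 1, n) + \<psi> (m, n + 1) + \<psi> (m, n - 1)
        + complex_of_real (V * (fib_word 0 m + fib_word 0 n)) * \<psi> (m, n))"

end

theory Submission
  imports Defs "HOL-Number_Theory.Fib" "HOL-Computational_Algebra.Fundamental_Theorem_Algebra"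
begin

text \<open>
  The half traces \<open>x\<^sub>k\<close> of the transfer matrices over blocks of Fibonacci length obey
  \<open>x\<^sub>k\<^sub>+\<^sub>3 = 2 x\<^sub>k\<^sub>+\<^sub>2 x\<^sub>k\<^sub>+\<^sub>1 - x\<^sub>k\<close>, and once two consecutive ones have modulus above 1 they escape to infinity.
  The spectrum \<open>\<Sigma>\<close> consists of the energies that never escape: a value \<open>\<bar>x\<^sub>k\<bar> \<le> 1\<close> gives an approximate
  eigenvector by cutting off a Bloch wave over a square in the Fibonacci word, while escape near \<open>E\<close>
  gives a spectral gap of the periodic approximants there, hence of the Fibonacci Hamiltonian.

  For small \<open>V\<close> two gaps of \<open>\<Sigma>\<close> are separated by at least twice the length of the shorter one. The reason
  is that \<open>x\<^sub>k\<close> has only real zeros \<open>r\<close>, so that \<open>\<bar>x\<^sub>k(c + \<rho>) x\<^sub>k(c - \<rho>)\<bar> \<le> x\<^sub>k(c)\<^sup>2 exp (- \<Sum> \<rho>\<^sup>2 / (c - r)\<^sup>2)\<close>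
  on a gap with centre \<open>c\<close> and radius \<open>\<rho>\<close>. If the gap escapes at time \<open>n\<close>, then \<open>log \<bar>x\<^sub>k(c)\<bar>\<close> is at most
  of order \<open>sqrt V\<close> times the Fibonacci number of index \<open>k - n\<close>, whereas an argument count shows that
  the number of zeros between the two gaps is at least of the order of that Fibonacci number. So most
  of these zeros are far from \<open>c\<close> compared with \<open>\<rho>\<close>.

  A compact set with this thickness property has an interval as its sum set, by Newhouse's gap
  argument. Tensor products of approximate eigenvectors show that \<open>\<Sigma> + \<Sigma>\<close> lies in the spectrum of the
  square Hamiltonian, and its numerical range lies in the convex hull of \<open>\<Sigma> + \<Sigma>\<close>.
\<close>

section \<open>The trace map\<close>

text \<open>At coupling 0 and energy \<open>2 * cosh t\<close> the traces are
  \<open>cosh (fib k * t)\<close>. For positive \<open>V\<close> the invariant disturbs this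
  addition formula by at most \<open>V / 2\<close> per step. A first escape happens at height 1 +
  O(V), which is \<open>cosh t\<close> with \<open>t\<close> of order \<open>sqrt V\<close>; hence
  the rate in the growth bound. Two gaps may escape at unrelated times. The estimate is applied to
  the one that escapes later, since by then the other one contains an escaped point too, and a bound
  on either length bounds the minimum. In the gap argument the factor 2 halves a product of two gap
  lengths at every step, so the argument ends after finitely many steps. The bound 1/1000000 on
  \<open>V\<close> ensures \<open>24 * sqrt V \<le> 1/25\<close>, from which the factor 2 follows.
  Instead of a spectral theorem there is a description of the spectrum by approximate eigenvalues;
  the only spectral point that has to be constructed is the bottom of a numerical range.\<close>

text \<open>For \<open>k \<ge> 2\<close> this is half the trace over the first \<open>fib k\<close> sites; the values at 0 and 1 continue the
  recursion backwards.\<close>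

fun tr :: "real \<Rightarrow> nat \<Rightarrow> 'a::real_field \<Rightarrow> 'a" where
  "tr V 0 z = 1"
| "tr V (Suc 0) z = z / 2"
| "tr V (Suc (Suc 0)) z = (z - of_real V) / 2"
| "tr V (Suc (Suc (Suc k))) z = 2 * tr V (Suc (Suc k)) z * tr V (Suc k) z - tr V k z"

lemma tr_of_real: "tr V k (of_real x :: 'a::real_field) = of_real (tr V k x)"
  by (induction V k x rule: tr.induct) auto

text \<open>The Fricke-Vogt invariant of the trace map. At \<open>k = 0\<close> the point is
  \<open>(1, z / 2, (z - V) / 2)\<close>, where the left side collapses to the square of a
  difference.\<close>

lemma tr_invariant:
  "(tr V k z)\<^sup>2 + (tr V (k+1) z)\<^sup>2 + (tr V (k+2) z)\<^sup>2 - 2 * tr V k z * tr V (k+1) z * tr V (k+2) z - 1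
     = (of_real V)\<^sup>2 / (4 :: 'a::real_field)"
proof (induction k)
  case 0
  show ?case by (simp add: numeral_2_eq_2 power2_eq_square field_simps)
next
  case (Suc k)
  have "tr V (Suc k + 2) z = 2 * tr V (k+2) z * tr V (k+1) z - tr V k z" by simp
  then show ?case using Suc by (simp add: numeral_2_eq_2 algebra_simps power2_eq_square)
qed

text \<open>The invariant is quadratic in each coordinate; completing the square in the newest one,
  and below in the oldest one, bounds that coordinate in terms of the other two.\<close>

lemma tr_invariant_forward:
  "(tr V (k+2) z - tr V k z * tr V (k+1) z)\<^sup>2
     = ((tr V k z)\<^sup>2 - 1) * ((tr V (k+1) z)\<^sup>2 - 1) + (of_real V)\<^sup>2 / (4 :: 'a::real_field)"
  unfolding tr_invariant[symmetric, of V k z] by (simp add: power2_eq_square algebra_simps)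

lemma tr_invariant_middle:
  "(tr V k z - tr V (k+1) z * tr V (k+2) z)\<^sup>2
     = ((tr V (k+1) z)\<^sup>2 - 1) * ((tr V (k+2) z)\<^sup>2 - 1) + (of_real V)\<^sup>2 / (4 :: 'a::real_field)"
  unfolding tr_invariant[symmetric, of V k z] by (simp add: power2_eq_square algebra_simps)

text \<open>If the bound failed, the trace map run backwards would keep the moduli above 1 all the way
  down to \<open>tr V 0 z = 1\<close>.\<close>

lemma tr_escape_backward:
  fixes z :: complex
  assumes "cmod (tr V (k+1) z) > 1" "cmod (tr V (k+2) z) > 1"
  shows "cmod (tr V k z) < cmod (tr V (k+1) z) * cmod (tr V (k+2) z)"
  using assms
proof (induction k)
  case 0
  have "1 * 1 < cmod (tr V (0+1) z) * cmod (tr V (0+2) z)"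
    using 0 by (intro mult_strict_mono) auto
  then show ?case by simp
next
  case (Suc k)
  define a b c d where "a = cmod (tr V k z)" "b = cmod (tr V (k+1) z)" "c = cmod (tr V (k+2) z)" "d = cmod (tr V (k+3) z)"
  note defs = this
  have c: "c > 1" "d > 1" using Suc.prems defs by (auto simp: numeral_3_eq_3 numeral_2_eq_2)
  show ?case
  proof (rule ccontr)
    assume "\<not> ?thesis"
    then have b: "b \<ge> c * d" by (simp add: defs numeral_3_eq_3 numeral_2_eq_2)
    have "c * d > 1 * 1" using c by (intro mult_strict_mono) auto
    then have b1: "b > 1" using b by simp
    have "2 * tr V (k+2) z * tr V (k+1) z = tr V (k+3) z + tr V k z"
      by (simp add: numeral_3_eq_3 numeral_2_eq_2)
    then have "2 * c * b \<le> d + a"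
      using norm_triangle_ineq[of "tr V (k+3) z" "tr V k z"]
      by (metis defs(1,2,3,4) norm_mult norm_numeral)
    moreover have "d \<le> b * c"
    proof -
      have "d * 1 \<le> d * c" using c by (intro mult_left_mono) auto
      also have "\<dots> \<le> b" using b by (simp add: mult.commute)
      also have "b * 1 \<le> b * c" using c b1 by (intro mult_left_mono) auto
      finally show ?thesis by simp
    qed
    moreover have "a < b * c" using Suc.IH b1 c defs by auto
    ultimately show False by (simp add: mult.commute)
  qed
qed

lemma tr_escape_forward:
  fixes z :: complex
  assumes "cmod (tr V (k+1) z) > 1" "cmod (tr V (k+2) z) > 1"
  shows "cmod (tr V (k+3) z) > cmod (tr V (k+1) z) * cmod (tr V (k+2) z)"
proof -
  have "2 * tr V (k+2) z * tr V (k+1) z = tr V (k+3) z + tr V k z"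
    by (simp add: numeral_3_eq_3 numeral_2_eq_2)
  then have "2 * cmod (tr V (k+2) z) * cmod (tr V (k+1) z) \<le> cmod (tr V (k+3) z) + cmod (tr V k z)"
    by (metis norm_mult norm_numeral norm_triangle_ineq)
  then show ?thesis using tr_escape_backward[OF assms] by (simp add: mult.commute)
qed

section \<open>Escaped energies and growth after the first escape\<close>

definition Esc :: "real \<Rightarrow> nat \<Rightarrow> real set" where
  "Esc V n = {E. \<bar>tr V n E\<bar> > 1 \<and> \<bar>tr V (Suc n) E\<bar> > 1}"

definition Sig :: "real \<Rightarrow> real set" where
  "Sig V = {E. \<forall>n. E \<notin> Esc V n}"

lemma tr_complex_abs: "cmod (tr V k (complex_of_real E)) = \<bar>tr V k E\<bar>"
  by (simp add: tr_of_real)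

lemma Esc_0: "Esc V 0 = {}"
  by (simp add: Esc_def)

lemma Esc_Suc: "Esc V n \<subseteq> Esc V (Suc n)"
proof (cases n)
  case (Suc k)
  show ?thesis
  proof
    fix E assume E: "E \<in> Esc V n"
    have "1 * 1 < \<bar>tr V n E\<bar> * \<bar>tr V (Suc n) E\<bar>" using E by (intro mult_strict_mono) (auto simp: Esc_def)
    also have "\<dots> < \<bar>tr V (Suc (Suc n)) E\<bar>"
      using tr_escape_forward[of V k "complex_of_real E"] E Suc
      by (simp only: tr_complex_abs Esc_def) (simp add: numeral_3_eq_3 numeral_2_eq_2)
    finally show "E \<in> Esc V (Suc n)" using E by (simp add: Esc_def)
  qed
qed (simp add: Esc_0)

lemma Esc_mono: "m \<le> n \<Longrightarrow> Esc V m \<subseteq> Esc V n"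
  by (rule lift_Suc_mono_le[of "Esc V"]) (rule Esc_Suc)

lemma continuous_on_tr: "continuous_on A (tr V k :: real \<Rightarrow> real)"
proof (induction V k "0::real" rule: tr.induct)
  case (4 V k)
  have "continuous_on A (\<lambda>x. 2 * tr V (Suc (Suc k)) x * tr V (Suc k) x - tr V k x)"
    using 4 by (intro continuous_intros)
  then show ?case by simp
qed (auto intro!: continuous_intros)

lemma open_Esc: "open (Esc V n)"
proof -
  have "Esc V n = {E. 1 < \<bar>tr V n E\<bar>} \<inter> {E. 1 < \<bar>tr V (Suc n) E\<bar>}" by (auto simp: Esc_def)
  then show ?thesis
    by (auto intro!: open_Collect_less continuous_intros continuous_on_tr open_Int)
qed

lemma Sig_compl: "- Sig V = (\<Union>n. Esc V n)"
  by (auto simp: Sig_def)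

lemma closed_Sig: "closed (Sig V)"
  unfolding closed_def Sig_compl by (auto intro: open_Esc)

text \<open>The open sets \<open>Esc V n\<close> increase and cover \<open>K\<close>, so compactness
  gives one escape time that serves all of \<open>K\<close>.\<close>

lemma compact_disjoint_Sig:
  assumes "compact K" "K \<inter> Sig V = {}"
  shows "\<exists>n. \<forall>m\<ge>n. K \<subseteq> Esc V m"
proof -
  have "K \<subseteq> \<Union> (range (Esc V))" using assms(2) Sig_compl by blast
  then obtain C where C: "C \<subseteq> range (Esc V)" "finite C" "K \<subseteq> \<Union>C"
    using assms(1) by (metis (no_types, lifting) compactE open_Esc rangeE)
  then obtain I where I: "finite I" "C = Esc V ` I"
    by (meson finite_subset_image)
  have "K \<subseteq> Esc V m" if "m \<ge> Max (insert 0 I)" for m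
  proof
    fix x assume "x \<in> K"
    then obtain i where "i \<in> I" "x \<in> Esc V i" using C I by auto
    then show "x \<in> Esc V m" using Esc_mono[of i m] that I by auto
  qed
  then show ?thesis by blast
qed

text \<open>Index 1 is the earliest possible escape time. The two components make
  \<open>Sig V\<close> bounded, and in \<open>gap_distance\<close> they identify gaps with escape
  time 1 as the unbounded ones.\<close>

lemma Esc_1: "0 < V \<Longrightarrow> V \<le> 1 \<Longrightarrow> Esc V 1 = {..<-2} \<union> {2+V<..}"
  by (auto simp: Esc_def abs_real_def numeral_2_eq_2 split: if_splits)

lemma Sig_bounds: "0 < V \<Longrightarrow> V \<le> 1 \<Longrightarrow> Sig V \<subseteq> {-2..2+V}"
  using Sig_compl[of V] Esc_1[of V] by fastforce

text \<open>A first escape with large trace forces the preceding orbit to be close to a point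
  \<open>(a, a, 1)\<close>, which has already escaped.\<close>

lemma first_escape_bound:
  fixes E :: real
  assumes V: "0 < V" "V \<le> 1/100" and n: "n \<ge> 2"
    and E: "E \<in> Esc V n" "E \<notin> Esc V (n - 1)"
  shows "\<bar>tr V n E\<bar> \<le> 1 + 2 * V" "\<bar>tr V (Suc n) E\<bar> \<le> 1 + 3 * V"
proof -
  obtain k where k: "n = k + 2" using n by (metis add.commute le_Suc_ex)
  define x y a where "x = tr V k E" "y = tr V (k+1) E" "a = tr V (k+2) E"
  note defs = this
  have y1: "\<bar>y\<bar> \<le> 1" and a1: "\<bar>a\<bar> > 1" using E k defs by (auto simp: Esc_def numeral_2_eq_2)
  have inv: "(x - y * a)\<^sup>2 = (y\<^sup>2 - 1) * (a\<^sup>2 - 1) + V\<^sup>2 / 4"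
    using tr_invariant_middle[of V k E] defs by simp
  have y2: "y\<^sup>2 \<le> 1" using y1 by (simp add: abs_square_le_1)
  have a2: "a\<^sup>2 \<ge> 1" using a1 one_le_power[of "\<bar>a\<bar>" 2] by simp
  have "(y\<^sup>2 - 1) * (a\<^sup>2 - 1) \<le> 0" using y2 a2 by (intro mult_nonpos_nonneg) auto
  moreover have "(V/2)\<^sup>2 = V\<^sup>2 / 4" by (simp add: power_divide)
  ultimately have "(x - y * a)\<^sup>2 \<le> (V/2)\<^sup>2" using inv by linarith
  then have xya: "\<bar>x - y * a\<bar> \<le> V / 2" using V abs_le_square_iff[of "x - y * a" "V/2"] by simp
  show an: "\<bar>tr V n E\<bar> \<le> 1 + 2 * V"
  proof (rule ccontr)
    assume "\<not> ?thesis"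
    then have A: "\<bar>a\<bar> > 1 + 2 * V" using k defs by simp
    have "(1 + 2*V)\<^sup>2 \<le> \<bar>a\<bar>\<^sup>2" using A V by (intro power_mono) auto
    moreover have "(1 + 2*V)\<^sup>2 = 1 + 4 * V + 4 * V\<^sup>2" by (simp add: power2_eq_square algebra_simps)
    ultimately have a4: "a\<^sup>2 - 1 \<ge> 4 * V" using zero_le_power2[of V] unfolding power2_abs by linarith
    have "(1 - y\<^sup>2) * (4 * V) \<le> (1 - y\<^sup>2) * (a\<^sup>2 - 1)" using a4 y2 by (intro mult_left_mono) auto
    also have "\<dots> \<le> V\<^sup>2 / 4" using inv by (smt (verit) zero_le_power2 minus_mult_left)
    finally have "((1 - y\<^sup>2) * 16) * V \<le> V * V" by (simp add: power2_eq_square mult_ac)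
    then have "(1 - y\<^sup>2) * 16 \<le> V" using V by (simp only: mult_le_cancel_right_pos)
    then have y3: "y\<^sup>2 \<ge> 1 - V / 16" by simp
    then have y4: "\<bar>y\<bar> \<ge> 1 - V / 16" using y1 by (metis abs_ge_zero mult_left_le order_trans power2_abs power2_eq_square)
    have "\<bar>y * a\<bar> \<ge> (1 - V/16) * (1 + 2*V)" unfolding abs_mult using A V y4 by (intro mult_mono) auto
    moreover have "(1 - V/16) * (1 + 2*V) = 1 + 2 * V - V/16 - V*V/8" by (simp add: field_simps)
    moreover have "V * V \<le> V * 1" using V by (intro mult_left_mono) auto
    ultimately have x1: "\<bar>x\<bar> > 1" using xya V by linarith
    show False
    proof (cases k)
      case 0
      then show False using x1 defs by simp
    next
      case (Suc j)
      define w where "w = tr V j E"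
      have "w = 2 * y * x - a" using Suc defs w_def by (simp add: numeral_2_eq_2)
      then have "w = a * (2 * y\<^sup>2 - 1) + 2 * y * (x - y * a)" by (simp add: power2_eq_square algebra_simps)
      moreover have "\<bar>a * (2 * y\<^sup>2 - 1)\<bar> \<ge> (1 + 2 * V) * (1 - V/8)"
        unfolding abs_mult using A V y3 by (intro mult_mono) auto
      moreover have "(1 + 2 * V) * (1 - V/8) = 1 + 2 * V - V/8 - V*V/4" by (simp add: field_simps)
      moreover have "\<bar>2 * y * (x - y * a)\<bar> \<le> V"
      proof -
        have "\<bar>y\<bar> * \<bar>x - y * a\<bar> \<le> 1 * (V/2)" using y1 xya by (intro mult_mono) auto
        then show ?thesis by (simp add: abs_mult)
      qed
      ultimately have "\<bar>w\<bar> > 1" using \<open>V * V \<le> V * 1\<close> V by linarith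
      then have "E \<in> Esc V j" using x1 defs w_def Suc by (simp add: Esc_def)
      then show False using E Esc_mono[of j "n - 1" V] Suc k by auto
    qed
  qed
  have "tr V (Suc n) E = 2 * a * y - x" using k defs by (simp add: numeral_2_eq_2)
  then have "tr V (Suc n) E = y * a - (x - y * a)" by simp
  then have "\<bar>tr V (Suc n) E\<bar> \<le> \<bar>y * a\<bar> + V / 2" using xya by linarith
  moreover have "\<bar>y * a\<bar> \<le> 1 * \<bar>a\<bar>" unfolding abs_mult using y1 by (intro mult_right_mono) auto
  ultimately show "\<bar>tr V (Suc n) E\<bar> \<le> 1 + 3 * V" using an k defs V by simp
qed

lemma sinh_real_ge: "0 \<le> x \<Longrightarrow> x \<le> sinh (x::real)"
  using real_le_x_sinh[of x] by (simp add: sinh_def exp_minus)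

lemma one_add_sq_le_cosh: "0 \<le> x \<Longrightarrow> 1 + x\<^sup>2 / 2 \<le> cosh (x::real)"
proof -
  assume x: "0 \<le> x"
  have "cosh x = cosh (2 * (x/2))" by simp
  also have "\<dots> = 1 + 2 * (sinh (x/2))\<^sup>2" by (simp only: cosh_double cosh_square_eq)
  finally have *: "cosh x = 1 + 2 * (sinh (x/2))\<^sup>2" .
  have "(x/2)\<^sup>2 \<le> (sinh (x/2))\<^sup>2" using sinh_real_ge[of "x/2"] x by (intro power_mono) auto
  then show ?thesis using * by (simp add: power_divide)
qed

text \<open>If two consecutive traces are at most \<open>cosh A\<close> and \<open>cosh B\<close>,
  the invariant bounds the next one by \<open>cosh (A + B) + V / 2\<close>. The summand
  \<open>- sqrt V\<close> in the exponent makes room for the error \<open>V / 2\<close>, so that the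
  exponents add up like Fibonacci numbers. The induction starts because the first escape stays below
  \<open>1 + 3 * V\<close>, hence below \<open>cosh (3 * sqrt V)\<close>.\<close>

lemma tr_growth:
  fixes E :: real
  assumes V: "0 < V" "V \<le> 1/100" and n: "n \<ge> 2"
    and E: "E \<in> Esc V n" "E \<notin> Esc V (n - 1)"
  shows "\<bar>tr V (n + k) E\<bar> \<le> cosh (4 * sqrt V * fib (k + 1) - sqrt V)"
proof (induction k rule: fib.induct)
  case 1
  have "1 + (3 * sqrt V)\<^sup>2 / 2 \<le> cosh (3 * sqrt V)" using V by (intro one_add_sq_le_cosh) auto
  then show ?case using first_escape_bound[OF V n E] V by (simp add: power_mult_distrib)
next
  case 2
  have "1 + (3 * sqrt V)\<^sup>2 / 2 \<le> cosh (3 * sqrt V)" using V by (intro one_add_sq_le_cosh) auto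
  then show ?case using first_escape_bound[OF V n E] V by (simp add: power_mult_distrib)
next
  case (3 k)
  define w where "w = sqrt V"
  define A B where "A = 4 * w * fib (k + 1) - w" "B = 4 * w * fib (k + 2) - w"
  define x y z where "x = tr V (n + k) E" "y = tr V (n + Suc k) E" "z = tr V (n + Suc (Suc k)) E"
  note defs = \<open>A = _\<close> \<open>B = _\<close> \<open>x = _\<close> \<open>y = _\<close> \<open>z = _\<close>
  have w: "0 < w" "w\<^sup>2 = V" using V by (auto simp: w_def)
  have fib1: "fib (Suc j) \<ge> 1" for j using fib_neq_0_nat[of "Suc j"] by linarith
  have "4 * w * 1 \<le> 4 * w * fib (k + 1)" "4 * w * 1 \<le> 4 * w * fib (k + 2)"
    using w fib1[of k] fib1[of "Suc k"] by (intro mult_left_mono; simp)+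
  then have AB: "A \<ge> 3 * w" "B \<ge> 3 * w" by (simp_all add: defs)
  have xA: "\<bar>x\<bar> \<le> cosh A" and yB: "\<bar>y\<bar> \<le> cosh B"
    using 3 by (simp_all add: defs w_def)
  have esc: "E \<in> Esc V (n + k)" using E Esc_mono[of n "n + k" V] by auto
  then have xy: "\<bar>x\<bar> > 1" "\<bar>y\<bar> > 1" by (simp_all add: Esc_def defs)
  have "x\<^sup>2 - 1 \<le> (sinh A)\<^sup>2"
    using power_mono[OF xA, of 2] by (simp add: cosh_square_eq)
  moreover have "y\<^sup>2 - 1 \<le> (sinh B)\<^sup>2"
    using power_mono[OF yB, of 2] by (simp add: cosh_square_eq)
  moreover have "y\<^sup>2 - 1 \<ge> 0" using xy one_le_power[of "\<bar>y\<bar>" 2] by simp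
  ultimately have "(x\<^sup>2 - 1) * (y\<^sup>2 - 1) \<le> (sinh A)\<^sup>2 * (sinh B)\<^sup>2"
    by (intro mult_mono) auto
  moreover have sAB: "sinh A \<ge> 0" "sinh B \<ge> 0" using AB w by auto
  moreover have "(z - x * y)\<^sup>2 = (x\<^sup>2 - 1) * (y\<^sup>2 - 1) + V\<^sup>2 / 4"
    using tr_invariant_forward[of V "n + k" E] by (simp add: defs)
  moreover have "sinh A * sinh B * V \<ge> 0" using sAB V by simp
  ultimately have "(z - x * y)\<^sup>2 \<le> (sinh A * sinh B + V / 2)\<^sup>2"
    by (simp only: power2_sum power_mult_distrib power_divide) simp
  then have "\<bar>z - x * y\<bar> \<le> \<bar>sinh A * sinh B + V / 2\<bar>" by (simp add: abs_le_square_iff)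
  also have "\<dots> = sinh A * sinh B + V / 2" using sAB V by simp
  finally have "\<bar>z\<bar> \<le> \<bar>x * y\<bar> + sinh A * sinh B + V / 2" by linarith
  also have "\<bar>x * y\<bar> \<le> cosh A * cosh B" unfolding abs_mult using xA yB by (intro mult_mono) auto
  finally have "\<bar>z\<bar> \<le> cosh (A + B) + V / 2" by (simp add: cosh_add)
  also have "\<dots> \<le> cosh (A + B) * 1 + sinh (A + B) * sinh w"
  proof -
    have "6 * w * w \<le> sinh (A + B) * sinh w"
      using AB w sinh_real_ge[of "A + B"] sinh_real_ge[of w] by (intro mult_mono) auto
    moreover have "w * w = V" using w by (simp add: power2_eq_square)
    ultimately show ?thesis using V by linarith
  qed
  also have "\<dots> \<le> cosh (A + B) * cosh w + sinh (A + B) * sinh w"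
    by (intro add_right_mono mult_left_mono cosh_real_ge_1) auto
  also have "\<dots> = cosh (A + B + w)" by (simp add: cosh_add)
  also have "A + B + w = 4 * sqrt V * fib (Suc (Suc k) + 1) - sqrt V"
    by (simp add: defs w_def algebra_simps)
  finally show ?case by (simp add: defs)
qed

section \<open>Bounded symmetric operators on \<open>ell2\<close>\<close>

lemma ell2_zero: "(\<lambda>x. 0) \<in> ell2"
  by (simp add: ell2_def)

lemma ell2_add:
  assumes "f \<in> ell2" "g \<in> ell2"
  shows "(\<lambda>x. f x + g x) \<in> ell2"
proof -
  have "(\<lambda>x. 2 * (cmod (f x))\<^sup>2 + 2 * (cmod (g x))\<^sup>2) summable_on UNIV"
    using assms unfolding ell2_def by (intro summable_on_add summable_on_cmult_right) auto
  moreover have "(cmod (f x + g x))\<^sup>2 \<le> 2 * (cmod (f x))\<^sup>2 + 2 * (cmod (g x))\<^sup>2" for x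
  proof -
    have "(cmod (f x + g x))\<^sup>2 \<le> (cmod (f x) + cmod (g x))\<^sup>2" by (intro power_mono norm_triangle_ineq) auto
    also have "\<dots> \<le> 2 * (cmod (f x))\<^sup>2 + 2 * (cmod (g x))\<^sup>2"
      using zero_le_power2[of "cmod (f x) - cmod (g x)"] by (simp add: power2_sum power2_diff)
    finally show ?thesis .
  qed
  ultimately show ?thesis unfolding ell2_def by (auto intro: summable_on_comparison_test)
qed

lemma ell2_bounded_mult:
  assumes "f \<in> ell2" and B: "\<And>x. cmod (q x) \<le> B"
  shows "(\<lambda>x. q x * f x) \<in> ell2"
proof -
  have "(\<lambda>x. B\<^sup>2 * (cmod (f x))\<^sup>2) summable_on UNIV"
    using assms unfolding ell2_def by (intro summable_on_cmult_right) auto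
  moreover have "(cmod (q x * f x))\<^sup>2 \<le> B\<^sup>2 * (cmod (f x))\<^sup>2" for x
    unfolding norm_mult power_mult_distrib using B[of x] by (intro mult_right_mono power_mono) auto
  ultimately show ?thesis unfolding ell2_def by (auto intro: summable_on_comparison_test)
qed

lemma ell2_cmult: "f \<in> ell2 \<Longrightarrow> (\<lambda>x. c * f x) \<in> ell2"
  by (rule ell2_bounded_mult[where B = "cmod c"]) auto

lemma ell2_uminus: "f \<in> ell2 \<Longrightarrow> (\<lambda>x. - f x) \<in> ell2"
  using ell2_cmult[of f "-1"] by simp

lemma ell2_diff: "f \<in> ell2 \<Longrightarrow> g \<in> ell2 \<Longrightarrow> (\<lambda>x. f x - g x) \<in> ell2"
  using ell2_add[OF _ ell2_uminus, of f g] by simp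

lemma ell2_reindex: "f \<in> ell2 \<Longrightarrow> bij g \<Longrightarrow> (\<lambda>x. f (g x)) \<in> ell2"
  unfolding ell2_def using summable_on_reindex_bij_betw[of g UNIV UNIV "\<lambda>x. (cmod (f x))\<^sup>2"] by auto

lemma ell2_inner_summable:
  assumes "f \<in> ell2" "g \<in> ell2"
  shows "(\<lambda>x. Re (f x * cnj (g x))) summable_on UNIV"
proof (rule abs_summable_summable)
  have "(\<lambda>x. (cmod (f x))\<^sup>2 + (cmod (g x))\<^sup>2) summable_on UNIV"
    using assms unfolding ell2_def by (intro summable_on_add) auto
  moreover have "norm (Re (f x * cnj (g x))) \<le> (cmod (f x))\<^sup>2 + (cmod (g x))\<^sup>2" for x
  proof -
    have "norm (Re (f x * cnj (g x))) \<le> cmod (f x) * cmod (g x)"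
      using abs_Re_le_cmod[of "f x * cnj (g x)"] by (simp add: norm_mult)
    also have "\<dots> \<le> (cmod (f x))\<^sup>2 + (cmod (g x))\<^sup>2"
    proof -
      have "0 \<le> (cmod (f x) - cmod (g x))\<^sup>2" "0 \<le> cmod (f x) * cmod (g x)" by simp_all
      then show ?thesis unfolding power2_diff by linarith
    qed
    finally show ?thesis .
  qed
  ultimately show "(\<lambda>x. norm (Re (f x * cnj (g x)))) summable_on UNIV"
    by (auto intro: summable_on_comparison_test)
qed

lemma ell2_finite_support: "finite {x. f x \<noteq> 0} \<Longrightarrow> f \<in> ell2"
  unfolding ell2_def
  by (auto intro!: finite_nonzero_values_imp_summable_on elim!: finite_subset[rotated])

section \<open>The Hilbert space as a type\<close>

typedef 'a l2 = "ell2 :: ('a \<Rightarrow> complex) set"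
  morphisms l2_fun Abs_l2
  using ell2_zero by blast

setup_lifting type_definition_l2

lemma l2_fun_ell2 [simp]: "l2_fun u \<in> ell2"
  using l2_fun by blast

instantiation l2 :: (type) real_inner
begin

lift_definition zero_l2 :: "'a l2" is "\<lambda>x. 0" by (rule ell2_zero)
lift_definition plus_l2 :: "'a l2 \<Rightarrow> 'a l2 \<Rightarrow> 'a l2" is "\<lambda>f g x. f x + g x" by (rule ell2_add)
lift_definition minus_l2 :: "'a l2 \<Rightarrow> 'a l2 \<Rightarrow> 'a l2" is "\<lambda>f g x. f x - g x" by (rule ell2_diff)
lift_definition uminus_l2 :: "'a l2 \<Rightarrow> 'a l2" is "\<lambda>f x. - f x" by (rule ell2_uminus)
lift_definition scaleR_l2 :: "real \<Rightarrow> 'a l2 \<Rightarrow> 'a l2" is "\<lambda>r f x. of_real r * f x" by (rule ell2_cmult)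
lift_definition inner_l2 :: "'a l2 \<Rightarrow> 'a l2 \<Rightarrow> real" is "\<lambda>f g. \<Sum>\<^sub>\<infinity>x. Re (f x * cnj (g x))" .

definition norm_l2 :: "'a l2 \<Rightarrow> real" where "norm_l2 u = sqrt (inner u u)"
definition dist_l2 :: "'a l2 \<Rightarrow> 'a l2 \<Rightarrow> real" where "dist_l2 u v = norm (u - v)"
definition sgn_l2 :: "'a l2 \<Rightarrow> 'a l2" where "sgn_l2 u = inverse (norm u) *\<^sub>R u"
definition uniformity_l2 :: "('a l2 \<times> 'a l2) filter" where
  "uniformity_l2 = (INF e\<in>{0<..}. principal {(u, v). dist u v < e})"
definition open_l2 :: "'a l2 set \<Rightarrow> bool" where
  "open_l2 U \<longleftrightarrow> (\<forall>u\<in>U. \<forall>\<^sub>F (u', v) in uniformity. u' = u \<longrightarrow> v \<in> U)"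

instance
proof
  fix u v w :: "'a l2" and r s :: real
  show "u + v + w = u + (v + w)" by transfer (simp add: add.assoc)
  show "u + v = v + u" by transfer (simp add: add.commute)
  show "0 + u = u" by transfer simp
  show "- u + u = 0" by transfer simp
  show "u - v = u + - v" by transfer simp
  show "r *\<^sub>R (u + v) = r *\<^sub>R u + r *\<^sub>R v" by transfer (simp add: distrib_left)
  show "(r + s) *\<^sub>R u = r *\<^sub>R u + s *\<^sub>R u" by transfer (simp add: distrib_right)
  show "r *\<^sub>R s *\<^sub>R u = (r * s) *\<^sub>R u" by transfer (simp add: mult.assoc)
  show "1 *\<^sub>R u = u" by transfer simp
  show "inner u v = inner v u" by transfer (simp add: mult.commute)
  show "inner (u + v) w = inner u w + inner v w"
    by transfer (simp only: distrib_right plus_complex.sel infsum_add[OF ell2_inner_summable ell2_inner_summable])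
  show "inner (r *\<^sub>R u) v = r * inner u v"
    by transfer (simp add: mult.assoc infsum_cmult_right'[symmetric] algebra_simps)
  show "0 \<le> inner u u"
    by transfer (auto intro!: infsum_nonneg)
  show "inner u u = 0 \<longleftrightarrow> u = 0"
  proof
    assume "inner u u = 0"
    then show "u = 0"
    proof transfer
      fix f :: "'a \<Rightarrow> complex" assume f: "f \<in> ell2" and 0: "(\<Sum>\<^sub>\<infinity>x. Re (f x * cnj (f x))) = 0"
      have "Re (f x * cnj (f x)) = 0" for x
        using nonneg_infsum_le_0D[OF _ ell2_inner_summable[OF f f], of x] 0 by auto
      then show "f = (\<lambda>x. 0)" by (auto simp: complex_eq_iff sum_squares_eq_zero_iff)
    qed
  qed (transfer, simp)
qed (auto simp: norm_l2_def dist_l2_def sgn_l2_def uniformity_l2_def open_l2_def)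

end

lemma l2_fun_simps [simp]:
  "l2_fun 0 = (\<lambda>x. 0)" "l2_fun (u + v) = (\<lambda>x. l2_fun u x + l2_fun v x)"
  "l2_fun (u - v) = (\<lambda>x. l2_fun u x - l2_fun v x)" "l2_fun (r *\<^sub>R u) = (\<lambda>x. of_real r * l2_fun u x)"
  by (transfer, simp)+

lemma Re_mult_cnj_self: "Re (z * cnj z) = (cmod z)\<^sup>2"
  by (metis Re_complex_of_real complex_norm_square)

lemma norm_l2_sq: "(norm u)\<^sup>2 = (\<Sum>\<^sub>\<infinity>x. (cmod (l2_fun u x))\<^sup>2)"
  by (simp only: power2_norm_eq_inner[of u] inner_l2.rep_eq Re_mult_cnj_self)

lemma norm_l2: "norm u = ell2_norm (l2_fun u)"
  unfolding ell2_norm_def norm_l2_sq[symmetric] by simp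

lemma norm_Abs_l2: "f \<in> ell2 \<Longrightarrow> norm (Abs_l2 f) = ell2_norm f"
  by (simp add: norm_l2 Abs_l2_inverse)

lemma finite_sum_le_norm:
  assumes "finite F" shows "(\<Sum>x\<in>F. (cmod (l2_fun u x))\<^sup>2) \<le> (norm u)\<^sup>2"
  unfolding norm_l2_sq using l2_fun_ell2[of u] assms
  by (intro finite_sum_le_infsum) (auto simp: ell2_def simp del: l2_fun_ell2)

lemma cmod_le_norm: "cmod (l2_fun u x) \<le> norm u"
  by (rule power2_le_imp_le) (use finite_sum_le_norm[of "{x}" u] in simp_all)

lemma ell2_boundedI:
  assumes "\<And>F. finite F \<Longrightarrow> (\<Sum>x\<in>F. (cmod (f x))\<^sup>2) \<le> B\<^sup>2" "B \<ge> 0"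
  shows "f \<in> ell2" "norm (Abs_l2 f) \<le> B"
proof -
  show f: "f \<in> ell2" unfolding ell2_def mem_Collect_eq
    by (rule nonneg_bdd_above_summable_on) (auto intro!: bdd_aboveI[of _ "B\<^sup>2"] assms)
  have "(norm (Abs_l2 f))\<^sup>2 \<le> B\<^sup>2"
    unfolding norm_l2_sq Abs_l2_inverse[OF f]
    using f by (intro infsum_le_finite_sums) (auto simp: ell2_def intro: assms)
  then show "norm (Abs_l2 f) \<le> B" using assms(2) by (rule power2_le_imp_le)
qed

instance l2 :: (type) complete_space
proof
  fix X :: "nat \<Rightarrow> 'a l2" assume X: "Cauchy X"
  have "Cauchy (\<lambda>n. l2_fun (X n) x)" for x
  proof (rule metric_CauchyI)
    fix e :: real assume "e > 0"
    then obtain M where M: "\<And>m n. m \<ge> M \<Longrightarrow> n \<ge> M \<Longrightarrow> dist (X m) (X n) < e" using metric_CauchyD[OF X] by metis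
    have "dist (l2_fun (X m) x) (l2_fun (X n) x) < e" if "m \<ge> M" "n \<ge> M" for m n
      using cmod_le_norm[of "X m - X n" x] M[OF that] by (simp add: dist_norm)
    then show "\<exists>M. \<forall>m\<ge>M. \<forall>n\<ge>M. dist (l2_fun (X m) x) (l2_fun (X n) x) < e" by blast
  qed
  then have "\<exists>l. (\<lambda>n. l2_fun (X n) x) \<longlonglongrightarrow> l" for x
    using Cauchy_convergent_iff convergent_def by blast
  then obtain f where f: "\<And>x. (\<lambda>n. l2_fun (X n) x) \<longlonglongrightarrow> f x" by metis
  \<comment> \<open>The Cauchy bound survives the pointwise limit because it is tested on finite
    sums only.\<close>
  have close: "(\<lambda>x. l2_fun (X n) x - f x) \<in> ell2 \<and> norm (Abs_l2 (\<lambda>x. l2_fun (X n) x - f x)) \<le> e"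
    if n: "n \<ge> M" and M: "\<And>m n. m \<ge> M \<Longrightarrow> n \<ge> M \<Longrightarrow> dist (X m) (X n) < e" and e: "e > 0" for n M e
  proof -
    have "(\<Sum>x\<in>F. (cmod (l2_fun (X n) x - f x))\<^sup>2) \<le> e\<^sup>2" if F: "finite F" for F
    proof (rule tendsto_upperbound)
      show "(\<lambda>m. \<Sum>x\<in>F. (cmod (l2_fun (X n) x - l2_fun (X m) x))\<^sup>2) \<longlonglongrightarrow> (\<Sum>x\<in>F. (cmod (l2_fun (X n) x - f x))\<^sup>2)"
        by (intro tendsto_intros f)
      have "(\<Sum>x\<in>F. (cmod (l2_fun (X n) x - l2_fun (X m) x))\<^sup>2) \<le> e\<^sup>2" if "m \<ge> M" for m
      proof -
        have "(\<Sum>x\<in>F. (cmod (l2_fun (X n) x - l2_fun (X m) x))\<^sup>2) \<le> (norm (X n - X m))\<^sup>2"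
          using finite_sum_le_norm[OF F, of "X n - X m"] by simp
        also have "\<dots> \<le> e\<^sup>2" using M[OF n that] by (intro power_mono) (auto simp: dist_norm)
        finally show ?thesis .
      qed
      then show "\<forall>\<^sub>F m in sequentially. (\<Sum>x\<in>F. (cmod (l2_fun (X n) x - l2_fun (X m) x))\<^sup>2) \<le> e\<^sup>2"
        by (auto simp: eventually_sequentially)
    qed simp
    then show ?thesis using ell2_boundedI[of "\<lambda>x. l2_fun (X n) x - f x" e] e by auto
  qed
  obtain M1 where M1: "\<And>m n. m \<ge> M1 \<Longrightarrow> n \<ge> M1 \<Longrightarrow> dist (X m) (X n) < 1" using metric_CauchyD[OF X, of 1] by auto
  have "(\<lambda>x. l2_fun (X M1) x - f x) \<in> ell2" using close[OF _ M1, of M1] by auto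
  from ell2_diff[OF l2_fun_ell2[of "X M1"] this] have fe: "f \<in> ell2" by simp
  have "X \<longlonglongrightarrow> Abs_l2 f"
  proof (rule metric_LIMSEQ_I)
    fix e :: real assume e: "e > 0"
    obtain M where M: "\<And>m n. m \<ge> M \<Longrightarrow> n \<ge> M \<Longrightarrow> dist (X m) (X n) < e/2"
      using metric_CauchyD[OF X, of "e/2"] e by auto
    have "dist (X n) (Abs_l2 f) < e" if n: "n \<ge> M" for n
    proof -
      have "l2_fun (X n - Abs_l2 f) = (\<lambda>x. l2_fun (X n) x - f x)"
        using fe by (simp add: Abs_l2_inverse)
      then have "X n - Abs_l2 f = Abs_l2 (\<lambda>x. l2_fun (X n) x - f x)"
        by (metis l2_fun_inverse)
      then have "dist (X n) (Abs_l2 f) \<le> e/2" using close[OF n M] e by (simp add: dist_norm)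
      then show ?thesis using e by simp
    qed
    then show "\<exists>no. \<forall>n\<ge>no. dist (X n) (Abs_l2 f) < e" by blast
  qed
  then show "convergent X" by (auto simp: convergent_def)
qed

text \<open>Multiplication by complex scalars, since the class \<open>real_inner\<close> only provides real ones.\<close>

lift_definition cs :: "complex \<Rightarrow> 'a l2 \<Rightarrow> 'a l2" is "\<lambda>c f x. c * f x" by (rule ell2_cmult)

lemma cs_simps: "cs z (u + v) = cs z u + cs z v" "cs z (u - v) = cs z u - cs z v" "cs z (cs w u) = cs (z * w) u"
  "cs (z + w) u = cs z u + cs w u" "cs (z - w) u = cs z u - cs w u" "cs (of_real r) u = r *\<^sub>R u" "cs z (r *\<^sub>R u) = r *\<^sub>R cs z u"
  by (transfer, simp add: algebra_simps)+

lemma norm_cs [simp]: "norm (cs z u) = cmod z * norm u"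
proof -
  have "(norm (cs z u))\<^sup>2 = (cmod z * norm u)\<^sup>2"
    by (simp only: norm_l2_sq power_mult_distrib) (simp add: cs.rep_eq norm_mult power_mult_distrib infsum_cmult_right')
  then show ?thesis by (simp add: power2_eq_iff_nonneg)
qed

lemma inner_cs_i: "inner (cs \<i> u) (cs \<i> v) = inner u v"
  by transfer (simp add: mult.commute)

lemma norm_diff_sq: "(norm (u - v))\<^sup>2 = (norm u)\<^sup>2 + (norm v)\<^sup>2 - 2 * inner u v" for u v :: "'h::real_inner"
  unfolding power2_norm_eq_inner by (simp add: inner_diff_left inner_diff_right inner_commute)

text \<open>Symmetry is stated for the real part of the inner product; applied to
  \<open>cs \<i> u\<close> it gives, by complex linearity, the imaginary part as well.\<close>

locale l2_symmetric =
  fixes T :: "'a l2 \<Rightarrow> 'a l2"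
  assumes T_add: "T (u + v) = T u + T v"
    and T_cs: "T (cs z u) = cs z (T u)"
    and T_bounded: "\<exists>C. \<forall>u. norm (T u) \<le> C * norm u"
    and T_sym: "inner (T u) v = inner u (T v)"
begin

lemma T_scaleR: "T (r *\<^sub>R u) = r *\<^sub>R T u"
  using T_cs[of "of_real r" u] by (simp add: cs_simps)

lemma T_diff: "T (u - v) = T u - T v"
  using T_add[of "u - v" v] by simp

lemma T_zero: "T 0 = 0"
  using T_diff[of 0 0] by simp

lemma bound_ge: obtains C where "C > 0" "\<And>u. norm (T u) \<le> C * norm u"
proof -
  obtain C where C: "\<And>u. norm (T u) \<le> C * norm u" using T_bounded by blast
  have "norm (T u) \<le> (\<bar>C\<bar> + 1) * norm u" for u
    by (rule order_trans[OF C mult_right_mono]) auto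
  then show ?thesis by (intro that[of "\<bar>C\<bar> + 1"]) auto
qed

text \<open>Both \<open>T u\<close>, by symmetry, and \<open>u\<close> are orthogonal to
  \<open>cs \<i> u\<close> for the real inner product, so Pythagoras separates the contribution of
  \<open>Im z\<close>.\<close>

lemma shift_ge_imag: "norm (T u - cs z u) \<ge> \<bar>Im z\<bar> * norm u"
proof -
  define y where "y = Im z"
  define w where "w = T u - (Re z) *\<^sub>R u"
  have i: "inner (T u) (cs \<i> u) = 0"
  proof -
    have "inner (T u) (cs \<i> u) = inner (cs \<i> (T u)) (cs \<i> (cs \<i> u))" by (simp add: inner_cs_i)
    also have "cs \<i> (cs \<i> u) = - u" by transfer simp
    also have "inner (cs \<i> (T u)) (- u) = - inner (T (cs \<i> u)) u" by (simp add: T_cs)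
    also have "\<dots> = - inner (T u) (cs \<i> u)" using T_sym[of "cs \<i> u" u] by (simp add: inner_commute)
    finally show ?thesis by simp
  qed
  have j: "inner u (cs \<i> u) = 0"
  proof -
    have "inner u (cs \<i> u) = inner (cs \<i> u) (cs \<i> (cs \<i> u))" by (simp add: inner_cs_i)
    also have "cs \<i> (cs \<i> u) = - u" by transfer simp
    finally show ?thesis by (simp add: inner_commute)
  qed
  have "T u - cs z u = w - y *\<^sub>R cs \<i> u"
  proof -
    have "cs z u = cs (of_real (Re z) + of_real y * \<i>) u" by (simp add: y_def complex_eq[symmetric] mult.commute)
    also have "\<dots> = Re z *\<^sub>R u + y *\<^sub>R cs \<i> u" by (simp only: cs_simps flip: cs_simps(3))
    finally show ?thesis by (simp add: w_def)
  qed
  then have "(norm (T u - cs z u))\<^sup>2 = (norm w)\<^sup>2 + (norm (y *\<^sub>R cs \<i> u))\<^sup>2 - 2 * inner w (y *\<^sub>R cs \<i> u)"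
    by (simp only: norm_diff_sq)
  also have "inner w (y *\<^sub>R cs \<i> u) = 0" using i j by (simp add: w_def inner_diff_left)
  finally have "(norm (T u - cs z u))\<^sup>2 = (norm w)\<^sup>2 + (\<bar>y\<bar> * norm u)\<^sup>2" by simp
  then have "(\<bar>y\<bar> * norm u)\<^sup>2 \<le> (norm (T u - cs z u))\<^sup>2" by simp
  then show ?thesis unfolding y_def by (rule power2_le_imp_le) simp
qed

text \<open>Method of continuity: solvability is propagated from far away down to \<open>z\<close> along a vertical ray,
  on which the operator stays uniformly bounded below.\<close>

lemma bounded_below_surj:
  assumes c: "c > 0" "\<And>u. c * norm u \<le> norm (T u - cs z u)"
  shows "\<exists>u. T u - cs z u = f"
proof -
  obtain C where C: "C > 0" "\<And>u. norm (T u) \<le> C * norm u" using bound_ge by blast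
  \<comment> \<open>The ray leads away from the real axis, so that
    \<open>\<bar>Im (w y)\<bar> \<ge> y\<close> along it.\<close>
  define s :: real where "s = (if Im z \<ge> 0 then 1 else - 1)"
  define w where "w y = z + of_real (s * y) * \<i>" for y
  have below: "c / 2 * norm u \<le> norm (T u - cs (w y) u)" if y: "y \<ge> 0" for y u
  proof (cases "y \<le> c / 2")
    case True
    have eq: "T u - cs (w y) u = (T u - cs z u) - cs (of_real (s * y) * \<i>) u"
      by (simp add: w_def cs_simps)
    have "norm (T u - cs (w y) u) \<ge> norm (T u - cs z u) - norm (cs (of_real (s * y) * \<i>) u)"
      unfolding eq by (rule norm_triangle_ineq2)
    moreover have "norm (cs (of_real (s * y) * \<i>) u) = y * norm u" using y by (simp add: s_def norm_mult)
    moreover have "y * norm u \<le> c / 2 * norm u" using True by (intro mult_right_mono) auto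
    ultimately show ?thesis using c(2)[of u] by linarith
  next
    case False
    have "\<bar>Im (w y)\<bar> \<ge> y" using y by (auto simp: w_def s_def)
    then have "c / 2 * norm u \<le> \<bar>Im (w y)\<bar> * norm u" using False by (intro mult_right_mono) auto
    then show ?thesis using shift_ge_imag[of "w y" u] by linarith
  qed
  define Y where "Y = C + cmod z + 1"
  \<comment> \<open>At height \<open>Y\<close> the bound \<open>C\<close> of \<open>T\<close> is
    below \<open>cmod (w y)\<close>, and a fixed point iteration solves the equation. Every further
    step descends by \<open>c / 4\<close> against the lower bound \<open>c / 2\<close>, which gives
    a contraction with factor 1/2.\<close>
  have surj: "\<forall>f. \<exists>u. T u - cs (w y) u = f" if "y \<ge> 0" "y \<ge> Y - real n * (c / 4)" for n y
    using that
  proof (induction n arbitrary: y)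
    case 0
    have wy: "cmod (w y) \<ge> C + 1"
    proof -
      have "y = cmod (of_real (s * y) * \<i>)" using 0 by (simp add: s_def norm_mult)
      also have "\<dots> \<le> cmod (w y) + cmod z" using norm_triangle_ineq4[of "w y" z] by (simp add: w_def)
      finally show ?thesis using 0 by (simp add: Y_def)
    qed
    then have w0: "w y \<noteq> 0" using C by auto
    show ?case
    proof
      fix f
      define K where "K u = cs (1 / w y) (T u - f)" for u
      have "\<exists>!u. K u = u"
      proof (rule banach_fix_type[where c = "C / (C + 1)"])
        show "\<forall>u v. dist (K u) (K v) \<le> C / (C + 1) * dist u v"
        proof (intro allI)
          fix u v
          have "dist (K u) (K v) = norm (T (u - v)) / cmod (w y)"
            by (simp add: K_def dist_norm cs_simps(2)[symmetric] T_diff norm_divide)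
          also have "\<dots> \<le> C * norm (u - v) / (C + 1)"
            using C wy by (intro frac_le) auto
          finally show "dist (K u) (K v) \<le> C / (C + 1) * dist u v" by (simp add: dist_norm)
        qed
      qed (use C in auto)
      then obtain u where "K u = u" by auto
      then have "cs (w y) u = cs (w y) (cs (1 / w y) (T u - f))" by (simp only: K_def)
      also have "\<dots> = T u - f" using w0 cs_simps(6)[of 1 "T u - f"] by (simp add: cs_simps(3))
      finally have "cs (w y) u = T u - f" .
      then show "\<exists>u. T u - cs (w y) u = f" by (intro exI[of _ u]) simp
    qed
  next
    case (Suc n)
    define y0 where "y0 = y + c / 4"
    have y0: "y0 \<ge> 0" using Suc c by (simp add: y0_def)
    have "\<forall>f. \<exists>u. T u - cs (w y0) u = f"
      using Suc c by (intro Suc.IH) (auto simp: y0_def field_simps)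
    then obtain S where S: "\<And>f. T (S f) - cs (w y0) (S f) = f" by metis
    have S_diff: "c / 2 * norm (S f - S g) \<le> norm (f - g)" for f g
    proof -
      have "f - g = T (S f - S g) - cs (w y0) (S f - S g)"
        using S[of f] S[of g] by (simp add: T_diff cs_simps algebra_simps)
      then show ?thesis using below[OF y0, of "S f - S g"] by simp
    qed
    have ww: "w y - w y0 = of_real (- s * c / 4) * \<i>" by (simp add: w_def y0_def algebra_simps)
    have cww: "cmod (w y - w y0) = c / 4" unfolding ww using c by (simp add: norm_mult s_def)
    show ?case
    proof
      fix f
      define K where "K u = S (f + cs (w y - w y0) u)" for u
      have "\<exists>!u. K u = u"
      proof (rule banach_fix_type[where c = "1/2"])
        show "\<forall>u v. dist (K u) (K v) \<le> 1/2 * dist u v"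
        proof (intro allI)
          fix u v
          have "c / 2 * norm (K u - K v) \<le> norm (cs (w y - w y0) (u - v))"
            using S_diff[of "f + cs (w y - w y0) u" "f + cs (w y - w y0) v"]
            by (simp add: K_def cs_simps(2))
          also have "\<dots> = c / 4 * norm (u - v)" by (simp add: cww)
          finally have "c * (2 * norm (K u - K v)) \<le> c * norm (u - v)" by simp
          then have "2 * norm (K u - K v) \<le> norm (u - v)" using c by (simp only: mult_le_cancel_left_pos)
          then show "dist (K u) (K v) \<le> 1/2 * dist u v" by (simp add: dist_norm)
        qed
      qed auto
      then obtain u where "K u = u" by auto
      then have "T u - cs (w y0) u = f + cs (w y - w y0) u" using S[of "f + cs (w y - w y0) u"] by (simp add: K_def)
      then show "\<exists>u. T u - cs (w y) u = f" by (intro exI[of _ u]) (simp add: cs_simps algebra_simps)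
    qed
  qed
  have "\<exists>n. Y < real n * (c / 4)" using reals_Archimedean3[of "c / 4"] c(1) by simp
  then obtain n where "Y < real n * (c / 4)" ..
  then have "0 \<ge> Y - real n * (c / 4)" by linarith
  then show ?thesis using surj[of 0 n] by (simp add: w_def)
qed

end

text \<open>The strict inequality excludes \<open>u = 0\<close>.\<close>

definition approx_ev :: "('a l2 \<Rightarrow> 'a l2) \<Rightarrow> real \<Rightarrow> bool" where
  "approx_ev T E \<longleftrightarrow> (\<forall>\<epsilon>>0. \<exists>u. norm (T u - E *\<^sub>R u) < \<epsilon> * norm u)"

text \<open>Positivity is tested at \<open>u - (1 / C) *\<^sub>R A u\<close>. The point is that for
  a positive operator a small quadratic form forces a small image.\<close>

lemma psd_norm_bound:
  fixes A :: "'h::real_inner \<Rightarrow> 'h"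
  assumes diff: "\<And>u v. A (u - v) = A u - A v" and scale: "\<And>r u. A (r *\<^sub>R u) = r *\<^sub>R A u"
    and sym: "\<And>u v. inner (A u) v = inner u (A v)" and pos: "\<And>u. inner (A u) u \<ge> 0"
    and C: "C > 0" "\<And>u. norm (A u) \<le> C * norm u"
  shows "(norm (A u))\<^sup>2 \<le> C * inner (A u) u"
proof -
  define w where "w = u - (1 / C) *\<^sub>R A u"
  have "0 \<le> inner (A w) w" by (rule pos)
  also have "\<dots> = inner (A u) u - 2 / C * (norm (A u))\<^sup>2 + inner (A (A u)) (A u) / C\<^sup>2"
    using sym[of "A u" u] unfolding power2_norm_eq_inner
    by (simp add: w_def diff scale inner_diff_left inner_diff_right power2_eq_square inner_commute)
  also have "inner (A (A u)) (A u) \<le> norm (A (A u)) * norm (A u)" by (rule norm_cauchy_schwarz)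
  also have "\<dots> \<le> C * norm (A u) * norm (A u)" by (intro mult_right_mono C) auto
  finally have "0 \<le> inner (A u) u - 2 / C * (norm (A u))\<^sup>2 + C * norm (A u) * norm (A u) / C\<^sup>2"
    by (simp add: divide_right_mono)
  also have "\<dots> = inner (A u) u - (norm (A u))\<^sup>2 / C" using C by (simp add: field_simps power2_eq_square)
  finally show ?thesis using C by (simp add: field_simps)
qed

lemma Inf_ratio:
  fixes N D :: "'b \<Rightarrow> real"
  assumes ne: "D v0 > 0" and low: "\<And>v. b * D v \<le> N v" and nonneg: "\<And>v. D v \<ge> 0"
  obtains c where "b \<le> c" "\<And>v. D v > 0 \<Longrightarrow> c * D v \<le> N v" "\<And>\<epsilon>. \<epsilon> > 0 \<Longrightarrow> \<exists>v. D v > 0 \<and> N v < (c + \<epsilon>) * D v"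
proof -
  define S where "S = {N v / D v |v. D v > 0}"
  have ge: "b \<le> x" if "x \<in> S" for x using that low by (auto simp: S_def pos_le_divide_eq)
  have S: "S \<noteq> {}" "bdd_below S"
    using ne by (auto simp: S_def)[1] (rule bdd_belowI[OF ge])
  show ?thesis
  proof (rule that[of "Inf S"])
    show "b \<le> Inf S" by (rule cInf_greatest[OF S(1) ge])
    show "Inf S * D v \<le> N v" if "D v > 0" for v
    proof -
      have "Inf S \<le> N v / D v" using that by (intro cInf_lower S) (auto simp: S_def)
      then show ?thesis using that by (simp add: pos_le_divide_eq)
    qed
    show "\<exists>v. D v > 0 \<and> N v < (Inf S + \<epsilon>) * D v" if "\<epsilon> > 0" for \<epsilon>
    proof -
      have "Inf S < Inf S + \<epsilon>" using that by simp
      then obtain x where "x \<in> S" "x < Inf S + \<epsilon>" using cInf_lessD[OF S(1)] by blast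
      then show ?thesis by (auto simp: S_def pos_divide_less_eq)
    qed
  qed
qed

lemma l2_nontrivial: "\<exists>u::'a l2. u \<noteq> 0"
proof -
  define f :: "'a \<Rightarrow> complex" where "f = (\<lambda>x. if x = undefined then 1 else 0)"
  have "f \<in> ell2" by (rule ell2_finite_support) (simp add: f_def)
  then have "l2_fun (Abs_l2 f) = f" by (rule Abs_l2_inverse)
  moreover have "f undefined \<noteq> 0" by (simp add: f_def)
  ultimately have "Abs_l2 f \<noteq> 0" by auto
  then show ?thesis ..
qed

context l2_symmetric
begin

lemma shift_props:
  fixes E :: real
  defines "B \<equiv> \<lambda>u. T u - E *\<^sub>R u"
  shows "B (u - v) = B u - B v" "B (r *\<^sub>R u) = r *\<^sub>R B u" "inner (B u) v = inner u (B v)"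
    "\<exists>C>0. \<forall>u. norm (B u) \<le> C * norm u"
proof -
  show "B (u - v) = B u - B v" "B (r *\<^sub>R u) = r *\<^sub>R B u"
    by (simp_all add: B_def T_diff T_scaleR algebra_simps)
  show "inner (B u) v = inner u (B v)"
    by (simp add: B_def inner_diff_left inner_diff_right T_sym)
  obtain C where C: "C > 0" "\<And>u. norm (T u) \<le> C * norm u" using bound_ge by blast
  have "norm (B u) \<le> (C + \<bar>E\<bar>) * norm u" for u
    using norm_triangle_ineq4[of "T u" "E *\<^sub>R u"] C(2)[of u] by (simp add: B_def distrib_right)
  then show "\<exists>C>0. \<forall>u. norm (B u) \<le> C * norm u" using C by (intro exI[of _ "C + \<bar>E\<bar>"]) auto
qed

lemma not_approx_ev:
  assumes "\<not> approx_ev T E"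
  obtains \<epsilon> where "\<epsilon> > 0" "\<And>u. \<epsilon> * norm u \<le> norm (T u - E *\<^sub>R u)"
  using assms unfolding approx_ev_def by (meson linorder_not_le)

text \<open>\<open>E\<close> is the infimum of the Rayleigh quotients. At near minimisers the form
  of the positive operator \<open>T - E\<close> is small, and \<open>psd_norm_bound\<close> makes
  them approximate eigenvectors.\<close>

lemma approx_ev_bottom:
  "\<exists>E. approx_ev T E \<and> (\<forall>v. E * (norm v)\<^sup>2 \<le> inner (T v) v)"
proof -
  obtain v0 :: "'a l2" where "v0 \<noteq> 0" using l2_nontrivial by blast
  then have v0: "(norm v0)\<^sup>2 > 0" by simp
  obtain C0 where C0: "C0 > 0" "\<And>u. norm (T u) \<le> C0 * norm u" using bound_ge by blast
  have bd: "- C0 * (norm v)\<^sup>2 \<le> inner (T v) v" for v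
  proof -
    have "\<bar>inner (T v) v\<bar> \<le> norm (T v) * norm v" by (rule Cauchy_Schwarz_ineq2)
    also have "\<dots> \<le> C0 * norm v * norm v" by (intro mult_right_mono C0) auto
    finally show ?thesis by (simp add: power2_eq_square)
  qed
  obtain E where E: "\<And>v. (norm v)\<^sup>2 > 0 \<Longrightarrow> E * (norm v)\<^sup>2 \<le> inner (T v) v"
    "\<And>\<epsilon>. \<epsilon> > 0 \<Longrightarrow> \<exists>v. (norm v)\<^sup>2 > 0 \<and> inner (T v) v < (E + \<epsilon>) * (norm v)\<^sup>2"
    using Inf_ratio[of "\<lambda>v. (norm v)\<^sup>2" v0 "- C0" "\<lambda>v. inner (T v) v"] v0 bd by (metis zero_le_power2)
  have low: "E * (norm v)\<^sup>2 \<le> inner (T v) v" for v using E(1)[of v] by (cases "v = 0") (auto simp: T_zero)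
  define B where "B v = T v - E *\<^sub>R v" for v
  note B = shift_props[where E = E, folded B_def]
  obtain C where C: "C > 0" "\<And>v. norm (B v) \<le> C * norm v" using B(4) by blast
  have iB: "inner (B v) v = inner (T v) v - E * (norm v)\<^sup>2" for v
    by (simp add: B_def inner_diff_left power2_norm_eq_inner)
  have psd: "(norm (B v))\<^sup>2 \<le> C * inner (B v) v" for v
    by (rule psd_norm_bound[OF B(1,2,3) _ C]) (use low in \<open>simp add: iB\<close>)
  have "approx_ev T E"
    unfolding approx_ev_def
  proof (intro allI impI)
    fix \<epsilon> :: real assume \<epsilon>: "\<epsilon> > 0"
    then have "\<epsilon>\<^sup>2 / C > 0" using C by simp
    then obtain v where v: "(norm v)\<^sup>2 > 0" "inner (T v) v < (E + \<epsilon>\<^sup>2 / C) * (norm v)\<^sup>2" using E(2) by blast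
    have "(norm (B v))\<^sup>2 \<le> C * inner (B v) v" by (rule psd)
    also have "\<dots> < C * (\<epsilon>\<^sup>2 / C * (norm v)\<^sup>2)"
      using v(2) C(1) by (intro mult_strict_left_mono) (auto simp: iB distrib_right)
    also have "\<dots> = (\<epsilon> * norm v)\<^sup>2" using C by (simp add: power_mult_distrib)
    finally have "norm (B v) < \<epsilon> * norm v" by (rule power2_less_imp_less) (use \<epsilon> in simp)
    then show "\<exists>u. norm (T u - E *\<^sub>R u) < \<epsilon> * norm u" by (auto simp: B_def)
  qed
  then show ?thesis using low by blast
qed

end

lemma l2_symmetric_uminus: "l2_symmetric T \<Longrightarrow> l2_symmetric (\<lambda>u. - T u)"
proof -
  assume "l2_symmetric T"
  then interpret l2_symmetric T .
  have *: "cs z (- u) = - cs z u" for z and u :: "'a l2" by transfer simp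
  show ?thesis by standard (auto simp: T_add T_cs T_sym * intro: T_bounded)
qed

lemma (in l2_symmetric) approx_ev_top:
  "\<exists>E. approx_ev T E \<and> (\<forall>v. inner (T v) v \<le> E * (norm v)\<^sup>2)"
proof -
  interpret neg: l2_symmetric "\<lambda>u. - T u" by (rule l2_symmetric_uminus) unfold_locales
  obtain E where E: "approx_ev (\<lambda>u. - T u) E" "\<And>v. E * (norm v)\<^sup>2 \<le> inner (- T v) v"
    using neg.approx_ev_bottom by blast
  have "norm (- T u - E *\<^sub>R u) = norm (T u - (- E) *\<^sub>R u)" for u
    using norm_minus_commute[of "- T u" "E *\<^sub>R u"] by (simp add: add.commute)
  then have "approx_ev T (- E)" using E(1) by (simp add: approx_ev_def)
  moreover have "inner (T v) v \<le> - E * (norm v)\<^sup>2" for v using E(2)[of v] by simp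
  ultimately show ?thesis by blast
qed

lemma approx_ev_ge:
  assumes "approx_ev T E" and low: "\<And>u. a * (norm u)\<^sup>2 \<le> inner (T u) u"
  shows "a \<le> E"
proof (rule ccontr)
  assume "\<not> ?thesis"
  then have "a - E > 0" by simp
  then obtain u where u: "norm (T u - E *\<^sub>R u) < (a - E) * norm u" using assms(1) unfolding approx_ev_def by blast
  have "(a - E) * (norm u)\<^sup>2 \<le> inner (T u - E *\<^sub>R u) u"
    using low[of u] by (simp add: inner_diff_left power2_norm_eq_inner algebra_simps)
  also have "\<dots> \<le> norm (T u - E *\<^sub>R u) * norm u" by (rule norm_cauchy_schwarz)
  finally have "(a - E) * norm u * norm u \<le> norm (T u - E *\<^sub>R u) * norm u" by (simp add: power2_eq_square)
  moreover have "norm u > 0" using u by (metis mult_zero_right norm_ge_zero not_less zero_less_norm_iff norm_eq_zero)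
  ultimately show False using u by simp
qed

lemma approx_ev_le:
  assumes "approx_ev T E" and up: "\<And>u. inner (T u) u \<le> b * (norm u)\<^sup>2"
  shows "E \<le> b"
proof -
  have "norm (- T u - (- E) *\<^sub>R u) = norm (T u - E *\<^sub>R u)" for u
    using norm_minus_commute[of "T u" "E *\<^sub>R u"] by simp
  then have "approx_ev (\<lambda>u. - T u) (- E)" using assms(1) by (simp add: approx_ev_def)
  then have "- b \<le> - E" by (rule approx_ev_ge) (use up in simp)
  then show ?thesis by simp
qed

lemma l2_symmetric_square: "l2_symmetric T \<Longrightarrow> l2_symmetric (\<lambda>u. T (T u))"
proof -
  assume "l2_symmetric T"
  then interpret l2_symmetric T .
  obtain C where C: "C > 0" "\<And>u. norm (T u) \<le> C * norm u" using bound_ge by blast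
  have "norm (T (T u)) \<le> C * C * norm u" for u
    using order_trans[OF C(2)[of "T u"] mult_left_mono[OF C(2)[of u]]] C(1) by (simp add: mult.assoc)
  then show ?thesis by unfold_locales (auto simp: T_add T_cs T_sym)
qed

lemma (in l2_symmetric) l2_symmetric_shift: "l2_symmetric (\<lambda>u. T u - E *\<^sub>R u)"
proof
  show "T (u + v) - E *\<^sub>R (u + v) = T u - E *\<^sub>R u + (T v - E *\<^sub>R v)" for u v
    by (simp add: T_add algebra_simps)
  show "T (cs z u) - E *\<^sub>R cs z u = cs z (T u - E *\<^sub>R u)" for z u
    by (simp add: T_cs cs_simps(2,7))
qed (use shift_props(3,4)[where E = E] in auto)

text \<open>The bottom \<open>s\<close> of the positive operator \<open>(T - E)\<^sup>2\<close> is an approximate eigenvalue, and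
  \<open>(T - E)\<^sup>2 - s\<close> is the product of \<open>T - (E + sqrt s)\<close> and \<open>T - (E - sqrt s)\<close>.\<close>

lemma (in l2_symmetric) approx_ev_near:
  assumes u: "norm (T u - E *\<^sub>R u) < \<eta> * norm u"
  shows "\<exists>E'. \<bar>E' - E\<bar> < \<eta> \<and> approx_ev T E'"
proof (rule ccontr)
  assume neg: "\<not> ?thesis"
  define B where "B v = T v - E *\<^sub>R v" for v
  interpret B: l2_symmetric B unfolding B_def[abs_def] by (rule l2_symmetric_shift)
  interpret S: l2_symmetric "\<lambda>v. B (B v)" by (rule l2_symmetric_square) unfold_locales
  obtain s where s: "approx_ev (\<lambda>v. B (B v)) s" "\<And>v. s * (norm v)\<^sup>2 \<le> inner (B (B v)) v"
    using S.approx_ev_bottom by blast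
  have iS: "inner (B (B v)) v = (norm (B v))\<^sup>2" for v by (simp add: B.T_sym power2_norm_eq_inner)
  have s0: "0 \<le> s" by (rule approx_ev_ge[OF s(1)]) (simp add: iS)
  have pos: "norm u > 0" "\<eta> > 0"
    using le_less_trans[OF norm_ge_zero u] by (auto simp: zero_less_mult_iff)
  have "s * (norm u)\<^sup>2 \<le> (norm (B u))\<^sup>2" using s(2)[of u] by (simp only: iS)
  also have "\<dots> < (\<eta> * norm u)\<^sup>2" using u by (intro power_strict_mono) (simp_all add: B_def)
  finally have "s < \<eta>\<^sup>2" using pos by (simp add: power_mult_distrib)
  define c where "c = sqrt s"
  have c: "0 \<le> c" "c\<^sup>2 = s" using s0 by (simp_all add: c_def)
  have "c < \<eta>" by (rule power2_less_imp_less) (use \<open>s < \<eta>\<^sup>2\<close> c pos in simp_all)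
  then have "\<not> approx_ev T (E + c)" "\<not> approx_ev T (E - c)" using neg c by auto
  then obtain \<epsilon>1 \<epsilon>2 where \<epsilon>: "\<epsilon>1 > 0" "\<epsilon>2 > 0" "\<And>v. \<epsilon>1 * norm v \<le> norm (T v - (E + c) *\<^sub>R v)"
    "\<And>v. \<epsilon>2 * norm v \<le> norm (T v - (E - c) *\<^sub>R v)"
    using not_approx_ev[of "E + c"] not_approx_ev[of "E - c"] by metis
  obtain v where v: "norm (B (B v) - s *\<^sub>R v) < \<epsilon>1 * \<epsilon>2 * norm v"
    using s(1) mult_pos_pos[OF \<epsilon>(1,2)] unfolding approx_ev_def by blast
  define w where "w = T v - (E - c) *\<^sub>R v"
  have "B (B v) - s *\<^sub>R v = T w - (E + c) *\<^sub>R w"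
    unfolding c(2)[symmetric]
    by (simp add: B_def w_def T_diff T_add T_scaleR algebra_simps power2_eq_square)
  then have "norm (B (B v) - s *\<^sub>R v) \<ge> \<epsilon>1 * norm w" using \<epsilon>(3) by simp
  moreover have "\<epsilon>1 * (\<epsilon>2 * norm v) \<le> \<epsilon>1 * norm w" unfolding w_def using \<epsilon> by (intro mult_left_mono) auto
  ultimately show False using v by simp
qed

definition l2_op :: "(('a \<Rightarrow> complex) \<Rightarrow> ('a \<Rightarrow> complex)) \<Rightarrow> 'a l2 \<Rightarrow> 'a l2" where
  "l2_op F u = Abs_l2 (F (l2_fun u))"

text \<open>A lower bound for \<open>T - z\<close> gives surjectivity by
  \<open>bounded_below_surj\<close> and hence a bounded inverse; conversely a bounded inverse
  forbids approximate eigenvectors. Nonreal \<open>z\<close> always have the lower bound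
  \<open>\<bar>Im z\<bar>\<close>, so only real points remain.\<close>

lemma spectrum_symmetric:
  fixes F :: "('a \<Rightarrow> complex) \<Rightarrow> ('a \<Rightarrow> complex)"
  assumes F: "\<And>f. f \<in> ell2 \<Longrightarrow> F f \<in> ell2" and sym: "l2_symmetric (l2_op F)"
  shows "spectrum F = complex_of_real ` {E. approx_ev (l2_op F) E}"
proof -
  define T where "T = l2_op F"
  interpret l2_symmetric T using sym by (simp add: T_def)
  have TF: "l2_fun (T u) = F (l2_fun u)" for u using F[of "l2_fun u"] by (simp add: T_def l2_op_def Abs_l2_inverse)
  have TFz: "l2_fun (T u - cs z u) = (\<lambda>x. F (l2_fun u) x - z * l2_fun u x)" for u z
    by (simp add: TF cs.rep_eq)
  have inv: "l2_fun (Abs_l2 f) = f" if "f \<in> ell2" for f :: "'a \<Rightarrow> complex" using that by (rule Abs_l2_inverse)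
  have resolvent: "z \<notin> spectrum F" if c: "c > 0" "\<And>u. c * norm u \<le> norm (T u - cs z u)" for z c
  proof -
    have "\<exists>S. \<forall>f. T (S f) - cs z (S f) = f" using bounded_below_surj[OF c] by metis
    then obtain S where S: "\<And>f. T (S f) - cs z (S f) = f" by blast
    have uniq: "u = v" if "T u - cs z u = T v - cs z v" for u v
    proof -
      have "T (u - v) - cs z (u - v) = 0" using that by (simp add: T_diff cs_simps(2) algebra_simps)
      then have "c * norm (u - v) \<le> 0" using c(2)[of "u - v"] by simp
      then show ?thesis using c(1) by (simp add: mult_le_0_iff)
    qed
    define R where "R f = l2_fun (S (Abs_l2 f))" for f
    have S_add: "S (f + g) = S f + S g" for f g
    proof (rule uniq)
      have "T (S f + S g) - cs z (S f + S g) = (T (S f) - cs z (S f)) + (T (S g) - cs z (S g))"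
        by (simp add: T_add cs_simps(1))
      then show "T (S (f + g)) - cs z (S (f + g)) = T (S f + S g) - cs z (S f + S g)" by (simp only: S)
    qed
    have S_cs: "S (cs w f) = cs w (S f)" for w f
    proof (rule uniq)
      have "T (cs w (S f)) - cs z (cs w (S f)) = cs w (T (S f) - cs z (S f))"
        by (simp add: T_cs cs_simps(2,3) mult.commute)
      then show "T (S (cs w f)) - cs z (S (cs w f)) = T (cs w (S f)) - cs z (cs w (S f))" by (simp only: S)
    qed
    have "bounded_operator R"
      unfolding bounded_operator_def
    proof (intro conjI ballI allI)
      show "R f \<in> ell2" for f by (simp add: R_def)
      show "R (\<lambda>x. f x + g x) = (\<lambda>x. R f x + R g x)" if "f \<in> ell2" "g \<in> ell2" for f g
      proof -
        have "Abs_l2 (\<lambda>x. f x + g x) = Abs_l2 f + Abs_l2 g"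
          using that by (simp add: plus_l2.abs_eq eq_onp_same_args)
        then show ?thesis by (simp add: R_def S_add)
      qed
      show "R (\<lambda>x. w * f x) = (\<lambda>x. w * R f x)" if "f \<in> ell2" for w f
      proof -
        have "Abs_l2 (\<lambda>x. w * f x) = cs w (Abs_l2 f)"
          using that by (simp add: cs.abs_eq eq_onp_same_args)
        then show ?thesis by (simp add: R_def S_cs cs.rep_eq)
      qed
      have "ell2_norm (R f) \<le> 1 / c * ell2_norm f" if "f \<in> ell2" for f
        using c(2)[of "S (Abs_l2 f)"] c(1)
        by (simp add: S R_def norm_l2[symmetric] norm_Abs_l2[OF that, symmetric] field_simps)
      then show "\<exists>C. \<forall>f\<in>ell2. ell2_norm (R f) \<le> C * ell2_norm f" by blast
    qed
    moreover have "R (\<lambda>x. F f x - z * f x) = f" if f: "f \<in> ell2" for f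
    proof -
      have "(\<lambda>x. F f x - z * f x) = l2_fun (T (Abs_l2 f) - cs z (Abs_l2 f))" by (simp only: TFz inv[OF f])
      then have "R (\<lambda>x. F f x - z * f x) = l2_fun (S (T (Abs_l2 f) - cs z (Abs_l2 f)))"
        by (simp only: R_def l2_fun_inverse)
      also have "S (T (Abs_l2 f) - cs z (Abs_l2 f)) = Abs_l2 f" by (rule uniq) (rule S)
      finally show ?thesis by (simp only: inv[OF f])
    qed
    moreover have "(\<lambda>x. F (R f) x - z * R f x) = f" if f: "f \<in> ell2" for f
      using TFz[of "S (Abs_l2 f)" z] by (simp only: R_def S inv[OF f])
    ultimately show ?thesis unfolding spectrum_def by blast
  qed
  have sub: "z \<in> complex_of_real ` {E. approx_ev T E}" if z: "z \<in> spectrum F" for z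
  proof -
    have "Im z = 0" using z resolvent[OF _ shift_ge_imag, of z] by auto
    then have zE: "z = of_real (Re z)" by (simp add: complex_eq_iff)
    have "approx_ev T (Re z)"
    proof (rule ccontr)
      assume "\<not> ?thesis"
      then obtain \<epsilon> where "\<epsilon> > 0" "\<And>u. \<epsilon> * norm u \<le> norm (T u - Re z *\<^sub>R u)" using not_approx_ev by blast
      moreover have "cs z u = Re z *\<^sub>R u" for u :: "'a l2" by (subst zE) (rule cs_simps)
      ultimately have "z \<notin> spectrum F" using resolvent[of \<epsilon> z] by simp
      then show False using z by simp
    qed
    then show ?thesis using zE by blast
  qed
  have "complex_of_real E \<in> spectrum F" if E: "approx_ev T E" for E
  proof (rule ccontr)
    assume "\<not> ?thesis"
    then obtain R where R: "bounded_operator R" "\<And>f. f \<in> ell2 \<Longrightarrow> R (\<lambda>x. F f x - of_real E * f x) = f"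
      unfolding spectrum_def by blast
    then obtain C where C: "\<And>f. f \<in> ell2 \<Longrightarrow> ell2_norm (R f) \<le> C * ell2_norm f"
      unfolding bounded_operator_def by blast
    have low: "norm u \<le> (\<bar>C\<bar> + 1) * norm (T u - E *\<^sub>R u)" for u
    proof -
      have "norm u = ell2_norm (R (l2_fun (T u - E *\<^sub>R u)))"
        using R(2)[of "l2_fun u"] TFz[of u "of_real E"] by (simp add: norm_l2 TF)
      also have "\<dots> \<le> C * norm (T u - E *\<^sub>R u)" using C[OF l2_fun_ell2, of "T u - E *\<^sub>R u"] by (simp only: norm_l2)
      also have "\<dots> \<le> (\<bar>C\<bar> + 1) * norm (T u - E *\<^sub>R u)" by (intro mult_right_mono) auto
      finally show ?thesis .
    qed
    have "1 / (\<bar>C\<bar> + 1) > 0" by simp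
    then obtain u where u: "norm (T u - E *\<^sub>R u) < 1 / (\<bar>C\<bar> + 1) * norm u"
      using E unfolding approx_ev_def by blast
    have "(\<bar>C\<bar> + 1) * norm (T u - E *\<^sub>R u) < (\<bar>C\<bar> + 1) * (1 / (\<bar>C\<bar> + 1) * norm u)"
      by (rule mult_strict_left_mono[OF u]) simp
    then show False using low[of u] by simp
  qed
  then show ?thesis using sub by (auto simp: T_def)
qed

section \<open>Schroedinger operators on the integers\<close>

lemma ell2_l2_fun_eqI: "l2_fun u = l2_fun v \<Longrightarrow> u = v"
  by (simp add: l2_fun_inject)

definition reidx :: "('a \<Rightarrow> 'a) \<Rightarrow> 'a l2 \<Rightarrow> 'a l2" where
  "reidx g u = Abs_l2 (\<lambda>x. l2_fun u (g x))"

lemma l2_fun_reidx: "bij g \<Longrightarrow> l2_fun (reidx g u) = (\<lambda>x. l2_fun u (g x))"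
  unfolding reidx_def by (rule Abs_l2_inverse[OF ell2_reindex[OF l2_fun_ell2]])

lemma norm_reidx: "bij g \<Longrightarrow> norm (reidx g u) = norm u"
proof -
  assume g: "bij g"
  have "(norm (reidx g u))\<^sup>2 = (norm u)\<^sup>2"
    unfolding norm_l2_sq l2_fun_reidx[OF g] using infsum_reindex_bij_betw[of g UNIV UNIV "\<lambda>x. (cmod (l2_fun u x))\<^sup>2"] g by simp
  then show ?thesis by (simp add: power2_eq_iff_nonneg)
qed

lemma inner_reidx:
  assumes "\<And>x. g (h x) = x" "\<And>x. h (g x) = x"
  shows "inner (reidx g u) v = inner u (reidx h v)"
proof -
  have b: "bij g" "bij h" using assms by (auto intro!: o_bij simp: fun_eq_iff)
  have "inner (reidx g u) v = (\<Sum>\<^sub>\<infinity>x. Re (l2_fun u (g x) * cnj (l2_fun v (h (g x)))))"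
    by (simp add: inner_l2.rep_eq l2_fun_reidx[OF b(1)] assms)
  also have "\<dots> = (\<Sum>\<^sub>\<infinity>y. Re (l2_fun u y * cnj (l2_fun v (h y))))"
    using infsum_reindex_bij_betw[of g UNIV UNIV "\<lambda>y. Re (l2_fun u y * cnj (l2_fun v (h y)))"] b by simp
  also have "\<dots> = inner u (reidx h v)" by (simp add: inner_l2.rep_eq l2_fun_reidx[OF b(2)])
  finally show ?thesis .
qed

lemma l2_symmetric_hop:
  assumes inv: "\<And>x. g (h x) = x" "\<And>x. h (g x) = x"
  shows "l2_symmetric (\<lambda>u. reidx g u + reidx h u)"
proof
  have b: "bij g" "bij h" using inv by (auto intro!: o_bij simp: fun_eq_iff)
  fix u v :: "'a l2" and z :: complex
  show "reidx g (u + v) + reidx h (u + v) = reidx g u + reidx h u + (reidx g v + reidx h v)"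
    by (rule ell2_l2_fun_eqI) (simp add: l2_fun_reidx b fun_eq_iff)
  show "reidx g (cs z u) + reidx h (cs z u) = cs z (reidx g u + reidx h u)"
    by (rule ell2_l2_fun_eqI) (simp add: l2_fun_reidx b cs.rep_eq distrib_left)
  show "\<exists>C. \<forall>u. norm (reidx g u + reidx h u) \<le> C * norm u"
  proof (intro exI[of _ 2] allI)
    fix u show "norm (reidx g u + reidx h u) \<le> 2 * norm u"
      using norm_triangle_ineq[of "reidx g u" "reidx h u"] by (simp add: norm_reidx b)
  qed
  show "inner (reidx g u + reidx h u) v = inner u (reidx g v + reidx h v)"
    using inner_reidx[OF inv] inner_reidx[OF inv(2,1)] by (simp add: inner_add_left inner_add_right)
qed

definition mulop :: "('a \<Rightarrow> real) \<Rightarrow> 'a l2 \<Rightarrow> 'a l2" where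
  "mulop q u = Abs_l2 (\<lambda>x. of_real (q x) * l2_fun u x)"

lemma l2_fun_mulop:
  assumes "\<And>x. \<bar>q x\<bar> \<le> B"
  shows "l2_fun (mulop q u) = (\<lambda>x. of_real (q x) * l2_fun u x)"
  unfolding mulop_def by (rule Abs_l2_inverse[OF ell2_bounded_mult[OF l2_fun_ell2, where B = B]]) (simp add: assms)

lemma norm_bounded_mult:
  assumes f: "f \<in> ell2" and q: "\<And>x. cmod (q x) \<le> B"
  shows "norm (Abs_l2 (\<lambda>x. q x * f x)) \<le> B * norm (Abs_l2 f)"
proof (rule ell2_boundedI(2))
  have B: "B \<ge> 0" using order_trans[OF norm_ge_zero q] .
  then show "0 \<le> B * norm (Abs_l2 f)" by simp
  fix F :: "'a set" assume F: "finite F"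
  have "(\<Sum>x\<in>F. (cmod (q x * f x))\<^sup>2) \<le> (\<Sum>x\<in>F. B\<^sup>2 * (cmod (f x))\<^sup>2)"
    unfolding norm_mult power_mult_distrib by (intro sum_mono mult_right_mono power_mono q) auto
  also have "\<dots> \<le> B\<^sup>2 * (norm (Abs_l2 f))\<^sup>2"
    unfolding sum_distrib_left[symmetric]
    using finite_sum_le_norm[OF F, of "Abs_l2 f"] by (intro mult_left_mono) (simp_all add: Abs_l2_inverse[OF f])
  finally show "(\<Sum>x\<in>F. (cmod (q x * f x))\<^sup>2) \<le> (B * norm (Abs_l2 f))\<^sup>2" by (simp add: power_mult_distrib)
qed

lemma l2_symmetric_mulop:
  assumes q: "\<And>x. \<bar>q x\<bar> \<le> B"
  shows "l2_symmetric (mulop q)"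
proof
  note m = l2_fun_mulop[of q B, OF q]
  fix u v :: "'a l2" and z :: complex
  show "mulop q (u + v) = mulop q u + mulop q v"
    by (rule ell2_l2_fun_eqI) (simp add: m distrib_left)
  show "mulop q (cs z u) = cs z (mulop q u)"
    by (rule ell2_l2_fun_eqI) (simp add: m cs.rep_eq mult.left_commute)
  show "inner (mulop q u) v = inner u (mulop q v)"
    by (simp add: inner_l2.rep_eq m algebra_simps)
  have "norm (mulop q u) \<le> B * norm u" for u
    unfolding mulop_def using norm_bounded_mult[OF l2_fun_ell2[of u], of "\<lambda>x. of_real (q x)" B] q
    by (simp add: l2_fun_inverse)
  then show "\<exists>C. \<forall>u. norm (mulop q u) \<le> C * norm u" by blast
qed

lemma l2_symmetric_add:
  assumes "l2_symmetric S" "l2_symmetric T"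
  shows "l2_symmetric (\<lambda>u. S u + T u)"
proof -
  interpret S: l2_symmetric S by fact
  interpret T: l2_symmetric T by fact
  show ?thesis
  proof
    fix u v :: "'a l2" and z :: complex
    show "S (u + v) + T (u + v) = S u + T u + (S v + T v)" by (simp add: S.T_add T.T_add)
    show "S (cs z u) + T (cs z u) = cs z (S u + T u)" by (simp add: S.T_cs T.T_cs cs_simps(1))
    show "inner (S u + T u) v = inner u (S v + T v)"
      by (simp add: inner_add_left inner_add_right S.T_sym T.T_sym)
    obtain C D where C: "\<And>u. norm (S u) \<le> C * norm u" and D: "\<And>u. norm (T u) \<le> D * norm u"
      using S.bound_ge T.bound_ge by metis
    show "\<exists>C. \<forall>u. norm (S u + T u) \<le> C * norm u"
    proof (intro exI[of _ "C + D"] allI)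
      fix u show "norm (S u + T u) \<le> (C + D) * norm u"
        using norm_triangle_ineq[of "S u" "T u"] C[of u] D[of u] by (simp add: distrib_right)
    qed
  qed
qed

lemma finite_support_dense:
  assumes "\<delta> > 0"
  shows "\<exists>v. finite {x. l2_fun v x \<noteq> 0} \<and> norm (u - v) < \<delta>"
proof -
  have "\<exists>F. finite F \<and> (norm u)\<^sup>2 - \<delta>\<^sup>2 < (\<Sum>x\<in>F. (cmod (l2_fun u x))\<^sup>2)"
  proof (rule ccontr)
    assume neg: "\<not> ?thesis"
    have "(norm u)\<^sup>2 \<le> (norm u)\<^sup>2 - \<delta>\<^sup>2"
    proof (subst norm_l2_sq, rule infsum_le_finite_sums)
      show "(\<lambda>x. (cmod (l2_fun u x))\<^sup>2) summable_on UNIV" using l2_fun[of u] by (simp only: ell2_def mem_Collect_eq)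
      show "(\<Sum>x\<in>F. (cmod (l2_fun u x))\<^sup>2) \<le> (norm u)\<^sup>2 - \<delta>\<^sup>2" if "finite F" for F
        using neg that by (auto simp: not_less)
    qed
    then show False using assms by simp
  qed
  then obtain F where F: "finite F" "(norm u)\<^sup>2 - \<delta>\<^sup>2 < (\<Sum>x\<in>F. (cmod (l2_fun u x))\<^sup>2)" by blast
  define f where "f = (\<lambda>x. if x \<in> F then l2_fun u x else 0)"
  have fs: "finite {x. f x \<noteq> 0}" by (rule finite_subset[OF _ F(1)]) (auto simp: f_def)
  define v where "v = Abs_l2 f"
  have v: "l2_fun v = f" unfolding v_def by (intro Abs_l2_inverse ell2_finite_support fs)
  have z: "(if x \<in> F then 0 else l2_fun u x) * cnj (f x) = 0" for x by (simp add: f_def)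
  have orth: "inner (u - v) v = 0"
    unfolding inner_l2.rep_eq by (simp add: v f_def if_distrib[of cnj] cong: if_cong)
       (auto intro!: infsum_0)
  have "(norm u)\<^sup>2 = (norm (u - v))\<^sup>2 + (norm v)\<^sup>2"
    using orth unfolding power2_norm_eq_inner by (simp add: inner_diff_left inner_diff_right inner_commute)
  moreover have "(\<Sum>x\<in>F. (cmod (l2_fun u x))\<^sup>2) \<le> (norm v)\<^sup>2"
    using finite_sum_le_norm[OF F(1), of v] by (simp add: v f_def)
  ultimately have "(norm (u - v))\<^sup>2 < \<delta>\<^sup>2" using F(2) by linarith
  then have "norm (u - v) < \<delta>" by (rule power2_less_imp_less) (use assms in simp)
  then show ?thesis using fs v by auto
qed

lemma (in l2_symmetric) approx_ev_finite_support:
  assumes "approx_ev T E" "\<epsilon> > 0"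
  shows "\<exists>u. finite {x. l2_fun u x \<noteq> 0} \<and> norm (T u - E *\<^sub>R u) < \<epsilon> * norm u"
proof -
  obtain u where u: "norm (T u - E *\<^sub>R u) < \<epsilon> * norm u" using assms by (auto simp: approx_ev_def)
  obtain C where C: "C > 0" "\<And>v. norm (T v - E *\<^sub>R v) \<le> C * norm v" using shift_props(4)[of E] by blast
  \<comment> \<open>\<open>\<delta>\<close> spends exactly the slack in the inequality for
    \<open>u\<close>: passing to a nearby vector changes the residual at rate \<open>C\<close> and
    the right side at rate \<open>\<epsilon>\<close>.\<close>
  define \<delta> where "\<delta> = (\<epsilon> * norm u - norm (T u - E *\<^sub>R u)) / (C + \<epsilon>)"
  have "\<delta> > 0" using u C assms by (simp add: \<delta>_def)
  then obtain v where v: "finite {x. l2_fun v x \<noteq> 0}" "norm (u - v) < \<delta>" using finite_support_dense by blast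
  have "T v - E *\<^sub>R v = (T u - E *\<^sub>R u) - (T (u - v) - E *\<^sub>R (u - v))" by (simp add: T_diff algebra_simps)
  then have "norm (T v - E *\<^sub>R v) \<le> norm (T u - E *\<^sub>R u) + norm (T (u - v) - E *\<^sub>R (u - v))"
    by (metis norm_triangle_ineq4)
  also have "\<dots> \<le> norm (T u - E *\<^sub>R u) + C * norm (u - v)" using C by simp
  also have "\<dots> < norm (T u - E *\<^sub>R u) + ((C + \<epsilon>) * \<delta> - \<epsilon> * norm (u - v))"
  proof -
    have "(C + \<epsilon>) * norm (u - v) < (C + \<epsilon>) * \<delta>" using v C assms by (intro mult_strict_left_mono) auto
    then show ?thesis by (simp add: distrib_right)
  qed
  also have "(C + \<epsilon>) * \<delta> = \<epsilon> * norm u - norm (T u - E *\<^sub>R u)" using C assms by (simp add: \<delta>_def)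
  also have "norm (T u - E *\<^sub>R u) + (\<epsilon> * norm u - norm (T u - E *\<^sub>R u) - \<epsilon> * norm (u - v)) = \<epsilon> * (norm u - norm (u - v))"
    by (simp add: algebra_simps)
  also have "\<dots> \<le> \<epsilon> * norm v"
    using norm_triangle_ineq2[of u "u - v"] assms by (intro mult_left_mono) auto
  finally show ?thesis using v by blast
qed

definition schr :: "(int \<Rightarrow> real) \<Rightarrow> (int \<Rightarrow> complex) \<Rightarrow> int \<Rightarrow> complex" where
  "schr q f = (\<lambda>n. f (n + 1) + f (n - 1) + of_real (q n) * f n)"

lemma fib_hamiltonian_schr: "fib_hamiltonian V \<omega> = schr (\<lambda>n. V * fib_word \<omega> n)"
  by (intro ext) (simp add: fib_hamiltonian_def schr_def)

lemma bij_shift: "bij (\<lambda>n::int. n + k)" "bij (\<lambda>n::int. n - k)"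
  by (rule o_bij[of "\<lambda>n. n - k"]; simp add: fun_eq_iff) (rule o_bij[of "\<lambda>n. n + k"]; simp add: fun_eq_iff)

lemma schr_ell2:
  assumes q: "\<And>n. \<bar>q n\<bar> \<le> B" and f: "f \<in> ell2"
  shows "schr q f \<in> ell2"
  unfolding schr_def
  by (rule ell2_add[OF ell2_add[OF ell2_reindex[OF f bij_shift(1)] ell2_reindex[OF f bij_shift(2)]]
      ell2_bounded_mult[OF f, where B = B]]) (simp add: q)

lemma l2_fun_schr:
  assumes "\<And>n. \<bar>q n\<bar> \<le> B"
  shows "l2_fun (l2_op (schr q) u) = schr q (l2_fun u)"
  unfolding l2_op_def by (rule Abs_l2_inverse[OF schr_ell2[OF assms l2_fun_ell2]])

lemma schr_symmetric:
  assumes q: "\<And>n. \<bar>q n\<bar> \<le> B"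
  shows "l2_symmetric (l2_op (schr q))"
proof -
  have "l2_symmetric (\<lambda>u. reidx (\<lambda>n. n + 1) u + reidx (\<lambda>n. n - 1) u + mulop q u)"
    by (intro l2_symmetric_add l2_symmetric_hop l2_symmetric_mulop[of q B] q) auto
  moreover have "l2_op (schr q) = (\<lambda>u. reidx (\<lambda>n. n + 1) u + reidx (\<lambda>n. n - 1) u + mulop q u)"
    by (rule ext, rule ell2_l2_fun_eqI)
       (simp add: l2_fun_schr[OF q] schr_def l2_fun_reidx bij_shift l2_fun_mulop[of q B, OF q])
  ultimately show ?thesis by simp
qed

lemma schr_transplant:
  assumes q: "\<And>n. \<bar>q n\<bar> \<le> B" and q': "\<And>n. \<bar>q' n\<bar> \<le> B"
    and eq: "\<And>n. l2_fun u n \<noteq> 0 \<Longrightarrow> q' (n + k) = q n"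
  shows "norm (reidx (\<lambda>n. n - k) u) = norm u"
    "norm (l2_op (schr q') (reidx (\<lambda>n. n - k) u) - cs z (reidx (\<lambda>n. n - k) u)) = norm (l2_op (schr q) u - cs z u)"
proof -
  show "norm (reidx (\<lambda>n. n - k) u) = norm u" by (rule norm_reidx[OF bij_shift(2)])
  have "l2_op (schr q') (reidx (\<lambda>n. n - k) u) - cs z (reidx (\<lambda>n. n - k) u) = reidx (\<lambda>n. n - k) (l2_op (schr q) u - cs z u)"
  proof (rule ell2_l2_fun_eqI, rule ext)
    fix n
    have "of_real (q' n) * l2_fun u (n - k) = of_real (q (n - k)) * l2_fun u (n - k)"
      using eq[of "n - k"] by (cases "l2_fun u (n - k) = 0") auto
    then show "l2_fun (l2_op (schr q') (reidx (\<lambda>n. n - k) u) - cs z (reidx (\<lambda>n. n - k) u)) n =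
       l2_fun (reidx (\<lambda>n. n - k) (l2_op (schr q) u - cs z u)) n"
      by (simp add: l2_fun_schr[OF q] l2_fun_schr[OF q'] schr_def l2_fun_reidx bij_shift cs.rep_eq algebra_simps)
  qed
  then show "norm (l2_op (schr q') (reidx (\<lambda>n. n - k) u) - cs z (reidx (\<lambda>n. n - k) u)) = norm (l2_op (schr q) u - cs z u)"
    by (simp only: norm_reidx[OF bij_shift(2)])
qed

text \<open>An approximate eigenvector can be truncated to finite support. It then sees the
  potential on finitely many sites only, and can be moved to a place where \<open>q'\<close> shows
  the same pattern.\<close>

lemma approx_ev_transfer:
  assumes q: "\<And>n. \<bar>q n\<bar> \<le> B" and q': "\<And>n. \<bar>q' n\<bar> \<le> B"
    and occ: "\<And>F. finite F \<Longrightarrow> \<exists>k. \<forall>n\<in>F. q' (n + k) = q n"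
    and E: "approx_ev (l2_op (schr q)) E"
  shows "approx_ev (l2_op (schr q')) E"
  unfolding approx_ev_def
proof (intro allI impI)
  fix \<epsilon> :: real assume "\<epsilon> > 0"
  interpret l2_symmetric "l2_op (schr q)" by (rule schr_symmetric[OF q])
  obtain u where u: "finite {x. l2_fun u x \<noteq> 0}" "norm (l2_op (schr q) u - E *\<^sub>R u) < \<epsilon> * norm u"
    using approx_ev_finite_support[OF E \<open>\<epsilon> > 0\<close>] by blast
  obtain k where k: "\<forall>n\<in>{x. l2_fun u x \<noteq> 0}. q' (n + k) = q n" using occ[OF u(1)] by blast
  have "norm (l2_op (schr q') (reidx (\<lambda>n. n - k) u) - E *\<^sub>R reidx (\<lambda>n. n - k) u) < \<epsilon> * norm (reidx (\<lambda>n. n - k) u)"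
    using schr_transplant(1)[where q = q and q' = q' and B = B and u = u and k = k, OF q q'] schr_transplant(2)[where q = q and q' = q' and B = B and u = u and k = k and z = "of_real E", OF q q'] k u(2) by (simp add: cs_simps(6))
  then show "\<exists>u. norm (l2_op (schr q') u - E *\<^sub>R u) < \<epsilon> * norm u" by blast
qed

section \<open>Transfer matrices and periodic potentials\<close>

text \<open>The matrix of \<open>\<psi> (n + 1) = e * \<psi> n - \<psi> (n - 1)\<close> acting on
  the column \<open>(\<psi> n, \<psi> (n - 1))\<close>, with \<open>e = z - q n\<close>.\<close>

definition step :: "complex \<Rightarrow> complex^2^2" where
  "step e = vector [vector [e, - 1], vector [1, 0]]"

fun tm :: "(int \<Rightarrow> real) \<Rightarrow> complex \<Rightarrow> int \<Rightarrow> nat \<Rightarrow> complex^2^2" where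
  "tm q z i 0 = mat 1"
| "tm q z i (Suc k) = step (z - of_real (q (i + int k))) ** tm q z i k"

lemma step_simps: "step e $ 1 $ 1 = e" "step e $ 1 $ 2 = - 1" "step e $ 2 $ 1 = 1" "step e $ 2 $ 2 = 0"
  by (auto simp: step_def)

lemma step_mult_vec: "(step e *v v) $ 1 = e * v $ 1 - v $ 2" "(step e *v v) $ 2 = v $ 1"
  by (auto simp: matrix_vector_mult_def sum_2 step_simps)

lemma det_step: "det (step e) = 1"
  by (simp add: det_2 step_simps)

lemma det_tm: "det (tm q z i k) = 1"
  by (induction k) (simp_all add: det_mul det_step)

lemma tm_add: "tm q z i (k + l) = tm q z (i + int k) l ** tm q z i k"
  by (induction l) (auto simp: matrix_mul_assoc add.assoc)

lemma tm_cong: "(\<And>j. j < k \<Longrightarrow> q (i + int j) = q' (i' + int j)) \<Longrightarrow> tm q z i k = tm q' z i' k"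
  by (induction k) auto

lemma trace_2: "trace (A :: complex^2^2) = A $ 1 $ 1 + A $ 2 $ 2"
  by (simp add: trace_def sum_2)

text \<open>For determinant 1, the square of \<open>X\<close> is \<open>trace X\<close> times
  \<open>X\<close> minus the identity; multiplied by \<open>Y\<close> this becomes the recursion of
  the traces.\<close>

lemma cayley_hamilton_trace:
  fixes X Y :: "complex^2^2"
  assumes "det X = 1"
  shows "trace (X ** (X ** Y)) = trace X * trace (X ** Y) - trace Y"
proof -
  have "X $ 1 $ 1 * X $ 2 $ 2 - X $ 1 $ 2 * X $ 2 $ 1 = 1" using assms by (simp add: det_2)
  then show ?thesis by (simp add: trace_2 matrix_matrix_mult_def sum_2) algebra
qed

text \<open>One shift conjugates the product by the step matrix at \<open>i\<close>, because the
  factor gained at \<open>i + N\<close> equals the factor lost at \<open>i\<close>.\<close>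

lemma trace_tm_shift:
  assumes "q (i + int N) = q i"
  shows "trace (tm q z (i + 1) N) = trace (tm q z i N)"
proof -
  define A where "A = step (z - of_real (q i))"
  define B :: "complex^2^2" where "B = vector [vector [0, 1], vector [- 1, z - of_real (q i)]]"
  have AB: "A ** B = mat 1"
    by (simp add: A_def B_def matrix_matrix_mult_def vec_eq_iff forall_2 sum_2 step_simps mat_def)
  have "tm q z (i + 1) N ** A = tm q z i (Suc N)"
    using tm_add[of q z i 1 N] by (simp add: A_def matrix_mul_rid)
  also have "\<dots> = A ** tm q z i N" by (simp add: assms A_def)
  finally have "tm q z (i + 1) N ** (A ** B) = A ** tm q z i N ** B" by (simp add: matrix_mul_assoc)
  then have "trace (tm q z (i + 1) N) = trace (A ** tm q z i N ** B)" by (simp add: AB matrix_mul_rid)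
  also have "\<dots> = trace (B ** (A ** tm q z i N))" by (rule trace_mul_sym)
  also have "\<dots> = trace (tm q z i N)"
  proof -
    have "B ** A = mat 1" using AB matrix_left_right_inverse by blast
    then show ?thesis by (simp add: matrix_mul_assoc matrix_mul_lid)
  qed
  finally show ?thesis .
qed

lemma trace_tm_periodic:
  assumes "\<And>n. q (n + int N) = q n"
  shows "trace (tm q z i N) = trace (tm q z j N)"
proof -
  have shift: "trace (tm q z (j + int k) N) = trace (tm q z j N)" for j k
  proof (induction k)
    case (Suc k)
    have "trace (tm q z (j + int k + 1) N) = trace (tm q z (j + int k) N)"
      by (rule trace_tm_shift) (rule assms)
    then show ?case using Suc by (simp add: add_ac)
  qed simp
  show ?thesis
  proof (cases "i \<le> j")
    case True
    then show ?thesis using shift[of i "nat (j - i)"] by simp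
  next
    case False
    then show ?thesis using shift[of j "nat (i - j)"] by simp
  qed
qed

text \<open>For \<open>x = cos \<theta>\<close> the eigenvalue is \<open>cis \<theta>\<close>.
  Either of the usual candidates \<open>(b, l - a)\<close> and \<open>(l - d, c)\<close> for the
  eigenvector may vanish, and both do for a scalar matrix, whence three cases.\<close>

lemma unimodular_eigenvector:
  fixes M :: "complex^2^2"
  assumes M: "det M = 1" "trace M = 2 * of_real x" and x: "\<bar>x\<bar> \<le> 1"
  shows "\<exists>l v. cmod l = 1 \<and> v \<noteq> 0 \<and> M *v v = l *s v"
proof -
  define a b c d where "a = M $ 1 $ 1" "b = M $ 1 $ 2" "c = M $ 2 $ 1" "d = M $ 2 $ 2"
  note defs = this
  have det: "a * d - b * c = 1" using M(1) by (simp add: det_2 defs)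
  have tr: "a + d = 2 * of_real x" using M(2) by (simp add: trace_2 defs)
  define l where "l = Complex x (sqrt (1 - x\<^sup>2))"
  have x2: "x\<^sup>2 \<le> 1" using x by (simp add: abs_square_le_1)
  have l1: "cmod l = 1" using x2 by (simp add: l_def cmod_def)
  have "sqrt (1 - x\<^sup>2) * sqrt (1 - x\<^sup>2) = 1 - x * x" using x2 by (simp add: power2_eq_square)
  then have "l * l - 2 * of_real x * l + 1 = 0" by (simp add: l_def complex_eq_iff)
  then have char: "l * l - (a + d) * l + (a * d - b * c) = 0" by (simp add: tr det)
  have vec: "M *v v = l *s v" if "a * v $ 1 + b * v $ 2 = l * v $ 1" "c * v $ 1 + d * v $ 2 = l * v $ 2" for v
    using that by (simp add: vec_eq_iff forall_2 matrix_vector_mult_def sum_2 defs)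
  consider "b \<noteq> 0" | "b = 0" "l = d" | "b = 0" "l \<noteq> d" by blast
  then show ?thesis
  proof cases
    case 1
    define v :: "complex^2" where "v = vector [b, l - a]"
    have "M *v v = l *s v"
      by (rule vec) (use char in \<open>simp_all add: v_def algebra_simps\<close>)
    moreover have "v \<noteq> 0" using 1 by (auto simp: v_def vec_eq_iff forall_2)
    ultimately show ?thesis using l1 by blast
  next
    case 2
    define v :: "complex^2" where "v = vector [0, 1]"
    have "M *v v = l *s v" by (rule vec) (use 2 in \<open>simp_all add: v_def\<close>)
    moreover have "v \<noteq> 0" by (auto simp: v_def vec_eq_iff forall_2)
    ultimately show ?thesis using l1 by blast
  next
    case 3
    define v :: "complex^2" where "v = vector [l - d, c]"
    have "M *v v = l *s v"
      by (rule vec) (use char 3 in \<open>simp_all add: v_def algebra_simps\<close>)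
    moreover have "v \<noteq> 0" using 3 by (auto simp: v_def vec_eq_iff forall_2)
    ultimately show ?thesis using l1 by blast
  qed
qed

text \<open>The approximate eigenvector is the solution \<open>c\<close> over two periods, multiplied by a tent function.\<close>

lemma tent_approx:
  fixes c :: "nat \<Rightarrow> complex"
  assumes q: "\<And>n. \<bar>q n\<bar> \<le> B" and N: "N \<ge> 1"
    and rec: "\<And>n. n \<in> {1..2*N} \<Longrightarrow> c (n + 1) + c (n - 1) + of_real (q (int n)) * c n = z * c n"
    and per: "\<And>n. n \<le> N \<Longrightarrow> cmod (c (n + N)) = cmod (c n)"
    and nz: "c 0 \<noteq> 0 \<or> c 1 \<noteq> 0"
  shows "\<exists>u. u \<noteq> 0 \<and> norm (l2_op (schr q) u - cs z u) \<le> 6 / N * norm u"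
proof -
  define \<tau> :: "nat \<Rightarrow> real" where "\<tau> n = real (min n (2 * N - n)) / N" for n
  define f :: "int \<Rightarrow> complex" where "f m = (if m \<ge> 0 then of_real (\<tau> (nat m)) * c (nat m) else 0)" for m
  have \<tau>0: "\<tau> 0 = 0" by (simp add: \<tau>_def)
  have \<tau>2: "\<tau> n = 0" if "n \<ge> 2 * N" for n using that by (simp add: \<tau>_def)
  have fn: "f (int n) = of_real (\<tau> n) * c n" for n by (simp add: f_def)
  have supp: "{x. f x \<noteq> 0} \<subseteq> int ` {..2 * N}"
  proof
    fix x assume "x \<in> {x. f x \<noteq> 0}"
    then have "x \<ge> 0" "\<tau> (nat x) \<noteq> 0" by (auto simp: f_def split: if_splits)
    moreover from this have "nat x \<le> 2 * N" using \<tau>2[of "nat x"] by linarith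
    ultimately show "x \<in> int ` {..2 * N}" by (intro image_eqI[of _ _ "nat x"]) auto
  qed
  then have fl: "f \<in> ell2" by (intro ell2_finite_support) (auto elim: finite_subset)
  define u where "u = Abs_l2 f"
  have uf: "l2_fun u = f" unfolding u_def by (rule Abs_l2_inverse[OF fl])
  define g where "g n = (cmod (c n))\<^sup>2" for n
  define P where "P = (\<Sum>n<N. g n)"
  have gper: "g (n + N) = g n" if "n \<le> N" for n using per[OF that] by (simp add: g_def)
  have g0: "g n \<ge> 0" for n by (simp add: g_def)
  have P: "P > 0"
  proof (rule ccontr)
    assume "\<not> ?thesis"
    moreover have "P \<ge> 0" unfolding P_def by (intro sum_nonneg g0)
    ultimately have "P = 0" by simp
    then have z: "g n = 0" if "n < N" for n using that by (simp add: P_def sum_nonneg_eq_0_iff g0)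
    have "g 0 = 0" using z N by simp
    moreover have "g 1 = 0"
    proof (cases "N = 1")
      case True
      then show ?thesis using gper[of 0] \<open>g 0 = 0\<close> by simp
    next
      case False
      then show ?thesis using z[of 1] N by simp
    qed
    ultimately show False using nz by (simp add: g_def)
  qed
  have sum_split: "(\<Sum>n<k + m. h n) = (\<Sum>n<k. h n) + (\<Sum>n<m. h (n + k))" for h :: "nat \<Rightarrow> real" and k m
    by (induction m) (auto simp: add_ac)
  have two: "(\<Sum>n<2*N. g n) = 2 * P"
  proof -
    have "(\<Sum>n<N. g (n + N)) = P" unfolding P_def by (rule sum.cong[OF refl], rule gper) simp
    then show ?thesis using sum_split[of g N N] by (simp add: P_def flip: mult_2)
  qed
  have two': "(\<Sum>n<2*N. g (n + 1)) = 2 * P"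
  proof -
    have "(\<Sum>n<2*N. g (n + 1)) + g 0 = (\<Sum>n<2*N. g n) + g (2*N)"
      using sum.lessThan_Suc_shift[of g "2*N"] by simp
    moreover have "g (2 * N) = g 0" using gper[of N] gper[of 0] by (simp flip: mult_2)
    ultimately show ?thesis using two by simp
  qed
  have lower: "P / 4 \<le> (norm u)\<^sup>2"
  proof -
    \<comment> \<open>On the \<open>N\<close> sites from \<open>h\<close> on the tent is at least
      1/2; being a full period, they carry the whole mass \<open>P\<close>.\<close>
    define h where "h = (N + 1) div 2"
    have h: "N \<le> 2 * h" "2 * h \<le> N + 1" "h \<le> N" using N by (auto simp: h_def)
    have "(\<Sum>n<N. g (n + h)) = P"
    proof -
      have "(\<Sum>n<h + N. g n) = (\<Sum>n<h. g n) + (\<Sum>n<N. g (n + h))" by (rule sum_split)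
      moreover have "(\<Sum>n<N + h. g n) = P + (\<Sum>n<h. g (n + N))" unfolding P_def by (rule sum_split)
      moreover have "(\<Sum>n<h. g (n + N)) = (\<Sum>n<h. g n)" using h(3) by (intro sum.cong refl gper) simp
      ultimately show ?thesis by (simp add: add.commute)
    qed
    then have "P / 4 = (\<Sum>n<N. g (n + h) / 4)" by (simp flip: sum_divide_distrib)
    also have "\<dots> \<le> (\<Sum>n<N. (cmod (f (int (n + h))))\<^sup>2)"
    proof (rule sum_mono)
      fix n assume n: "n \<in> {..<N}"
      have "\<tau> (n + h) \<ge> 1/2" using n h N by (auto simp: \<tau>_def min_def field_simps of_nat_diff)
      then have "(1/2)\<^sup>2 * g (n + h) \<le> (\<tau> (n + h))\<^sup>2 * g (n + h)" by (intro mult_right_mono power_mono g0) auto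
      then show "g (n + h) / 4 \<le> (cmod (f (int (n + h))))\<^sup>2"
        unfolding fn by (simp add: g_def norm_mult power_mult_distrib power_divide)
    qed
    also have "\<dots> = (\<Sum>x\<in>(\<lambda>n. int (n + h)) ` {..<N}. (cmod (l2_fun u x))\<^sup>2)"
      by (subst sum.reindex) (auto simp: inj_on_def uf)
    also have "\<dots> \<le> (norm u)\<^sup>2" by (intro finite_sum_le_norm) auto
    finally show ?thesis .
  qed
  define r where "r = (\<lambda>n. schr q f n - z * f n)"
  have r_fun: "l2_fun (l2_op (schr q) u - cs z u) = r"
    by (simp add: l2_fun_schr[OF q] cs.rep_eq uf r_def)
  \<comment> \<open>The cutoffs match the tent: beyond \<open>2 * N\<close> it is zero, and at
    \<open>n = 0\<close> truncated subtraction would wrongly count \<open>c 0\<close>. Each half of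
    \<open>w\<close> thus sums to exactly two periods.\<close>
  define w where "w n = (if n < 2 * N then g (n + 1) else 0) + (if n \<ge> 1 then g (n - 1) else 0)" for n
  have r_bound: "(cmod (r (int n)))\<^sup>2 \<le> 2 / N\<^sup>2 * w n" if n: "n \<le> 2 * N" for n
  proof -
    have \<Delta>: "\<bar>\<tau> (m + 1) - \<tau> m\<bar> \<le> 1 / N" for m
    proof -
      have "\<bar>real (min (m+1) (2 * N - (m+1))) - real (min m (2 * N - m))\<bar> \<le> 1" by (auto simp: min_def of_nat_diff)
      then show ?thesis unfolding \<tau>_def diff_divide_distrib[symmetric] abs_divide using N by (simp add: divide_right_mono)
    qed
    define \<alpha> \<beta> where "\<alpha> = (if n < 2 * N then (\<tau> (n + 1) - \<tau> n) else 0)" "\<beta> = (if n \<ge> 1 then \<tau> (n - 1) - \<tau> n else 0)"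
    note ab = this
    have \<alpha>: "\<bar>\<alpha>\<bar> \<le> 1 / N" and \<beta>: "\<bar>\<beta>\<bar> \<le> 1 / N"
      using \<Delta>[of n] \<Delta>[of "n - 1"] by (auto simp: ab abs_minus_commute)
    have "r (int n) = of_real \<alpha> * c (n + 1) + of_real \<beta> * c (n - 1)"
    proof (cases "n = 0")
      case True
      have "f 0 = 0" "f (- 1) = 0" using fn[of 0] \<tau>0 by (auto simp: f_def)
      then show ?thesis using True fn[of 1] N by (simp add: r_def schr_def ab \<tau>0)
    next
      case False
      then have n1: "n \<in> {1..2*N}" using n by auto
      have fm: "f (int n - 1) = of_real (\<tau> (n - 1)) * c (n - 1)"
        using fn[of "n - 1"] False by (simp add: of_nat_diff)
      have fp: "f (int n + 1) = of_real (\<tau> (n + 1)) * c (n + 1)"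
        using fn[of "n + 1"] by (simp add: add.commute)
      have "r (int n) = of_real (\<tau> (n + 1)) * c (n + 1) + of_real (\<tau> (n - 1)) * c (n - 1)
          + of_real (\<tau> n) * (of_real (q (int n)) * c n - z * c n)"
        unfolding r_def schr_def fm fp fn by (simp add: right_diff_distrib mult.left_commute)
      also have "of_real (q (int n)) * c n - z * c n = - c (n + 1) - c (n - 1)"
        unfolding rec[OF n1, symmetric] by simp
      finally show ?thesis using n1 \<tau>2[of n] \<tau>2[of "n + 1"]
        by (cases "n < 2 * N") (auto simp: ab algebra_simps)
    qed
    then have "cmod (r (int n)) \<le> \<bar>\<alpha>\<bar> * cmod (c (n + 1)) + \<bar>\<beta>\<bar> * cmod (c (n - 1))"
      using norm_triangle_ineq[of "of_real \<alpha> * c (n + 1)" "of_real \<beta> * c (n - 1)"] by (simp add: norm_mult)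
    then have "(cmod (r (int n)))\<^sup>2 \<le> (\<bar>\<alpha>\<bar> * cmod (c (n + 1)) + \<bar>\<beta>\<bar> * cmod (c (n - 1)))\<^sup>2"
      by (intro power_mono) auto
    also have "\<dots> \<le> 2 * (\<alpha>\<^sup>2 * g (n + 1)) + 2 * (\<beta>\<^sup>2 * g (n - 1))"
      using sum_squares_bound[of "\<bar>\<alpha>\<bar> * cmod (c (n + 1))" "\<bar>\<beta>\<bar> * cmod (c (n - 1))"]
      by (simp add: power2_sum power_mult_distrib g_def)
    also have "\<alpha>\<^sup>2 * g (n + 1) \<le> 1 / N\<^sup>2 * (if n < 2 * N then g (n + 1) else 0)"
    proof (cases "n < 2 * N")
      case True
      have "\<bar>\<alpha>\<bar>\<^sup>2 \<le> (1 / N)\<^sup>2" using \<alpha> by (intro power_mono) auto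
      then have "\<alpha>\<^sup>2 * g (n + 1) \<le> (1 / N)\<^sup>2 * g (n + 1)" by (intro mult_right_mono g0) auto
      then show ?thesis using True by (simp add: power_divide)
    qed (simp add: ab)
    also have "\<beta>\<^sup>2 * g (n - 1) \<le> 1 / N\<^sup>2 * (if n \<ge> 1 then g (n - 1) else 0)"
    proof (cases "n \<ge> 1")
      case True
      have "\<bar>\<beta>\<bar>\<^sup>2 \<le> (1 / N)\<^sup>2" using \<beta> by (intro power_mono) auto
      then have "\<beta>\<^sup>2 * g (n - 1) \<le> (1 / N)\<^sup>2 * g (n - 1)" using g0 by (intro mult_right_mono) auto
      then show ?thesis using True by (simp add: power_divide)
    qed (simp add: ab)
    finally show ?thesis by (simp add: w_def algebra_simps)
  qed
  have r0: "r x = 0" if "x \<notin> int ` {..2 * N}" for x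
  proof -
    have z: "f y = 0" if "y \<le> 0 \<or> y \<ge> 2 * int N" for y
    proof (cases "y \<ge> 2 * int N")
      case True
      then show ?thesis using \<tau>2[of "nat y"] by (simp add: f_def le_nat_iff)
    next
      case False
      then show ?thesis using that \<tau>0 by (simp add: f_def)
    qed
    have "x < 0 \<or> x > 2 * int N"
    proof (rule ccontr)
      assume "\<not> ?thesis"
      then have "x = int (nat x)" "nat x \<le> 2 * N" by auto
      then show False using that by blast
    qed
    then have "f x = 0" "f (x + 1) = 0" "f (x - 1) = 0" by (auto intro!: z)
    then show ?thesis by (simp add: r_def schr_def)
  qed
  have w_sum: "(\<Sum>n\<le>2*N. w n) = 4 * P"
  proof -
    have "(\<Sum>n\<le>2*N. if n < 2 * N then g (n + 1) else 0) = (\<Sum>n<2*N. g (n + 1))"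
      by (simp add: lessThan_Suc_atMost[symmetric])
    moreover have "(\<Sum>n\<le>2*N. if n \<ge> 1 then g (n - 1) else 0) = (\<Sum>n<2*N. g n)"
      using sum.lessThan_Suc_shift[of "\<lambda>n. if n \<ge> 1 then g (n - 1) else 0" "2*N"]
      by (simp add: lessThan_Suc_atMost)
    ultimately show ?thesis using two two' by (simp add: w_def sum.distrib)
  qed
  have upper: "(norm (l2_op (schr q) u - cs z u))\<^sup>2 \<le> 8 * P / N\<^sup>2"
  proof -
    have fin: "finite {x. r x \<noteq> 0}" by (rule finite_subset[of _ "int ` {..2 * N}"]) (use r0 in auto)
    have "(norm (l2_op (schr q) u - cs z u))\<^sup>2 = (\<Sum>\<^sub>\<infinity>x. (cmod (r x))\<^sup>2)"
      unfolding norm_l2_sq r_fun ..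
    also have "\<dots> = (\<Sum>\<^sub>\<infinity>x\<in>int ` {..2*N}. (cmod (r x))\<^sup>2)"
      by (rule infsum_cong_neutral) (use r0 in auto)
    also have "\<dots> = (\<Sum>n\<le>2*N. (cmod (r (int n)))\<^sup>2)"
      by (simp add: sum.reindex)
    also have "\<dots> \<le> (\<Sum>n\<le>2*N. 2 / N\<^sup>2 * w n)" by (intro sum_mono r_bound) auto
    also have "\<dots> = 8 * P / N\<^sup>2" unfolding sum_distrib_left[symmetric] w_sum by simp
    finally show ?thesis .
  qed
  also have "8 * P / N\<^sup>2 \<le> 32 / N\<^sup>2 * (norm u)\<^sup>2"
  proof -
    have "8 * P / N\<^sup>2 = 32 / N\<^sup>2 * (P / 4)" by simp
    also have "\<dots> \<le> 32 / N\<^sup>2 * (norm u)\<^sup>2" by (intro mult_left_mono lower) auto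
    finally show ?thesis .
  qed
  \<comment> \<open>A residual of \<open>8 * P / N\<^sup>2\<close> against a mass of at least
    \<open>P / 4\<close> gives the ratio 32, rounded up to the square of 6.\<close>
  also have "\<dots> \<le> 36 / N\<^sup>2 * (norm u)\<^sup>2" by (intro mult_right_mono divide_right_mono) auto
  also have "\<dots> = (6 / N * norm u)\<^sup>2" by (simp add: power_mult_distrib power_divide)
  finally have "norm (l2_op (schr q) u - cs z u) \<le> 6 / N * norm u"
    by (rule power2_le_imp_le) simp
  moreover have "u \<noteq> 0" using lower P by auto
  ultimately show ?thesis by blast
qed

text \<open>The column at \<open>n\<close> is \<open>(c (n + 1), c n)\<close>, so \<open>v\<close>
  holds \<open>c 1\<close> and \<open>c 0\<close>. The Floquet relation is stated with periodicity
  on the traversed sites alone, so that a square in a word can take the place of a periodic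
  potential.\<close>

lemma bloch_sequence:
  assumes M: "tm q z 1 N *v v = l *s v" and v: "v \<noteq> 0"
  defines "c \<equiv> \<lambda>n. (tm q z 1 n *v v) $ 2"
  shows "n \<ge> 1 \<Longrightarrow> c (n + 1) + c (n - 1) + of_real (q (int n)) * c n = z * c n"
    and "c 0 \<noteq> 0 \<or> c 1 \<noteq> 0"
    and "(\<And>i. 1 \<le> i \<Longrightarrow> i \<le> n \<Longrightarrow> q (int (i + N)) = q (int i)) \<Longrightarrow> c (n + N) = l * c n"
proof -
  define \<Psi> where "\<Psi> n = tm q z 1 n *v v" for n
  have S: "\<Psi> (Suc n) = step (z - of_real (q (1 + int n))) *v \<Psi> n" for n
    by (simp add: \<Psi>_def matrix_vector_mul_assoc)
  have c: "c n = \<Psi> n $ 2" for n by (simp add: c_def \<Psi>_def)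
  have c1: "c (Suc n) = \<Psi> n $ 1" for n by (simp add: c S step_mult_vec)
  show "c (n + 1) + c (n - 1) + of_real (q (int n)) * c n = z * c n" if n1: "n \<ge> 1"
  proof -
    obtain m where m: "n = Suc m" using n1 by (cases n) auto
    have "c (n + 1) = (z - of_real (q (int n))) * c n - c m"
      using c1[of n] c1[of m] c[of m] by (simp add: m S step_mult_vec)
    then show ?thesis by (simp add: m algebra_simps)
  qed
  have "v = 0" if "c 0 = 0" "c 1 = 0"
    using that c[of 0] c1[of 0] by (simp add: \<Psi>_def vec_eq_iff forall_2)
  then show "c 0 \<noteq> 0 \<or> c 1 \<noteq> 0" using v by blast
  show "c (n + N) = l * c n" if per: "\<And>i. 1 \<le> i \<Longrightarrow> i \<le> n \<Longrightarrow> q (int (i + N)) = q (int i)"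
  proof -
    have "tm q z (1 + int N) n = tm q z 1 n"
    proof (rule tm_cong)
      fix j assume "j < n"
      then show "q (1 + int N + int j) = q (1 + int j)" using per[of "Suc j"] by (simp add: add_ac)
    qed
    then have "\<Psi> (N + n) = tm q z 1 n *v (l *s v)"
      using tm_add[of q z 1 N n] M by (simp add: \<Psi>_def matrix_vector_mul_assoc[symmetric])
    also have "\<dots> = l *s \<Psi> n" by (simp add: \<Psi>_def vector_scalar_commute)
    finally show ?thesis by (simp add: c add.commute)
  qed
qed

lemma two_period_approx:
  assumes q: "\<And>n. \<bar>q n\<bar> \<le> B" and N: "N \<ge> 1"
    and per: "\<And>i. 1 \<le> i \<Longrightarrow> i \<le> N \<Longrightarrow> q (int (i + N)) = q (int i)"
    and tr: "trace (tm q z 1 N) = 2 * of_real x" "\<bar>x\<bar> \<le> 1"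
  shows "\<exists>u. u \<noteq> 0 \<and> norm (l2_op (schr q) u - cs z u) \<le> 6 / N * norm u"
proof -
  obtain l v where lv: "cmod l = 1" "v \<noteq> 0" "tm q z 1 N *v v = l *s v"
    using unimodular_eigenvector[OF det_tm tr] by blast
  note b = bloch_sequence[OF lv(3,2)]
  show ?thesis
  proof (rule tent_approx[OF q N])
    fix n assume "n \<in> {1..2*N}"
    then show "(tm q z 1 (n + 1) *v v) $ 2 + (tm q z 1 (n - 1) *v v) $ 2 + of_real (q (int n)) * (tm q z 1 n *v v) $ 2
      = z * (tm q z 1 n *v v) $ 2" by (intro b(1)) auto
  next
    fix n assume "n \<le> N"
    then have "(tm q z 1 (n + N) *v v) $ 2 = l * (tm q z 1 n *v v) $ 2" by (intro b(3) per) auto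
    then show "cmod ((tm q z 1 (n + N) *v v) $ 2) = cmod ((tm q z 1 n *v v) $ 2)" by (simp add: norm_mult lv)
  qed (rule b(2))
qed

text \<open>The Bloch wave keeps its modulus from period to period, so the tent may have arbitrarily
  many periods as its half width. The error then tends to 0, while symmetry keeps it at least
  \<open>\<bar>Im z\<bar>\<close>.\<close>

lemma periodic_band_real:
  assumes q: "\<And>n. \<bar>q n\<bar> \<le> B" and N: "N \<ge> 1" and per: "\<And>n. q (n + int N) = q n"
    and tr: "trace (tm q z 1 N) = 2 * of_real x" "\<bar>x\<bar> \<le> 1"
  shows "Im z = 0"
proof -
  obtain l v where lv: "cmod l = 1" "v \<noteq> 0" "tm q z 1 N *v v = l *s v"
    using unimodular_eigenvector[OF det_tm tr] by blast
  note b = bloch_sequence[OF lv(3,2)]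
  define c where "c n = (tm q z 1 n *v v) $ 2" for n
  have cN: "cmod (c (n + N)) = cmod (c n)" for n
    using b(3)[of n] per by (simp add: c_def norm_mult lv(1))
  have cK: "cmod (c (n + K * N)) = cmod (c n)" for n K
    by (induction K) (use cN in \<open>auto simp: add.assoc[symmetric] add.commute[of N] \<close>)
  have bound: "\<bar>Im z\<bar> \<le> 6 / real (Suc K)" for K
  proof -
    have "\<exists>u. u \<noteq> 0 \<and> norm (l2_op (schr q) u - cs z u) \<le> 6 / real (Suc K * N) * norm u"
    proof (rule tent_approx[OF q])
      show "Suc K * N \<ge> 1" using N by simp
      show "c (n + 1) + c (n - 1) + of_real (q (int n)) * c n = z * c n" if "n \<in> {1..2 * (Suc K * N)}" for n
        unfolding c_def using that by (intro b(1)) auto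
      show "cmod (c (n + Suc K * N)) = cmod (c n)" for n by (rule cK)
      show "c 0 \<noteq> 0 \<or> c 1 \<noteq> 0" unfolding c_def by (rule b(2))
    qed
    then obtain u where u: "u \<noteq> 0" "norm (l2_op (schr q) u - cs z u) \<le> 6 / real (Suc K * N) * norm u" by blast
    interpret l2_symmetric "l2_op (schr q)" by (rule schr_symmetric[OF q])
    have "\<bar>Im z\<bar> * norm u \<le> 6 / real (Suc K * N) * norm u" using shift_ge_imag[of z u] u by linarith
    then have "\<bar>Im z\<bar> \<le> 6 / real (Suc K * N)" by (rule mult_right_le_imp_le) (use u in simp)
    also have "\<dots> \<le> 6 / real (Suc K)"
    proof (rule divide_left_mono)
      have "Suc K \<le> Suc K * N" using mult_le_mono2[OF N, of "Suc K"] by (simp only: mult_1_right)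
      then show "real (Suc K) \<le> real (Suc K * N)" by (simp only: of_nat_le_iff)
      have "Suc K * N > 0" using N by simp
      then show "0 < real (Suc K * N) * real (Suc K)" by (intro mult_pos_pos) (simp_all only: of_nat_0_less_iff zero_less_Suc)
    qed simp
    finally show ?thesis .
  qed
  have "\<bar>Im z\<bar> \<le> 0"
  proof (rule ccontr)
    assume "\<not> ?thesis"
    then have pos: "\<bar>Im z\<bar> > 0" by simp
    obtain K where "6 / \<bar>Im z\<bar> < real K" using reals_Archimedean2[of "6 / \<bar>Im z\<bar>"] ..
    then have "6 < real K * \<bar>Im z\<bar>" by (simp only: pos_divide_less_eq[OF pos])
    moreover have "\<bar>Im z\<bar> * real (Suc K) \<le> 6"
      using bound[of K] by (simp only: pos_le_divide_eq[of "real (Suc K)", OF of_nat_0_less_iff[THEN iffD2, OF zero_less_Suc]])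
    moreover have "\<bar>Im z\<bar> * real (Suc K) = real K * \<bar>Im z\<bar> + \<bar>Im z\<bar>" by (simp add: algebra_simps)
    ultimately show False using pos by linarith
  qed
  then show ?thesis by simp
qed

text \<open>Bookkeeping for sequences built from \<open>u\<close> that are bounded by a multiple of
  \<open>D u\<close>. In \<open>periodic_gap_below\<close>, \<open>D u\<close> is the norm of
  \<open>(H - z) u\<close>, and the closure rules cover finite combinations of its translates with
  bounded coefficients.\<close>

definition controlled :: "('a l2 \<Rightarrow> real) \<Rightarrow> ('a l2 \<Rightarrow> 'a \<Rightarrow> complex) \<Rightarrow> bool" where
  "controlled D Z \<longleftrightarrow> (\<exists>C. \<forall>u. Z u \<in> ell2 \<and> norm (Abs_l2 (Z u)) \<le> C * D u)"

lemma controlled_add: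
  assumes "controlled D Y" "controlled D Z"
  shows "controlled D (\<lambda>u x. Y u x + Z u x)"
proof -
  obtain A B where AB: "\<And>u. Y u \<in> ell2" "\<And>u. norm (Abs_l2 (Y u)) \<le> A * D u"
    "\<And>u. Z u \<in> ell2" "\<And>u. norm (Abs_l2 (Z u)) \<le> B * D u"
    using assms unfolding controlled_def by blast
  have "Abs_l2 (\<lambda>x. Y u x + Z u x) = Abs_l2 (Y u) + Abs_l2 (Z u)" for u
    using AB by (simp add: plus_l2.abs_eq eq_onp_same_args)
  then have "norm (Abs_l2 (\<lambda>x. Y u x + Z u x)) \<le> (A + B) * D u" for u
    using norm_triangle_mono[OF AB(2)[of u] AB(4)[of u]] by (simp only: distrib_right)
  then show ?thesis unfolding controlled_def using ell2_add[OF AB(1,3)] by blast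
qed

lemma controlled_mult:
  assumes "controlled D Z" and m: "\<And>x. cmod (m x) \<le> K"
  shows "controlled D (\<lambda>u x. m x * Z u x)"
proof -
  obtain C where C: "\<And>u. Z u \<in> ell2" "\<And>u. norm (Abs_l2 (Z u)) \<le> C * D u"
    using assms unfolding controlled_def by blast
  have "K \<ge> 0" using order_trans[OF norm_ge_zero m] .
  then have "norm (Abs_l2 (\<lambda>x. m x * Z u x)) \<le> K * C * D u" for u
    using order_trans[OF norm_bounded_mult[OF C(1) m] mult_left_mono[OF C(2)]] by (simp only: mult.assoc)
  moreover have "(\<lambda>x. m x * Z u x) \<in> ell2" for u by (rule ell2_bounded_mult[OF C(1) m])
  ultimately show ?thesis unfolding controlled_def by blast
qed

lemma controlled_diff:
  assumes "controlled D Y" "controlled D Z"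
  shows "controlled D (\<lambda>u x. Y u x - Z u x)"
  using controlled_add[OF assms(1) controlled_mult[OF assms(2), of "\<lambda>x. - 1" 1]] by simp

lemma controlled_reindex:
  assumes "controlled D Z" and g: "bij g"
  shows "controlled D (\<lambda>u x. Z u (g x))"
proof -
  obtain C where C: "\<And>u. Z u \<in> ell2" "\<And>u. norm (Abs_l2 (Z u)) \<le> C * D u"
    using assms unfolding controlled_def by blast
  have "norm (Abs_l2 (\<lambda>x. Z u (g x))) = norm (Abs_l2 (Z u))" for u
    using norm_reidx[OF g, of "Abs_l2 (Z u)"] by (simp only: reidx_def Abs_l2_inverse[OF C(1)])
  then show ?thesis unfolding controlled_def using ell2_reindex[OF C(1) g] C(2) by auto
qed

lemma tm_bounded:
  assumes q: "\<And>n. \<bar>q n\<bar> \<le> B"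
  shows "\<exists>K. \<forall>i a b. cmod (tm q z i k $ a $ b) \<le> K"
proof (induction k)
  case 0
  have "cmod (tm q z i 0 $ a $ b) \<le> 1" for i a b by (simp add: mat_def)
  then show ?case by blast
next
  case (Suc k)
  then obtain K where K: "\<And>i a b. cmod (tm q z i k $ a $ b) \<le> K" by blast
  have K0: "K \<ge> 0" using order_trans[OF norm_ge_zero K] .
  have "cmod (tm q z i (Suc k) $ a $ b) \<le> (cmod z + B + 1) * K" for i a b
  proof -
    define e where "e = z - of_real (q (i + int k))"
    have e: "cmod e \<le> cmod z + B"
      using norm_triangle_ineq4[of z "of_real (q (i + int k))"] q[of "i + int k"] by (simp add: e_def)
    have "tm q z i (Suc k) $ 1 $ b = e * tm q z i k $ 1 $ b - tm q z i k $ 2 $ b"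
      by (simp add: matrix_matrix_mult_def sum_2 step_simps e_def)
    then have "cmod (tm q z i (Suc k) $ 1 $ b) \<le> cmod e * cmod (tm q z i k $ 1 $ b) + cmod (tm q z i k $ 2 $ b)"
      by (metis norm_mult norm_triangle_ineq4)
    also have "\<dots> \<le> (cmod z + B) * K + K"
      using order_trans[OF norm_ge_zero e] by (intro add_mono mult_mono K e) auto
    finally have 1: "cmod (tm q z i (Suc k) $ 1 $ b) \<le> (cmod z + B + 1) * K" by (simp add: algebra_simps)
    have "tm q z i (Suc k) $ 2 $ b = tm q z i k $ 1 $ b"
      by (simp add: matrix_matrix_mult_def sum_2 step_simps)
    then have "cmod (tm q z i (Suc k) $ 2 $ b) \<le> 1 * K" using K by simp
    also have "\<dots> \<le> (cmod z + B + 1) * K"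
      using K0 order_trans[OF norm_ge_zero e] by (intro mult_right_mono) auto
    finally show ?thesis using 1 exhaust_2[of a] by auto
  qed
  then show ?case by blast
qed

text \<open>By Cayley--Hamilton, \<open>u (n + N) + u (n - N) - 2 * x * u n\<close> is a local linear expression in \<open>(H - z) u\<close>.\<close>

lemma periodic_gap_below:
  assumes q: "\<And>n. \<bar>q n\<bar> \<le> B" and per: "\<And>n. q (n + int N) = q n"
    and tr: "trace (tm q z 1 N) = 2 * of_real x" "\<bar>x\<bar> > 1"
  shows "\<exists>\<epsilon>>0. \<forall>u. \<epsilon> * norm u \<le> norm (l2_op (schr q) u - cs z u)"
proof -
  define D where "D u = norm (l2_op (schr q) u - cs z u)" for u
  define f where "f u = l2_fun (l2_op (schr q) u - cs z u)" for u
  have f: "f u n = l2_fun u (n + 1) + l2_fun u (n - 1) + of_real (q n) * l2_fun u n - z * l2_fun u n" for u n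
    by (simp add: f_def l2_fun_schr[OF q] cs.rep_eq schr_def)
  have cf: "controlled D f"
    unfolding controlled_def by (intro exI[of _ 1]) (simp add: f_def D_def l2_fun_inverse del: l2_fun_simps)
  define \<Psi> :: "int l2 \<Rightarrow> int \<Rightarrow> complex^2" where "\<Psi> u n = vector [l2_fun u n, l2_fun u (n - 1)]" for u n
  \<comment> \<open>The defect of the transfer matrix: it vanishes for solutions of the eigenvalue
    equation and otherwise accumulates the values of \<open>f u\<close>.\<close>
  define R where "R k u n = \<Psi> u (n + int k) - tm q z n k *v \<Psi> u n" for k u n
  have \<Psi>1: "\<Psi> u (n + 1) = step (z - of_real (q n)) *v \<Psi> u n + vector [f u n, 0]" for u n
    by (simp add: \<Psi>_def vec_eq_iff forall_2 step_mult_vec f algebra_simps)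
  have R_Suc: "R (Suc k) u n = step (z - of_real (q (n + int k))) *v R k u n + vector [f u (n + int k), 0]" for k u n
  proof -
    have "R (Suc k) u n = \<Psi> u (n + int k + 1) - step (z - of_real (q (n + int k))) *v (tm q z n k *v \<Psi> u n)"
      by (simp add: R_def matrix_vector_mul_assoc add_ac)
    then show ?thesis by (simp add: \<Psi>1 R_def matrix_vector_mult_diff_distrib)
  qed
  have eb: "cmod (z - of_real (q n)) \<le> cmod z + B" for n
    using norm_triangle_ineq4[of z "of_real (q n)"] q[of n] by simp
  have R: "controlled D (\<lambda>u n. R k u n $ 1) \<and> controlled D (\<lambda>u n. R k u n $ 2)" for k
  proof (induction k)
    case 0
    have "controlled D (\<lambda>u n. 0)"
      unfolding controlled_def by (intro exI[of _ 0]) (simp add: ell2_zero flip: zero_l2_def)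
    then show ?case by (simp add: R_def)
  next
    case (Suc k)
    have "controlled D (\<lambda>u n. ((z - of_real (q (n + int k))) * R k u n $ 1 - R k u n $ 2) + f u (n + int k))"
      using Suc eb by (intro controlled_add controlled_diff controlled_mult controlled_reindex[OF cf bij_shift(1)]) auto
    then show ?case using Suc by (simp add: R_Suc step_mult_vec)
  qed
  define g where "g u n = l2_fun u (n + int N) + l2_fun u (n - int N) - 2 * of_real x * l2_fun u n" for u n
  have g_eq: "g u n = R N u n $ 1 + (tm q z n N $ 1 $ 2 * R N u (n - int N) $ 2 - tm q z n N $ 2 $ 2 * R N u (n - int N) $ 1)" for u n
  proof -
    define M where "M = tm q z n N"
    have M': "tm q z (n - int N) N = M"
      unfolding M_def
    proof (rule tm_cong)
      show "q (n - int N + int j) = q (n + int j)" for j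
        using per[of "n - int N + int j"] by (simp add: algebra_simps)
    qed
    have trM: "M $ 1 $ 1 + M $ 2 $ 2 = 2 * of_real x"
      using trace_tm_periodic[of q N z n 1] per tr by (simp add: M_def trace_2)
    have detM: "M $ 1 $ 1 * M $ 2 $ 2 - M $ 1 $ 2 * M $ 2 $ 1 = 1"
      using det_tm[of q z n N] by (simp add: M_def det_2)
    define U where "U = l2_fun u"
    define p where "p = R N u (n - int N)"
    have 1: "U (n + int N) = M $ 1 $ 1 * U n + M $ 1 $ 2 * U (n - 1) + R N u n $ 1"
      by (simp add: R_def \<Psi>_def M_def U_def matrix_vector_mult_def sum_2)
    have 2: "U n = M $ 1 $ 1 * U (n - int N) + M $ 1 $ 2 * U (n - int N - 1) + p $ 1"
      "U (n - 1) = M $ 2 $ 1 * U (n - int N) + M $ 2 $ 2 * U (n - int N - 1) + p $ 2"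
      by (simp_all add: p_def R_def \<Psi>_def M' U_def matrix_vector_mult_def sum_2 algebra_simps)
    \<comment> \<open>The value one period back is recovered by applying the adjugate of
      \<open>M\<close>, which is its inverse since the determinant is 1.\<close>
    have "M $ 2 $ 2 * U n - M $ 1 $ 2 * U (n - 1) = (M $ 1 $ 1 * M $ 2 $ 2 - M $ 1 $ 2 * M $ 2 $ 1) * U (n - int N) + M $ 2 $ 2 * p $ 1 - M $ 1 $ 2 * p $ 2"
      unfolding 2 by (simp add: algebra_simps)
    then have 3: "U (n - int N) = M $ 2 $ 2 * U n - M $ 1 $ 2 * U (n - 1) - M $ 2 $ 2 * p $ 1 + M $ 1 $ 2 * p $ 2"
      using detM by simp
    have "g u n = R N u n $ 1 + (M $ 1 $ 2 * p $ 2 - M $ 2 $ 2 * p $ 1) + (M $ 1 $ 1 + M $ 2 $ 2 - 2 * of_real x) * U n"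
      unfolding g_def U_def[symmetric] 1 3 by (simp add: algebra_simps)
    then show ?thesis using trM by (simp add: M_def p_def)
  qed
  obtain K where K: "\<And>i a b. cmod (tm q z i N $ a $ b) \<le> K" using tm_bounded[of q B z N] q by blast
  have "controlled D g"
    unfolding g_eq[abs_def]
    by (intro controlled_add controlled_diff controlled_mult[where K = K] K R[THEN conjunct1] R[THEN conjunct2]
        controlled_reindex[OF R[THEN conjunct1] bij_shift(2)] controlled_reindex[OF R[THEN conjunct2] bij_shift(2)])
  then obtain C where C: "\<And>u. norm (Abs_l2 (g u)) \<le> C * D u" unfolding controlled_def by blast
  \<comment> \<open>The two translates of \<open>u\<close> together have norm at most
    \<open>2 * norm u\<close>, so \<open>2 * \<bar>x\<bar> > 2\<close> leaves a positive lower bound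
    for the norm of \<open>g u\<close>.\<close>
  have "(2 * \<bar>x\<bar> - 2) * norm u \<le> (\<bar>C\<bar> + 1) * D u" for u
  proof -
    define W where "W = reidx (\<lambda>n. n + int N) u + reidx (\<lambda>n. n - int N) u"
    have "norm W \<le> 2 * norm u"
      using norm_triangle_ineq[of "reidx (\<lambda>n. n + int N) u" "reidx (\<lambda>n. n - int N) u"]
      by (simp add: W_def norm_reidx bij_shift)
    then have "(2 * \<bar>x\<bar> - 2) * norm u \<le> norm (W - (2 * x) *\<^sub>R u)"
      using norm_triangle_ineq2[of "(2 * x) *\<^sub>R u" W] by (simp add: norm_minus_commute abs_mult algebra_simps)
    also have "l2_fun (W - (2 * x) *\<^sub>R u) = g u"
      by (simp add: W_def g_def l2_fun_reidx bij_shift fun_eq_iff)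
    then have "W - (2 * x) *\<^sub>R u = Abs_l2 (g u)" by (metis l2_fun_inverse)
    also have "norm (Abs_l2 (g u)) \<le> C * D u" by (rule C)
    also have "\<dots> \<le> (\<bar>C\<bar> + 1) * D u" by (intro mult_right_mono) (auto simp: D_def)
    finally show ?thesis .
  qed
  then have "(2 * \<bar>x\<bar> - 2) / (\<bar>C\<bar> + 1) * norm u \<le> D u" for u
    by (simp add: pos_divide_le_eq add_nonneg_pos mult.commute)
  moreover have "(2 * \<bar>x\<bar> - 2) / (\<bar>C\<bar> + 1) > 0" using tr by (intro divide_pos_pos) auto
  ultimately show ?thesis unfolding D_def by blast
qed

section \<open>The Fibonacci word\<close>

lemma fib_alpha_props: "fib_alpha\<^sup>2 = 1 - fib_alpha" "0 < fib_alpha" "fib_alpha < 1" "1/2 < fib_alpha"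
proof -
  have s: "sqrt 5 * sqrt 5 = 5" by simp
  show "fib_alpha\<^sup>2 = 1 - fib_alpha" by (simp add: fib_alpha_def power2_eq_square field_simps)
  have "sqrt 5 > 2" "sqrt 5 < 3" by (auto simp: real_less_rsqrt real_less_lsqrt)
  then show "0 < fib_alpha" "fib_alpha < 1" "1/2 < fib_alpha" by (auto simp: fib_alpha_def)
qed

lemma fib_alpha_bounds: "0.618 < fib_alpha" "fib_alpha < 0.619"
proof -
  have "2.236 < sqrt 5" by (rule real_less_rsqrt) (simp add: power2_eq_square)
  moreover have "sqrt 5 < 2.238" by (rule real_less_lsqrt) (simp_all add: power2_eq_square)
  ultimately show "0.618 < fib_alpha" "fib_alpha < 0.619" by (auto simp: fib_alpha_def)
qed

text \<open>Adding \<open>fib_alpha\<close> passes an integer exactly when the fractional part is at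
  least \<open>1 - fib_alpha\<close>. In this form the equality of letters reduces to the equality
  of floors.\<close>

lemma fib_word_floor:
  "fib_word \<omega> n = of_int (\<lfloor>of_int n * fib_alpha + \<omega> + fib_alpha\<rfloor> - \<lfloor>of_int n * fib_alpha + \<omega>\<rfloor>)"
proof -
  define y where "y = of_int n * fib_alpha + \<omega>"
  have y: "y = of_int \<lfloor>y\<rfloor> + frac y" "0 \<le> frac y" "frac y < 1" by (auto simp: frac_def frac_lt_1[unfolded frac_def])
  have "indicator {1 - fib_alpha..<1} (frac y) = real_of_int (\<lfloor>y + fib_alpha\<rfloor> - \<lfloor>y\<rfloor>)"
  proof (cases "frac y \<ge> 1 - fib_alpha")
    case True
    have "\<lfloor>y + fib_alpha\<rfloor> = \<lfloor>y\<rfloor> + 1"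
      by (rule floor_unique) (use y True fib_alpha_props(3) in linarith)+
    then show ?thesis using True y by simp
  next
    case False
    have "\<lfloor>y + fib_alpha\<rfloor> = \<lfloor>y\<rfloor>"
      by (rule floor_unique) (use y False fib_alpha_props(2) in linarith)+
    then show ?thesis using False by simp
  qed
  then show ?thesis by (simp add: fib_word_def y_def)
qed

lemma fib_word_bounded: "\<bar>fib_word \<omega> n\<bar> \<le> 1"
  by (simp add: fib_word_def indicator_def)

text \<open>Both sides obey the Fibonacci recursion because \<open>1 - fib_alpha\<close> is the
  square of \<open>fib_alpha\<close>. The size of the error serves \<open>fib_word_prefix\<close>,
  its alternating sign \<open>one_sided_density\<close>.\<close>

lemma fib_convergent: "real (fib (Suc m)) * fib_alpha - real (fib m) = - ((- fib_alpha) ^ Suc m)"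
proof (induction m rule: fib.induct)
  case 2
  show ?case using fib_alpha_props(1) by (simp add: power2_eq_square)
next
  case (3 n)
  have "real (fib (Suc (Suc (Suc n)))) * fib_alpha - real (fib (Suc (Suc n)))
     = (real (fib (Suc (Suc n))) * fib_alpha - real (fib (Suc n))) + (real (fib (Suc n)) * fib_alpha - real (fib n))"
    by (simp add: algebra_simps)
  also have "\<dots> = - ((- fib_alpha) ^ Suc (Suc n)) + - ((- fib_alpha) ^ Suc n)" using 3 by simp
  also have "\<dots> = - ((- fib_alpha) ^ Suc n * (1 - fib_alpha))" by (simp add: algebra_simps)
  also have "\<dots> = - ((- fib_alpha) ^ Suc n * fib_alpha\<^sup>2)" by (simp add: fib_alpha_props(1))
  also have "\<dots> = - ((- fib_alpha) ^ Suc (Suc (Suc n)))" by (simp add: power2_eq_square)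
  finally show ?case .
qed simp

lemma fib_alpha_power: "fib_alpha ^ m * (real (fib (Suc m)) + fib_alpha * real (fib m)) = 1"
proof (induction m)
  case (Suc m)
  have "fib_alpha ^ Suc m * (real (fib (Suc (Suc m))) + fib_alpha * real (fib (Suc m)))
      = fib_alpha ^ m * ((fib_alpha + fib_alpha\<^sup>2) * real (fib (Suc m)) + fib_alpha * real (fib m))"
    by (simp add: power2_eq_square algebra_simps)
  also have "fib_alpha + fib_alpha\<^sup>2 = 1" by (simp add: fib_alpha_props(1))
  finally show ?case using Suc by simp
qed simp

text \<open>Odd powers of \<open>fib_alpha\<close> are positive errors of convergents, so the
  multiples of a small one climb in steps below \<open>\<delta>\<close> and must enter the window.
  The integer \<open>P\<close> lifts the target far enough for the index to exceed
  \<open>K\<close>.\<close>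

lemma one_sided_density:
  assumes "\<delta> > 0"
  shows "\<exists>k p :: int. K \<le> k \<and> y \<le> of_int k * fib_alpha - of_int p \<and> of_int k * fib_alpha - of_int p < y + \<delta>"
proof -
  obtain m where m: "fib_alpha ^ m < \<delta>" using real_arch_pow_inv[OF assms fib_alpha_props(3)] by blast
  define \<kappa> where "\<kappa> = fib_alpha ^ Suc (2 * m)"
  have "\<kappa> \<le> fib_alpha ^ m" unfolding \<kappa>_def using fib_alpha_props by (intro power_decreasing) auto
  then have \<kappa>\<delta>: "\<kappa> < \<delta>" using m by simp
  have \<kappa>0: "0 < \<kappa>" unfolding \<kappa>_def using fib_alpha_props by (intro zero_less_power)
  have \<kappa>1: "\<kappa> \<le> 1" unfolding \<kappa>_def using fib_alpha_props by (intro power_le_one) auto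
  note \<kappa> = \<kappa>0 \<kappa>\<delta> \<kappa>1
  have \<kappa>_eq: "real (fib (Suc (2 * m))) * fib_alpha - real (fib (2 * m)) = \<kappa>"
    using fib_convergent[of "2 * m"] by (simp add: \<kappa>_def)
  obtain P :: nat where P: "\<bar>y\<bar> + \<bar>of_int K\<bar> \<le> real P" using real_arch_simple ..
  define y' where "y' = y + real P"
  have y': "y' \<ge> \<bar>of_int K\<bar>" using P by (simp add: y'_def)
  define n where "n = \<lceil>y' / \<kappa>\<rceil>"
  have n: "y' / \<kappa> \<le> of_int n" "of_int n < y' / \<kappa> + 1" unfolding n_def by linarith+
  have n1: "y' \<le> of_int n * \<kappa>" "of_int n * \<kappa> < y' + \<kappa>"
    using n \<kappa>0 by (simp_all add: pos_divide_le_eq pos_less_divide_eq flip: pos_less_divide_eq add_divide_distrib) (simp add: field_simps)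
  have "y' \<le> y' / \<kappa>" using \<kappa> y' by (simp add: pos_le_divide_eq mult_left_le)
  then have "\<bar>of_int K\<bar> \<le> (of_int n :: real)" using n y' by linarith
  then have nK: "\<bar>K\<bar> \<le> n" by linarith
  define k where "k = n * int (fib (Suc (2 * m)))"
  define p where "p = n * int (fib (2 * m)) + int P"
  have "fib (Suc (2 * m)) \<ge> 1" using fib_neq_0_nat[of "Suc (2 * m)"] by linarith
  then have "n * 1 \<le> k" unfolding k_def using nK by (intro mult_left_mono) auto
  moreover have "of_int k * fib_alpha - of_int p = of_int n * \<kappa> - real P"
    unfolding \<kappa>_eq[symmetric] by (simp add: k_def p_def algebra_simps)
  ultimately show ?thesis using n1 nK \<kappa> by (intro exI[of _ k] exI[of _ p]) (auto simp: y'_def)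
qed

text \<open>Since \<open>fib_word\<close> is right continuous in the phase, it suffices to approximate \<open>\<omega>\<close> from above.\<close>

lemma fib_word_window:
  assumes "finite F"
  shows "\<exists>k\<ge>K. \<forall>n\<in>F. fib_word \<omega>' (n + k) = fib_word \<omega> n"
proof -
  define y where "y n = of_int n * fib_alpha + \<omega>" for n
  define d where "d x = of_int \<lfloor>x\<rfloor> + 1 - x" for x :: real
  have d0: "d x > 0" for x unfolding d_def by linarith
  define S where "S = insert 1 ((\<lambda>n. d (y n)) ` F \<union> (\<lambda>n. d (y n + fib_alpha)) ` F)"
  have S: "finite S" "S \<noteq> {}" using assms by (auto simp: S_def)
  have "Min S > 0" using S d0 by (auto simp: S_def)
  then obtain k p where kp: "K \<le> k" "\<omega> - \<omega>' \<le> of_int k * fib_alpha - of_int p" "of_int k * fib_alpha - of_int p < \<omega> - \<omega>' + Min S"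
    using one_sided_density by blast
  define \<eta> where "\<eta> = of_int k * fib_alpha - of_int p - (\<omega> - \<omega>')"
  have \<eta>: "0 \<le> \<eta>" "\<eta> < Min S" using kp by (auto simp: \<eta>_def)
  have fl: "\<lfloor>x + of_int p + \<eta>\<rfloor> = \<lfloor>x\<rfloor> + p" if "d x \<in> S" for x
  proof -
    have "\<eta> < d x" using \<eta> Min_le[OF S(1) that] by linarith
    then show ?thesis using \<eta> by (intro floor_unique) (auto simp: d_def, linarith+)
  qed
  have "fib_word \<omega>' (n + k) = fib_word \<omega> n" if "n \<in> F" for n
  proof -
    have e: "of_int (n + k) * fib_alpha + \<omega>' = y n + of_int p + \<eta>"
      by (simp add: y_def \<eta>_def algebra_simps)
    have e': "y n + of_int p + \<eta> + fib_alpha = (y n + fib_alpha) + of_int p + \<eta>" by simp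
    have "\<lfloor>y n + of_int p + \<eta>\<rfloor> = \<lfloor>y n\<rfloor> + p" "\<lfloor>(y n + fib_alpha) + of_int p + \<eta>\<rfloor> = \<lfloor>y n + fib_alpha\<rfloor> + p"
      using that by (auto intro!: fl simp: S_def)
    then show ?thesis unfolding fib_word_floor e e' y_def[symmetric] by simp
  qed
  then show ?thesis using kp by blast
qed

text \<open>The form is the norm of \<open>i * fib_alpha - p\<close> in the field of
  \<open>sqrt 5\<close>. Modulo 2 it has only the trivial zero, so infinite descent applies.\<close>

lemma fib_norm_nonzero:
  fixes i p :: int
  assumes "- (i * i) + i * p + p * p = 0"
  shows "i = 0"
  using assms
proof (induction "nat \<bar>i\<bar>" arbitrary: i p rule: less_induct)
  case less
  have "even (- (i * i) + i * p + p * p)" by (simp only: less.prems even_zero)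
  then have "even i \<and> even p" by (cases "even i"; cases "even p") simp_all
  then obtain i' p' where ip: "i = 2 * i'" "p = 2 * p'" by (auto elim!: evenE)
  have "4 * (- (i' * i') + i' * p' + p' * p') = 0" using less.prems by (simp add: ip algebra_simps)
  then have eq: "- (i' * i') + i' * p' + p' * p' = 0" by simp
  show ?case
  proof (rule ccontr)
    assume "i \<noteq> 0"
    then have "nat \<bar>i'\<bar> < nat \<bar>i\<bar>" "i' \<noteq> 0" using ip by auto
    then show False using less.hyps[OF _ eq] by simp
  qed
qed

text \<open>Multiplied by its conjugate, \<open>i * fib_alpha - p\<close> is a nonzero integer, so
  it cannot be much smaller than \<open>1 / i\<close>. The threshold is the error of the convergent
  with denominator \<open>fib m\<close>; the contradiction comes from \<open>fib_alpha_power\<close>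
  at \<open>m - 1\<close>. The range of \<open>i\<close> has one extra index because a letter
  compares the floors at \<open>i\<close> and \<open>i + 1\<close>.\<close>

lemma fib_alpha_approx:
  assumes m: "m \<ge> 5" and i: "1 \<le> i" "i \<le> fib (m - 1) + 1"
  shows "\<bar>real i * fib_alpha - of_int p\<bar> > fib_alpha ^ m"
proof (rule ccontr)
  define a where "a = fib_alpha"
  define e where "e = real i * a - of_int p"
  note al = fib_alpha_props[folded a_def]
  assume "\<not> ?thesis"
  then have e: "\<bar>e\<bar> \<le> a ^ m" by (simp add: e_def a_def)
  have i0: "real i > 0" using i by simp
  define N where "N = - (int i * int i) + int i * p + p * p"
  have N: "e * (- (real i * (1 + a)) - of_int p) = of_int N"
  proof -
    have "e * (- (real i * (1 + a)) - of_int p) = - (real i * real i * (a + a\<^sup>2)) + real i * of_int p + of_int p * of_int p"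
      by (simp add: e_def power2_eq_square algebra_simps)
    also have "a + a\<^sup>2 = 1" by (simp add: al)
    finally show ?thesis by (simp add: N_def)
  qed
  have "N \<noteq> 0" using fib_norm_nonzero[of "int i" p] i by (auto simp: N_def)
  then have "1 \<le> \<bar>real_of_int N\<bar>" by linarith
  also have "\<bar>real_of_int N\<bar> = \<bar>e\<bar> * \<bar>- (real i * (1 + a)) - of_int p\<bar>" unfolding N[symmetric] abs_mult ..
  also have "- (real i * (1 + a)) - of_int p = e - real i * (1 + 2 * a)" by (simp add: e_def algebra_simps)
  also have "\<bar>e\<bar> * \<bar>e - real i * (1 + 2 * a)\<bar> \<le> a ^ m * (a ^ m + real i * (1 + 2 * a))"
  proof (intro mult_mono e)
    have "0 \<le> real i * (1 + 2 * a)" using i0 al by simp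
    then show "\<bar>e - real i * (1 + 2 * a)\<bar> \<le> a ^ m + real i * (1 + 2 * a)" using e by linarith
  qed (use al in auto)
  finally have le: "1 \<le> a ^ m * (a ^ m + real i * (1 + 2 * a))" .
  define j where "j = m - 3"
  then have j: "m = Suc (Suc (Suc j))" "j \<ge> 2" using m by auto
  define f where "f = real (fib (Suc (Suc j)))"
  define g where "g = real (fib (Suc j))"
  have fib3: "fib 3 = 2" by (simp add: eval_nat_numeral)
  have "fib 3 \<le> fib (Suc j)" "fib 3 \<le> fib (Suc (Suc j))" by (rule fib_mono, use j in simp)+
  then have g: "g \<ge> 2" and f: "f \<ge> 2" unfolding g_def f_def fib3 by linarith+
  have "real i \<le> f + 1" using i(2) j by (simp add: f_def)
  then have "a * (a ^ m + real i * (1 + 2 * a)) \<le> a * (a ^ m + (f + 1) * (1 + 2 * a))"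
    using al by (intro mult_left_mono add_left_mono mult_right_mono) auto
  also have "\<dots> = a * a ^ m + (f + 1) * (a + 2 * a\<^sup>2)" by (simp add: power2_eq_square algebra_simps)
  also have "\<dots> = a * a ^ m + (f + 1) * (2 - a)" by (simp add: al)
  also have "a * a ^ m \<le> a * 1" using al by (intro mult_left_mono power_le_one) auto
  finally have "a * (a ^ m + real i * (1 + 2 * a)) \<le> a + (f + 1) * (2 - a)" by simp
  also have "\<dots> = f + 2 + f * (1 - a)" by (simp add: algebra_simps)
  also have "\<dots> < f + g + a * f"
  proof -
    have "f * (2 * a - 1) > 0" using f al by simp
    then show ?thesis using g by (simp add: algebra_simps)
  qed
  finally have lt: "a * (a ^ m + real i * (1 + 2 * a)) < f + g + a * f" .
  have am: "a ^ m = a ^ (m - 1) * a" by (simp add: j)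
  have "1 \<le> a ^ (m - 1) * (a * (a ^ m + real i * (1 + 2 * a)))"
    using le by (simp only: am mult.assoc)
  also have "\<dots> < a ^ (m - 1) * (f + g + a * f)"
    using al by (intro mult_strict_left_mono lt) auto
  also have "\<dots> = 1"
    using fib_alpha_power[of "m - 1"] j by (simp add: a_def f_def g_def)
  finally show False by simp
qed

lemma fib_word_values: "fib_word 0 1 = 1" "fib_word 0 2 = 0" "fib_word 0 3 = 1" "fib_word 0 4 = 1" "fib_word 0 5 = 0"
proof -
  note b = fib_alpha_bounds
  have "\<lfloor>fib_alpha\<rfloor> = 0" "\<lfloor>2 * fib_alpha\<rfloor> = 1" "\<lfloor>3 * fib_alpha\<rfloor> = 1" "\<lfloor>4 * fib_alpha\<rfloor> = 2" "\<lfloor>5 * fib_alpha\<rfloor> = 3" "\<lfloor>6 * fib_alpha\<rfloor> = 3"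
    using b by (auto intro!: floor_unique)
  then show "fib_word 0 1 = 1" "fib_word 0 2 = 0" "fib_word 0 3 = 1" "fib_word 0 4 = 1" "fib_word 0 5 = 0"
    by (auto simp: fib_word_floor algebra_simps)
qed

text \<open>A shift by \<open>fib m\<close> changes \<open>i * fib_alpha\<close> by an integer and
  an error of size \<open>fib_alpha ^ m\<close>, which by \<open>fib_alpha_approx\<close> is too
  small to pass an integer. That bound starts at \<open>m = 5\<close>; the two earlier cases are
  read off the word.\<close>

lemma fib_word_prefix:
  assumes m: "m \<ge> 3" and i: "1 \<le> i" "i \<le> fib (m - 1)"
  shows "fib_word 0 (int (fib m + i)) = fib_word 0 (int i)"
proof -
  consider "m = 3" | "m = 4" | "m \<ge> 5" using m by linarith
  then show ?thesis
  proof cases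
    case 1
    then have "i = 1" "fib m = 2" using i by (auto simp: numeral_3_eq_3)
    then show ?thesis by (simp add: fib_word_values)
  next
    case 2
    have "fib 4 = 3" "fib 3 = 2" by (simp_all add: eval_nat_numeral)
    then have "i = 1 \<or> i = 2" "fib m = 3" using i 2 by auto
    then show ?thesis by (auto simp: fib_word_values)
  next
    case 3
    obtain l where l: "m = Suc l" using m by (cases m) auto
    define \<epsilon> where "\<epsilon> = real (fib m) * fib_alpha - real (fib (m - 1))"
    have \<epsilon>: "\<bar>\<epsilon>\<bar> = fib_alpha ^ m"
      using fib_convergent[of l] fib_alpha_props by (simp add: \<epsilon>_def l power_abs[symmetric] abs_mult)
    have fl: "\<lfloor>real (fib m + j) * fib_alpha\<rfloor> = \<lfloor>real j * fib_alpha\<rfloor> + int (fib (m - 1))"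
      if j: "1 \<le> j" "j \<le> fib (m - 1) + 1" for j
    proof (rule floor_unique)
      define s where "s = \<lfloor>real j * fib_alpha\<rfloor>"
      have "of_int s \<le> real j * fib_alpha" "real j * fib_alpha < of_int s + 1" unfolding s_def by linarith+
      moreover have "\<bar>real j * fib_alpha - of_int s\<bar> > \<bar>\<epsilon>\<bar>" "\<bar>real j * fib_alpha - of_int (s + 1)\<bar> > \<bar>\<epsilon>\<bar>"
        unfolding \<epsilon> by (rule fib_alpha_approx[OF 3 j])+
      moreover have "real (fib m + j) * fib_alpha = real j * fib_alpha + real (fib (m - 1)) + \<epsilon>"
        by (simp add: \<epsilon>_def algebra_simps)
      ultimately show "of_int (\<lfloor>real j * fib_alpha\<rfloor> + int (fib (m - 1))) \<le> real (fib m + j) * fib_alpha"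
        "real (fib m + j) * fib_alpha < of_int (\<lfloor>real j * fib_alpha\<rfloor> + int (fib (m - 1))) + 1"
        unfolding s_def[symmetric] by (auto simp: abs_real_def split: if_splits)
    qed
    have w: "fib_word 0 (int n) = of_int (\<lfloor>real (n + 1) * fib_alpha\<rfloor> - \<lfloor>real n * fib_alpha\<rfloor>)" for n
      by (simp add: fib_word_floor algebra_simps)
    show ?thesis unfolding w using fl[of i] fl[of "i + 1"] i by (simp add: add.assoc)
  qed
qed

text \<open>By \<open>fib_word_prefix\<close> the block of length \<open>fib (k + 2)\<close> is the
  block of length \<open>fib (k + 1)\<close> followed by that of length \<open>fib k\<close>. The
  prefix property starts at 3, so the recursion is used from \<open>k = 2\<close> on, with the three
  initial traces computed directly.\<close>

lemma trace_tm_fib: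
  assumes "k \<ge> 2"
  shows "trace (tm (\<lambda>n. V * fib_word 0 n) z 1 (fib k)) = 2 * tr V k z"
proof -
  define M where "M k = tm (\<lambda>n. V * fib_word 0 n) z 1 (fib k)" for k
  have M_Suc: "M (Suc (Suc k)) = M k ** M (Suc k)" if "k \<ge> 2" for k
  proof -
    have "M (Suc (Suc k)) = tm (\<lambda>n. V * fib_word 0 n) z (1 + int (fib (Suc k))) (fib k) ** M (Suc k)"
      unfolding M_def fib.simps by (rule tm_add)
    also have "tm (\<lambda>n. V * fib_word 0 n) z (1 + int (fib (Suc k))) (fib k) = M k"
      unfolding M_def
    proof (rule tm_cong)
      fix j assume "j < fib k"
      then have "fib_word 0 (int (fib (Suc k) + Suc j)) = fib_word 0 (int (Suc j))"
        using that by (intro fib_word_prefix) auto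
      then show "V * fib_word 0 (1 + int (fib (Suc k)) + int j) = V * fib_word 0 (1 + int j)"
        by (simp add: add_ac)
    qed
    finally show ?thesis .
  qed
  have rec: "trace (M (k + 3)) = trace (M (k + 2)) * trace (M (k + 1)) - trace (M k)" if k: "k \<ge> 2" for k
  proof -
    have "trace (M (k + 3)) = trace (M (k + 1) ** (M k ** M (k + 1)))"
      using M_Suc[of k] M_Suc[of "Suc k"] k by (simp add: eval_nat_numeral)
    also have "\<dots> = trace (M (k + 1) ** (M (k + 1) ** M k))"
      by (metis matrix_mul_assoc trace_mul_sym)
    also have "\<dots> = trace (M (k + 1)) * trace (M (k + 1) ** M k) - trace (M k)"
      by (rule cayley_hamilton_trace) (simp add: M_def det_tm)
    also have "trace (M (k + 1) ** M k) = trace (M (k + 2))"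
      using M_Suc[of k] k trace_mul_sym[of "M (k + 1)" "M k"] by (simp add: eval_nat_numeral)
    finally show ?thesis by (simp add: mult.commute)
  qed
  have w: "fib_word 0 1 = 1" "fib_word 0 2 = 0" "fib_word 0 3 = 1" by (rule fib_word_values)+
  have fibs: "fib 2 = 1" "fib 3 = 2" "fib 4 = 3" by (simp_all add: eval_nat_numeral)
  have initial: "trace (M 2) = 2 * tr V 2 z" "trace (M 3) = 2 * tr V 3 z" "trace (M 4) = 2 * tr V 4 z"
    by (simp_all add: M_def fibs eval_nat_numeral trace_2 matrix_matrix_mult_def sum_2 step_simps mat_def w[unfolded eval_nat_numeral] field_simps)
  define P where "P n \<longleftrightarrow> trace (M n) = 2 * tr V n z \<and> trace (M (Suc n)) = 2 * tr V (Suc n) z \<and>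
    trace (M (Suc (Suc n))) = 2 * tr V (Suc (Suc n)) z" for n
  have "P k" using assms
  proof (induction k rule: dec_induct)
    case base
    show ?case using initial by (simp add: P_def eval_nat_numeral del: tr.simps)
  next
    case (step n)
    have "trace (M (Suc (Suc (Suc n)))) = trace (M (Suc (Suc n))) * trace (M (Suc n)) - trace (M n)"
      using rec[OF step(1)] by (simp add: eval_nat_numeral)
    then show ?case using step by (simp add: P_def)
  qed
  then show ?thesis by (simp add: P_def M_def)
qed

section \<open>Periodic approximants and real zeros of the traces\<close>

definition per_word :: "nat \<Rightarrow> int \<Rightarrow> real" where
  "per_word N n = fib_word 0 ((n - 1) mod int N + 1)"

lemma per_word_eq: "1 \<le> n \<Longrightarrow> n \<le> int N \<Longrightarrow> per_word N n = fib_word 0 n"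
  by (simp add: per_word_def mod_pos_pos_trivial)

lemma per_word_periodic: "per_word N (n + int N) = per_word N n"
proof -
  have "(n + int N - 1) mod int N = (n - 1) mod int N"
    by (metis add_diff_eq add.commute diff_add_eq mod_add_self2)
  then show ?thesis by (simp add: per_word_def)
qed

lemma trace_per_word:
  assumes "k \<ge> 2"
  shows "trace (tm (\<lambda>n. V * per_word (fib k) n) z 1 (fib k)) = 2 * tr V k z"
proof -
  have "tm (\<lambda>n. V * per_word (fib k) n) z 1 (fib k) = tm (\<lambda>n. V * fib_word 0 n) z 1 (fib k)"
    by (rule tm_cong) (simp add: per_word_eq)
  then show ?thesis using trace_tm_fib[OF assms] by simp
qed

lemma potential_bounded: "\<bar>V * fib_word \<omega> n\<bar> \<le> \<bar>V\<bar>" "\<bar>V * per_word N n\<bar> \<le> \<bar>V\<bar>"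
  using fib_word_bounded by (auto simp: per_word_def abs_mult intro: mult_left_le)

text \<open>A zero of the half trace lies in a band of the periodic approximant, and bands are real
  by symmetry.\<close>

lemma tr_root_real:
  assumes "k \<ge> 1" "tr V k z = (0::complex)"
  shows "Im z = 0"
proof (cases "k = 1")
  case False
  have "fib k \<ge> 1" using fib_neq_0_nat[of k] assms by linarith
  then show ?thesis
  proof (rule periodic_band_real[OF potential_bounded(2)])
    show "V * per_word (fib k) (n + int (fib k)) = V * per_word (fib k) n" for n
      by (simp add: per_word_periodic)
    show "trace (tm (\<lambda>n. V * per_word (fib k) n) z 1 (fib k)) = 2 * of_real 0"
      using trace_per_word[of k V z] assms False by simp
  qed simp
qed (use assms in simp)

fun tr_poly :: "real \<Rightarrow> nat \<Rightarrow> complex poly" where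
  "tr_poly V 0 = 1"
| "tr_poly V (Suc 0) = [:0, 1/2:]"
| "tr_poly V (Suc (Suc 0)) = [:- of_real V / 2, 1/2:]"
| "tr_poly V (Suc (Suc (Suc k))) = smult 2 (tr_poly V (Suc (Suc k)) * tr_poly V (Suc k)) - tr_poly V k"

lemma poly_tr_poly: "poly (tr_poly V k) z = tr V k z"
  by (induction V k rule: tr_poly.induct) (auto simp: field_simps)

lemma tr_poly_degree:
  "degree (tr_poly V (Suc k)) = fib (Suc k) \<and> lead_coeff (tr_poly V (Suc k)) = 1/2"
proof (induction k rule: less_induct)
  case (less k)
  consider "k = 0" | "k = 1" | j where "k = Suc (Suc j)" by (metis One_nat_def not0_implies_Suc)
  then show ?case
  proof cases
    case 3
    define p where "p = smult 2 (tr_poly V (Suc (Suc j)) * tr_poly V (Suc j))"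
    have 1: "degree (tr_poly V (Suc j)) = fib (Suc j)" "lead_coeff (tr_poly V (Suc j)) = 1/2"
      "degree (tr_poly V (Suc (Suc j))) = fib (Suc (Suc j))" "lead_coeff (tr_poly V (Suc (Suc j))) = 1/2"
      using less.IH[of j] less.IH[of "Suc j"] 3 by auto
    then have nz: "tr_poly V (Suc j) \<noteq> 0" "tr_poly V (Suc (Suc j)) \<noteq> 0" by auto
    have "degree p = fib (Suc (Suc (Suc j)))"
      using nz by (simp add: p_def degree_mult_eq 1)
    moreover have "lead_coeff p = 2 * (lead_coeff (tr_poly V (Suc (Suc j))) * lead_coeff (tr_poly V (Suc j)))"
      unfolding p_def by (simp only: lead_coeff_smult lead_coeff_mult)
    then have "lead_coeff p = 1/2" unfolding 1(2,4) by simp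
    ultimately have p: "degree p = fib (Suc (Suc (Suc j)))" "lead_coeff p = 1/2" by auto
    have "degree (tr_poly V j) < degree p"
    proof (cases j)
      case 0
      then show ?thesis by (simp add: p)
    next
      case (Suc i)
      then have "degree (tr_poly V j) = fib j" using less.IH[of i] 3 by auto
      moreover have "fib (Suc j) \<ge> 1" using fib_neq_0_nat[of "Suc j"] by linarith
      ultimately show ?thesis by (simp add: p)
    qed
    then have d: "degree (p - tr_poly V j) = degree p" and c: "coeff (tr_poly V j) (degree p) = 0"
      using degree_add_eq_left[of "- tr_poly V j" p] by (simp_all add: coeff_eq_0)
    then have "lead_coeff (p - tr_poly V j) = lead_coeff p" by simp
    then show ?thesis using 3 p d by (simp add: p_def)
  qed auto
qed

lemma tr_factor_ex:
  "\<exists>r::nat \<Rightarrow> real. \<forall>z::complex. tr V (Suc k) z = (\<Prod>i<fib (Suc k). z - of_real (r i)) / 2"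
proof -
  define p where "p = tr_poly V (Suc k)"
  have p: "degree p = fib (Suc k)" "lead_coeff p = 1/2" using tr_poly_degree[of V k] unfolding p_def by blast+
  obtain root where root: "smult (lead_coeff p) (\<Prod>i<degree p. [:- root i, 1:]) = p"
    by (rule complex_poly_decompose')
  have root': "smult (1/2) (\<Prod>i<fib (Suc k). [:- root i, 1:]) = p"
    using root[unfolded p(2)] by (simp only: p(1))
  have eq: "tr V (Suc k) z = (\<Prod>i<fib (Suc k). z - root i) / 2" for z
  proof -
    have "tr V (Suc k) z = poly p z" by (simp add: p_def poly_tr_poly)
    also have "\<dots> = (\<Prod>i<fib (Suc k). z - root i) / 2"
      by (subst root'[symmetric]) (simp add: poly_prod)
    finally show ?thesis .
  qed
  have "root i = complex_of_real (Re (root i))" if "i < fib (Suc k)" for i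
  proof -
    have "tr V (Suc k) (root i) = 0" using that by (auto simp: eq)
    then show ?thesis using tr_root_real[of "Suc k"] by (simp add: complex_eq_iff)
  qed
  then have "(\<Prod>i<fib (Suc k). z - root i) = (\<Prod>i<fib (Suc k). z - of_real (Re (root i)))" for z
    by (intro prod.cong refl) simp
  then show ?thesis using eq by (intro exI[of _ "\<lambda>i. Re (root i)"]) simp
qed

section \<open>Zeros of the traces and distances between gaps\<close>

definition troot :: "real \<Rightarrow> nat \<Rightarrow> nat \<Rightarrow> real" where
  "troot V k = (SOME r. \<forall>z::complex. tr V k z = (\<Prod>i<fib k. z - of_real (r i)) / 2)"

lemma tr_factor:
  assumes "k \<ge> 1"
  shows "tr V k z = (\<Prod>i<fib k. z - complex_of_real (troot V k i)) / 2"
proof -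
  obtain j where "k = Suc j" using assms by (cases k) auto
  then have "\<exists>r. \<forall>z::complex. tr V k z = (\<Prod>i<fib k. z - of_real (r i)) / 2"
    using tr_factor_ex[of V j] by (simp only:)
  from someI_ex[OF this] show ?thesis unfolding troot_def by blast
qed

lemma tr_factor_real:
  assumes "k \<ge> 1"
  shows "tr V k E = (\<Prod>i<fib k. E - troot V k i) / 2"
proof -
  have "complex_of_real (tr V k E) = of_real ((\<Prod>i<fib k. E - troot V k i) / 2)"
    using tr_factor[OF assms, of V "complex_of_real E"] by (simp add: tr_of_real)
  then show ?thesis by (simp only: of_real_eq_iff)
qed

lemma tr_root_zero: "k \<ge> 1 \<Longrightarrow> i < fib k \<Longrightarrow> tr V k (troot V k i) = 0"
  by (auto simp: tr_factor_real)

text \<open>All zeros are real, so leaving the axis vertically lengthens every factor. An escaped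
  energy therefore stays escaped on its whole vertical line, which is where \<open>cnt_fib\<close>
  works.\<close>

lemma tr_vertical_ge:
  assumes "k \<ge> 1"
  shows "cmod (tr V k (Complex E s)) \<ge> \<bar>tr V k E\<bar>"
proof -
  have "(\<Prod>i<fib k. \<bar>E - troot V k i\<bar>) \<le> (\<Prod>i<fib k. cmod (Complex E s - of_real (troot V k i)))"
    using abs_Re_le_cmod[of "Complex E s - of_real x" for x] by (intro prod_mono) auto
  then show ?thesis
    by (simp add: tr_factor[OF assms] tr_factor_real[OF assms] norm_divide abs_prod prod_norm)
qed

text \<open>A continuous branch of the argument of \<open>tr V k (Complex E s)\<close> for
  \<open>s > 0\<close>; every zero contributes its angle, between 0 and \<open>pi\<close>.\<close>

definition phase :: "real \<Rightarrow> nat \<Rightarrow> real \<Rightarrow> real \<Rightarrow> real" where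
  "phase V k E s = (\<Sum>i<fib k. pi / 2 - arctan ((E - troot V k i) / s))"

lemma Complex_polar:
  assumes "s > 0"
  shows "Complex u s = of_real (cmod (Complex u s)) * cis (pi / 2 - arctan (u / s))"
proof -
  have "cmod (Complex u s) = s * sqrt (1 + (u / s)\<^sup>2)"
  proof -
    have "u\<^sup>2 + s\<^sup>2 = s\<^sup>2 * (1 + (u / s)\<^sup>2)" using assms by (simp add: field_simps)
    then show ?thesis using assms by (simp add: cmod_def real_sqrt_mult)
  qed
  moreover have "sqrt (1 + (u / s)\<^sup>2) > 0" by (intro real_sqrt_gt_zero) (simp add: add_pos_nonneg)
  ultimately show ?thesis using assms
    by (simp add: complex_eq_iff cos_diff sin_diff cos_arctan sin_arctan)
qed

lemma tr_phase:
  assumes "k \<ge> 1" "s > 0"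
  shows "tr V k (Complex E s) = of_real (cmod (tr V k (Complex E s))) * cis (phase V k E s)"
proof -
  have *: "Complex E s - of_real r = Complex (E - r) s" for r by (simp add: complex_eq_iff)
  have cis_sum: "(\<Prod>i<n. cis (f i)) = cis (\<Sum>i<n. f i)" for f :: "nat \<Rightarrow> real" and n
    by (induction n) (auto simp: cis_mult)
  have "(\<Prod>i<fib k. Complex (E - troot V k i) s)
      = (\<Prod>i<fib k. of_real (cmod (Complex (E - troot V k i) s)) * cis (pi / 2 - arctan ((E - troot V k i) / s)))"
    by (intro prod.cong refl Complex_polar assms)
  also have "\<dots> = of_real (cmod (\<Prod>i<fib k. Complex (E - troot V k i) s)) * cis (phase V k E s)"
    by (simp add: prod.distrib cis_sum phase_def prod_norm[symmetric])
  finally show ?thesis unfolding tr_factor[OF assms(1)] * norm_divide by simp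
qed

lemma continuous_phase: "continuous_on {0<..} (phase V k E)"
  unfolding phase_def by (intro continuous_intros) auto

lemma phase_at_top: "(phase V k E \<longlongrightarrow> fib k * pi / 2) at_top"
proof -
  have lim: "((\<lambda>s. arctan (u / s)) \<longlongrightarrow> arctan 0) at_top" for u :: real
    by (intro tendsto_arctan tendsto_divide_0[OF tendsto_const] filterlim_at_top_imp_at_infinity filterlim_ident)
  have "(phase V k E \<longlongrightarrow> (\<Sum>i<fib k. pi / 2 - arctan 0)) at_top"
    unfolding phase_def by (intro tendsto_sum tendsto_diff tendsto_const lim)
  then show ?thesis by simp
qed

definition cnt :: "real \<Rightarrow> nat \<Rightarrow> real \<Rightarrow> nat" where
  "cnt V k E = card {i. i < fib k \<and> troot V k i > E}"

text \<open>Close to the real axis a zero above \<open>E\<close> contributes \<open>pi\<close> and a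
  zero below contributes 0, so the argument counts zeros.\<close>

lemma phase_at_0:
  assumes "k \<ge> 1" "tr V k E \<noteq> 0"
  shows "(phase V k E \<longlongrightarrow> cnt V k E * pi) (at_right 0)"
proof -
  have lim: "((\<lambda>s. pi / 2 - arctan (u / s)) \<longlongrightarrow> (if u < 0 then pi else 0)) (at_right 0)" if "u \<noteq> 0" for u :: real
  proof (cases "u > 0")
    case True
    then have "filterlim (\<lambda>s. u * inverse s) at_top (at_right 0)"
      by (intro filterlim_tendsto_pos_mult_at_top[OF tendsto_const] filterlim_inverse_at_top_right)
    then have "((\<lambda>s. arctan (u * inverse s)) \<longlongrightarrow> pi / 2) (at_right 0)"
      by (rule filterlim_compose[OF tendsto_arctan_at_top])
    from tendsto_diff[OF tendsto_const[of "pi / 2"] this] show ?thesis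
      using True by (simp add: divide_inverse[of u])
  next
    case False
    then have "filterlim (\<lambda>s. u * inverse s) at_bot (at_right 0)"
      using that by (intro filterlim_tendsto_neg_mult_at_bot[OF tendsto_const] filterlim_inverse_at_top_right) auto
    then have "((\<lambda>s. arctan (u * inverse s)) \<longlongrightarrow> - (pi / 2)) (at_right 0)"
      by (rule filterlim_compose[OF tendsto_arctan_at_bot])
    from tendsto_diff[OF tendsto_const[of "pi / 2"] this] show ?thesis
      using False that by (simp add: divide_inverse[of u])
  qed
  have "(phase V k E \<longlongrightarrow> (\<Sum>i<fib k. if E - troot V k i < 0 then pi else 0)) (at_right 0)"
    unfolding phase_def
  proof (rule tendsto_sum)
    fix i assume "i \<in> {..<fib k}"
    then have "E - troot V k i \<noteq> 0" using assms tr_root_zero[of k i V] by auto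
    then show "((\<lambda>s. pi / 2 - arctan ((E - troot V k i) / s)) \<longlongrightarrow> (if E - troot V k i < 0 then pi else 0)) (at_right 0)"
      by (rule lim)
  qed
  moreover have "(\<Sum>i<fib k. if E - troot V k i < 0 then pi else 0) = cnt V k E * pi"
    by (simp add: sum.If_cases cnt_def Int_def lessThan_def)
  ultimately show ?thesis by simp
qed

text \<open>On the vertical line above an escaped energy, \<open>tr V (k+3) / (tr V (k+1) * tr V (k+2))\<close> stays in the
  disc of radius 1 around 2, so its argument cannot wind.\<close>

lemma cnt_fib:
  assumes E: "E \<in> Esc V (k + 1)"
  shows "cnt V (k + 3) E = cnt V (k + 2) E + cnt V (k + 1) E"
proof -
  define D where "D s = phase V (k+3) E s - phase V (k+2) E s - phase V (k+1) E s" for s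
  have E1: "\<bar>tr V (k+1) E\<bar> > 1" "\<bar>tr V (k+2) E\<bar> > 1" "\<bar>tr V (k+3) E\<bar> > 1"
    using E Esc_mono[of "k+1" "k+2" V] by (auto simp: Esc_def numeral_2_eq_2 numeral_3_eq_3)
  have pos: "cos (D s) > 0" if s: "s > 0" for s
  proof -
    define z where "z = Complex E s"
    define w where "w = tr V (k+1) z * tr V (k+2) z"
    have "cmod (tr V (k+1) z) > 1" "cmod (tr V (k+2) z) > 1"
      using E1 tr_vertical_ge[of "k+1" V E s] tr_vertical_ge[of "k+2" V E s] by (auto simp: z_def)
    then have small: "cmod (tr V k z) < cmod w"
      using tr_escape_backward[of V k z] by (simp add: w_def norm_mult)
    have "Re (tr V k z * cnj w) \<le> cmod (tr V k z) * cmod w"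
      by (metis complex_Re_le_cmod complex_mod_cnj norm_mult)
    also have "\<dots> < cmod w * cmod w"
      using small by (intro mult_strict_right_mono) (auto intro: le_less_trans[OF norm_ge_zero])
    also have "\<dots> = Re (w * cnj w)" by (simp only: Re_mult_cnj_self power2_eq_square)
    finally have lt: "Re (tr V k z * cnj w) < Re (w * cnj w)" .
    have "tr V (k+3) z * cnj w = w * cnj w + (w * cnj w - tr V k z * cnj w)"
      by (simp add: w_def numeral_2_eq_2 numeral_3_eq_3 algebra_simps)
    then have "Re (tr V (k+3) z * cnj w) = Re (w * cnj w) + (Re (w * cnj w) - Re (tr V k z * cnj w))"
      by (simp only: plus_complex.sel minus_complex.sel)
    moreover have "0 \<le> Re (w * cnj w)" by (simp only: Re_mult_cnj_self zero_le_power2)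
    ultimately have "0 < Re (tr V (k+3) z * cnj w)" using lt by linarith
    also have "tr V (k+3) z * cnj w = of_real (cmod (tr V (k+3) z) * cmod w) * cis (D s)"
    proof -
      define a1 a2 a3 where "a1 = cmod (tr V (k+1) z)" "a2 = cmod (tr V (k+2) z)" "a3 = cmod (tr V (k+3) z)"
      note defs = this
      have e1: "tr V (k+1) z = of_real a1 * cis (phase V (k+1) E s)"
        and e2: "tr V (k+2) z = of_real a2 * cis (phase V (k+2) E s)"
        and e3: "tr V (k+3) z = of_real a3 * cis (phase V (k+3) E s)"
        unfolding defs z_def using s by (auto intro: tr_phase)
      have cw: "cmod w = a1 * a2" by (simp only: w_def norm_mult defs)
      have "tr V (k+3) z * cnj w = of_real a3 * cis (phase V (k+3) E s) *
         cnj (of_real a1 * cis (phase V (k+1) E s) * (of_real a2 * cis (phase V (k+2) E s)))"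
        by (simp only: w_def e1 e2 e3)
      also have "\<dots> = of_real (a3 * (a1 * a2)) *
           (cis (phase V (k+3) E s) * cis (- phase V (k+2) E s) * cis (- phase V (k+1) E s))"
        by (simp add: cis_cnj mult_ac)
      also have "\<dots> = of_real (a3 * (a1 * a2)) * cis (D s)"
        by (simp add: cis_mult D_def)
      finally show ?thesis by (simp only: cw defs(3))
    qed
    finally have "0 < cmod (tr V (k+3) z) * cmod w * cos (D s)" by simp
    then show ?thesis by (smt (verit) mult_nonneg_nonneg mult_nonneg_nonpos norm_ge_zero)
  qed
  have contD: "continuous_on {0<..} D"
    unfolding D_def by (intro continuous_intros continuous_phase)
  have "(D \<longlongrightarrow> fib (k+3) * pi / 2 - fib (k+2) * pi / 2 - fib (k+1) * pi / 2) at_top"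
    unfolding D_def by (intro tendsto_intros phase_at_top)
  \<comment> \<open>The degrees are Fibonacci numbers, so the three phases cancel at
    infinity.\<close>
  then have "(D \<longlongrightarrow> 0) at_top" by (simp add: numeral_2_eq_2 numeral_3_eq_3 field_simps)
  then have "eventually (\<lambda>s. dist (D s) 0 < pi / 2) at_top" by (rule tendstoD) simp
  then obtain S where S: "\<And>s. s \<ge> S \<Longrightarrow> \<bar>D s\<bar> < pi / 2" by (auto simp: eventually_at_top_linorder)
  have bound: "\<bar>D s\<bar> < pi / 2" if s: "s > 0" for s
  proof (rule ccontr)
    assume "\<not> ?thesis"
    then have s1: "\<bar>D s\<bar> \<ge> pi / 2" by simp
    then have sS: "s < max S s + 1" "\<bar>D (max S s + 1)\<bar> < pi / 2" using S by auto
    have "continuous_on {s..max S s + 1} (\<lambda>s. \<bar>D s\<bar>)"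
      using s by (intro continuous_intros continuous_on_subset[OF contD]) auto
    then obtain x where x: "s \<le> x" "\<bar>D x\<bar> = pi / 2"
      using IVT2'[of "\<lambda>s. \<bar>D s\<bar>" "max S s + 1" "pi/2" s] sS s1 by auto
    have "cos \<bar>D x\<bar> = 0" unfolding x(2) by (rule cos_pi_half)
    then have "cos (D x) = 0" by (simp only: cos_abs_real)
    then show False using pos[of x] x s by simp
  qed
  \<comment> \<open>At the lower end of the line \<open>D\<close> tends to an integer multiple of
    \<open>pi\<close>; as it stays within \<open>pi / 2\<close> of 0, the integer is 0.\<close>
  define J where "J = real (cnt V (k+3) E) - real (cnt V (k+2) E) - real (cnt V (k+1) E)"
  have "(D \<longlongrightarrow> cnt V (k+3) E * pi - cnt V (k+2) E * pi - cnt V (k+1) E * pi) (at_right 0)"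
    unfolding D_def using E1 by (intro tendsto_intros phase_at_0) auto
  then have "(D \<longlongrightarrow> J * pi) (at_right 0)" by (simp add: J_def algebra_simps)
  then have "((\<lambda>s. \<bar>D s\<bar>) \<longlongrightarrow> \<bar>J * pi\<bar>) (at_right 0)" by (rule tendsto_rabs)
  moreover have "eventually (\<lambda>s. \<bar>D s\<bar> \<le> pi / 2) (at_right 0)"
    using bound by (auto simp: eventually_at_right_field intro!: exI[of _ 1] less_imp_le)
  ultimately have "\<bar>J * pi\<bar> \<le> pi / 2" by (rule tendsto_upperbound) simp
  then have "\<bar>J\<bar> < 1" by (simp add: abs_mult field_simps)
  then show ?thesis unfolding J_def by linarith
qed

section \<open>Zeros between two gaps\<close>

definition root_count :: "real \<Rightarrow> nat \<Rightarrow> real \<Rightarrow> real \<Rightarrow> nat" where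
  "root_count V k lo hi = card {i. i < fib k \<and> lo < troot V k i \<and> troot V k i < hi}"

lemma root_count_cnt:
  assumes "k \<ge> 1" "lo < hi" "tr V k hi \<noteq> 0"
  shows "cnt V k lo = root_count V k lo hi + cnt V k hi"
proof -
  have eq: "{i. i < fib k \<and> troot V k i > lo}
     = {i. i < fib k \<and> lo < troot V k i \<and> troot V k i < hi} \<union> {i. i < fib k \<and> troot V k i > hi}"
    using assms tr_root_zero[of k _ V] by (auto simp: not_less_iff_gr_or_eq)
  show ?thesis unfolding cnt_def root_count_def eq
    by (rule card_Un_disjoint) auto
qed

lemma root_count_fib:
  assumes "lo < hi" "lo \<in> Esc V k" "hi \<in> Esc V k"
  shows "root_count V (k + 2) lo hi = root_count V (k + 1) lo hi + root_count V k lo hi"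
proof -
  obtain j where k: "k = j + 1" using assms Esc_0 by (cases k) auto
  have "hi \<in> Esc V (k + 1)" using assms Esc_mono[of k "k+1" V] by auto
  then have "tr V k hi \<noteq> 0" "tr V (k+1) hi \<noteq> 0" "tr V (k+2) hi \<noteq> 0"
    using assms by (auto simp: Esc_def)
  then have "cnt V k lo = root_count V k lo hi + cnt V k hi"
    "cnt V (k+1) lo = root_count V (k+1) lo hi + cnt V (k+1) hi"
    "cnt V (k+2) lo = root_count V (k+2) lo hi + cnt V (k+2) hi"
    using assms k by (auto intro!: root_count_cnt)
  moreover have "cnt V (k+2) lo = cnt V (k+1) lo + cnt V k lo" "cnt V (k+2) hi = cnt V (k+1) hi + cnt V k hi"
    using assms cnt_fib[of _ V j] k by (auto simp: numeral_2_eq_2 numeral_3_eq_3)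
  ultimately show ?thesis by linarith
qed

text \<open>A quantitative log-concavity between zeros: relative to its value at \<open>c\<close>,
  each zero \<open>r\<close> contributes \<open>1 - \<rho>\<^sup>2 / (c - r)\<^sup>2\<close>, and
  \<open>1 - x \<le> exp (- x)\<close>.\<close>

lemma tr_second_difference:
  assumes k: "k \<ge> 1" and \<rho>: "\<rho> > 0" and roots: "\<And>i. i < fib k \<Longrightarrow> \<bar>c - troot V k i\<bar> > \<rho>"
  shows "\<bar>tr V k (c + \<rho>) * tr V k (c - \<rho>)\<bar> \<le> (tr V k c)\<^sup>2 * exp (- (\<Sum>i<fib k. \<rho>\<^sup>2 / (c - troot V k i)\<^sup>2))"
proof -
  have "(c + \<rho> - troot V k i) * (c - \<rho> - troot V k i)
      = (c - troot V k i)\<^sup>2 * (1 - \<rho>\<^sup>2 / (c - troot V k i)\<^sup>2)" if "i < fib k" for i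
  proof -
    define r where "r = troot V k i"
    have "(c - r)\<^sup>2 \<noteq> 0" using roots[OF that] \<rho> by (auto simp: r_def)
    then have "(c - r)\<^sup>2 * (1 - \<rho>\<^sup>2 / (c - r)\<^sup>2) = (c - r)\<^sup>2 - \<rho>\<^sup>2" by (simp add: right_diff_distrib)
    also have "\<dots> = (c + \<rho> - r) * (c - \<rho> - r)" by (simp add: power2_eq_square algebra_simps)
    finally show ?thesis by (simp add: r_def)
  qed
  then have "(\<Prod>i<fib k. (c + \<rho> - troot V k i) * (c - \<rho> - troot V k i))
      = (\<Prod>i<fib k. c - troot V k i)\<^sup>2 * (\<Prod>i<fib k. 1 - \<rho>\<^sup>2 / (c - troot V k i)\<^sup>2)"
    by (simp add: prod.distrib prod_power_distrib)
  then have eq: "tr V k (c + \<rho>) * tr V k (c - \<rho>) = (tr V k c)\<^sup>2 * (\<Prod>i<fib k. 1 - \<rho>\<^sup>2 / (c - troot V k i)\<^sup>2)"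
    by (simp add: tr_factor_real[OF k] prod.distrib power_divide)
  have factor: "0 \<le> 1 - \<rho>\<^sup>2 / (c - troot V k i)\<^sup>2" if "i < fib k" for i
  proof -
    have "\<rho>\<^sup>2 \<le> \<bar>c - troot V k i\<bar>\<^sup>2" using roots[OF that] \<rho> by (intro power_mono) auto
    then show ?thesis by (simp add: divide_le_eq_1)
  qed
  have "\<bar>tr V k (c + \<rho>) * tr V k (c - \<rho>)\<bar> = (tr V k c)\<^sup>2 * (\<Prod>i<fib k. 1 - \<rho>\<^sup>2 / (c - troot V k i)\<^sup>2)"
    unfolding eq by (rule abs_of_nonneg, intro mult_nonneg_nonneg prod_nonneg zero_le_power2, rule factor) simp
  also have "\<dots> \<le> (tr V k c)\<^sup>2 * (\<Prod>i<fib k. exp (- (\<rho>\<^sup>2 / (c - troot V k i)\<^sup>2)))"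
  proof (intro mult_left_mono prod_mono conjI)
    fix i assume "i \<in> {..<fib k}"
    then show "0 \<le> 1 - \<rho>\<^sup>2 / (c - troot V k i)\<^sup>2" by (intro factor) simp
    show "1 - \<rho>\<^sup>2 / (c - troot V k i)\<^sup>2 \<le> exp (- (\<rho>\<^sup>2 / (c - troot V k i)\<^sup>2))"
      using exp_ge_add_one_self[of "- (\<rho>\<^sup>2 / (c - troot V k i)\<^sup>2)"] by simp
  qed auto
  finally show ?thesis by (simp add: exp_sum sum_negf[symmetric])
qed

text \<open>An interior minimum of \<open>\<bar>tr V k\<bar>\<close> would contradict log-concavity away from the roots.\<close>

lemma tr_gt_1_between:
  assumes k: "k \<ge> 1" and lohi: "lo < hi" "\<bar>tr V k lo\<bar> > 1" "\<bar>tr V k hi\<bar> > 1"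
    and no: "root_count V k lo hi = 0" and x: "x \<in> {lo..hi}"
  shows "\<bar>tr V k x\<bar> > 1"
proof (rule ccontr)
  assume less: "\<not> ?thesis"
  have noroot: "\<not> (lo \<le> troot V k i \<and> troot V k i \<le> hi)" if "i < fib k" for i
    using no that lohi tr_root_zero[OF k that, of V] unfolding root_count_def
    by (force simp: order_le_less)
  have "\<exists>c\<in>{lo..hi}. \<forall>y\<in>{lo..hi}. \<bar>tr V k c\<bar> \<le> \<bar>tr V k y\<bar>"
    by (rule continuous_attains_inf) (use lohi in \<open>auto intro!: continuous_on_rabs continuous_on_tr\<close>)
  then obtain c where c: "c \<in> {lo..hi}" "\<And>y. y \<in> {lo..hi} \<Longrightarrow> \<bar>tr V k c\<bar> \<le> \<bar>tr V k y\<bar>" by blast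
  have "\<bar>tr V k c\<bar> \<le> 1" using c(2)[OF x] less by simp
  then have lc: "lo < c" "c < hi" using c(1) lohi by (auto simp: order_le_less)
  define \<rho> where "\<rho> = min (c - lo) (hi - c)"
  have \<rho>: "\<rho> > 0" "c + \<rho> \<in> {lo..hi}" "c - \<rho> \<in> {lo..hi}" using lc by (auto simp: \<rho>_def)
  have "\<bar>c - troot V k i\<bar> > \<rho>" if "i < fib k" for i
    using noroot[OF that] by (auto simp: \<rho>_def)
  then have "\<bar>tr V k (c + \<rho>) * tr V k (c - \<rho>)\<bar> \<le> (tr V k c)\<^sup>2 * exp (- (\<Sum>i<fib k. \<rho>\<^sup>2 / (c - troot V k i)\<^sup>2))"
    by (intro tr_second_difference k \<rho>) auto
  moreover have "(tr V k c)\<^sup>2 \<le> \<bar>tr V k (c + \<rho>) * tr V k (c - \<rho>)\<bar>"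
    using mult_mono[OF c(2)[OF \<rho>(2)] c(2)[OF \<rho>(3)]] by (simp add: abs_mult power2_eq_square)
  moreover have "(tr V k c)\<^sup>2 * exp (- (\<Sum>i<fib k. \<rho>\<^sup>2 / (c - troot V k i)\<^sup>2)) < (tr V k c)\<^sup>2 * 1"
  proof (rule mult_strict_left_mono)
    have "tr V k c \<noteq> 0"
    proof
      assume "tr V k c = 0"
      then obtain i where "i < fib k" "c = troot V k i" by (auto simp: tr_factor_real[OF k])
      then show False using noroot[of i] c(1) by auto
    qed
    then show "(tr V k c)\<^sup>2 > 0" by simp
    have "(\<Sum>i<fib k. \<rho>\<^sup>2 / (c - troot V k i)\<^sup>2) > 0"
    proof (rule sum_pos)
      show "{..<fib k} \<noteq> {}" using fib_neq_0_nat[of k] k by auto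
      fix i assume "i \<in> {..<fib k}"
      then have "c \<noteq> troot V k i" using noroot[of i] c(1) by auto
      then show "\<rho>\<^sup>2 / (c - troot V k i)\<^sup>2 > 0" using \<rho> by simp
    qed auto
    then show "exp (- (\<Sum>i<fib k. \<rho>\<^sup>2 / (c - troot V k i)\<^sup>2)) < 1" by simp
  qed
  ultimately show False by linarith
qed

text \<open>Without a zero at either index, \<open>tr_gt_1_between\<close> would keep both traces
  above 1 on all of \<open>{lo..hi}\<close>, which would then consist of escaped energies.\<close>

lemma root_count_pos:
  assumes "lo < hi" "lo \<in> Esc V n" "hi \<in> Esc V n" "Sig V \<inter> {lo..hi} \<noteq> {}"
  shows "root_count V n lo hi + root_count V (n + 1) lo hi \<ge> 1"
proof (rule ccontr)
  assume "\<not> ?thesis"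
  then have 0: "root_count V n lo hi = 0" "root_count V (n + 1) lo hi = 0" by auto
  have "n \<ge> 1" using assms Esc_0 by (cases n) auto
  then have esc: "x \<in> Esc V n" if "x \<in> {lo..hi}" for x
    using tr_gt_1_between[OF _ assms(1) _ _ 0(1) that] tr_gt_1_between[OF _ assms(1) _ _ 0(2) that] assms
    by (auto simp: Esc_def)
  obtain x where x: "x \<in> Sig V" "x \<in> {lo..hi}" using assms(4) by blast
  then show False using esc[OF x(2)] by (simp add: Sig_def)
qed

text \<open>The counts obey the Fibonacci recursion once both ends have escaped. The offset in the
  index arises because only the sum of the counts at \<open>n\<close> and \<open>n + 1\<close> is
  known to be positive, and this sum is the count at \<open>n + 2\<close>.\<close>

lemma root_count_ge_fib:
  assumes "lo < hi" "lo \<in> Esc V n" "hi \<in> Esc V n" "Sig V \<inter> {lo..hi} \<noteq> {}"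
  shows "root_count V (n + j + 1) lo hi \<ge> fib j"
proof -
  have rec: "root_count V (n + j + 2) lo hi = root_count V (n + j + 1) lo hi + root_count V (n + j) lo hi" for j
    using assms Esc_mono[of n "n + j" V] by (intro root_count_fib) auto
  show ?thesis
  proof (induction j rule: fib.induct)
    case 2
    show ?case using rec[of 0] root_count_pos[OF assms] by simp
  next
    case (3 j)
    then show ?case using rec[of "Suc j"] by simp
  qed simp
qed

text \<open>\<open>{a..b}\<close> is the gap to be bounded, with first escape time \<open>n\<close>;
  \<open>K\<close> is the other gap, with a point escaped by that time. The zeros between
  \<open>e\<close> and \<open>e'\<close> avoid both and so lie within \<open>G\<close> of
  \<open>{a..b}\<close>. If \<open>G\<close> were small, so many close zeros would force a trace at
  the centre that \<open>tr_growth\<close> excludes.\<close>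

lemma gap_core:
  assumes V: "0 < V" "V \<le> 1/1000000" and n: "n \<ge> 2"
    and ab: "a < b" "{a..b} \<inter> Sig V = {}" "{a..b} \<inter> Esc V (n - 1) = {}"
    and K: "compact K" "K \<inter> Sig V = {}"
    and e: "e \<in> {a..b} \<inter> Esc V n" and e': "e' \<in> K \<inter> Esc V n"
    and sig: "Sig V \<inter> {min e e'..max e e'} \<noteq> {}"
    and G: "\<And>r. min e e' < r \<Longrightarrow> r < max e e' \<Longrightarrow> r \<notin> K \<Longrightarrow> r \<notin> {a..b} \<Longrightarrow> \<bar>(a + b) / 2 - r\<bar> \<le> (b - a) / 2 + G"
  shows "2 * (b - a) \<le> G"
proof -
  define c \<rho> where "c = (a + b) / 2" "\<rho> = (b - a) / 2"
  have c\<rho>: "c - \<rho> = a" "c + \<rho> = b" "\<rho> > 0" "c \<in> {a..b}" using ab by (auto simp: c_\<rho>_def field_simps)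
  obtain m1 where m1: "\<And>m. m \<ge> m1 \<Longrightarrow> {a..b} \<subseteq> Esc V m" using compact_disjoint_Sig[OF _ ab(2)] by blast
  obtain m2 where m2: "\<And>m. m \<ge> m2 \<Longrightarrow> K \<subseteq> Esc V m" using compact_disjoint_Sig[OF K] by blast
  \<comment> \<open>By time \<open>n + j + 1\<close> both gaps have escaped entirely and contain no
    zero of the trace; the summand 1 makes \<open>fib j\<close> positive.\<close>
  define j where "j = m1 + m2 + 1"
  define m where "m = n + j + 1"
  have m: "m \<ge> 1" "{a..b} \<subseteq> Esc V m" "K \<subseteq> Esc V m" using m1[of m] m2[of m] by (auto simp: m_def j_def)
  have root_out: "troot V m i \<notin> Esc V m" if "i < fib m" for i
    using tr_root_zero[OF m(1) that, of V] by (simp add: Esc_def)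
  define lo hi where "lo = min e e'" "hi = max e e'"
  have "e \<noteq> e'" using sig ab(2) e by auto
  then have lohi: "lo < hi" "lo \<in> Esc V n" "hi \<in> Esc V n" using e e' by (auto simp: lo_hi_def min_def max_def)
  define B where "B = {i. i < fib m \<and> lo < troot V m i \<and> troot V m i < hi}"
  have B: "card B \<ge> fib j"
    using root_count_ge_fib[OF lohi] sig by (simp add: lo_hi_def root_count_def m_def B_def)
  have fj: "fib j \<ge> 1" using fib_neq_0_nat[of j] by (simp add: j_def)
  have far: "\<bar>c - troot V m i\<bar> > \<rho>" if "i < fib m" for i
  proof -
    have "troot V m i \<notin> {a..b}" using root_out[OF that] m(2) by blast
    then show ?thesis using c\<rho>(1,2) by (auto simp: abs_real_def)
  qed
  have near: "\<bar>c - troot V m i\<bar> \<le> \<rho> + G" if "i \<in> B" for i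
    unfolding c_\<rho>_def using that root_out[of i] m lo_hi_def by (intro G) (auto simp: B_def)
  have "card B > 0" using B fj by linarith
  then have "B \<noteq> {}" by auto
  then obtain i0 where "i0 \<in> B" by blast
  then have \<rho>G: "0 < \<rho> + G" using near[of i0] far[of i0] c\<rho> by (auto simp: B_def)
  have "card B * (\<rho>\<^sup>2 / (\<rho> + G)\<^sup>2) \<le> (\<Sum>i\<in>B. \<rho>\<^sup>2 / (c - troot V m i)\<^sup>2)"
  proof -
    have "\<rho>\<^sup>2 / (\<rho> + G)\<^sup>2 \<le> \<rho>\<^sup>2 / (c - troot V m i)\<^sup>2" if "i \<in> B" for i
    proof (rule divide_left_mono)
      have "\<bar>c - troot V m i\<bar>\<^sup>2 \<le> (\<rho> + G)\<^sup>2" using near[OF that] by (intro power_mono) auto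
      then show "(c - troot V m i)\<^sup>2 \<le> (\<rho> + G)\<^sup>2" by simp
      have "c \<noteq> troot V m i" using far[of i] that c\<rho> by (auto simp: B_def)
      then show "0 < (\<rho> + G)\<^sup>2 * (c - troot V m i)\<^sup>2" using \<rho>G by simp
    qed simp
    then show ?thesis using sum_bounded_below[of B "\<rho>\<^sup>2 / (\<rho> + G)\<^sup>2"] by simp
  qed
  also have "\<dots> \<le> (\<Sum>i<fib m. \<rho>\<^sup>2 / (c - troot V m i)\<^sup>2)"
    by (intro sum_mono2) (auto simp: B_def)
  finally have S: "card B * (\<rho>\<^sup>2 / (\<rho> + G)\<^sup>2) \<le> (\<Sum>i<fib m. \<rho>\<^sup>2 / (c - troot V m i)\<^sup>2)" .
  define H where "H = 4 * sqrt V * fib (j + 2)"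
  have tc: "\<bar>tr V m c\<bar> \<le> exp H"
  proof -
    \<comment> \<open>The centre may escape later than \<open>e\<close>; a later first escape only
      lowers the Fibonacci number in \<open>tr_growth\<close>.\<close>
    define n' where "n' = (LEAST k. c \<in> Esc V k)"
    have cm: "c \<in> Esc V m" using c\<rho> m by auto
    then have n': "c \<in> Esc V n'" "n' \<le> m" unfolding n'_def by (auto intro: LeastI Least_le)
    have nn': "n \<le> n'"
    proof (rule ccontr)
      assume "\<not> ?thesis"
      then have "n' \<le> n - 1" by linarith
      then have "c \<in> Esc V (n - 1)" using n'(1) Esc_mono[of n' "n - 1" V] by blast
      then show False using ab(3) c\<rho>(4) by blast
    qed
    then have "c \<notin> Esc V (n' - 1)" unfolding n'_def
      using n by (intro not_less_Least) (auto simp: n'_def)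
    then have "\<bar>tr V (n' + (m - n')) c\<bar> \<le> cosh (4 * sqrt V * fib (m - n' + 1) - sqrt V)"
      using V n nn' n' by (intro tr_growth) auto
    also have "n' + (m - n') = m" using n' by simp
    also have "cosh (4 * sqrt V * fib (m - n' + 1) - sqrt V) \<le> exp (4 * sqrt V * fib (m - n' + 1) - sqrt V)"
    proof -
      have "fib (m - n' + 1) \<ge> 1" using fib_neq_0_nat[of "m - n' + 1"] by simp
      then have "sqrt V * 1 \<le> sqrt V * (4 * real (fib (m - n' + 1)))"
        using V by (intro mult_left_mono) auto
      then have "4 * sqrt V * fib (m - n' + 1) - sqrt V \<ge> 0" by simp
      then show ?thesis by (simp add: cosh_def)
    qed
    also have "\<dots> \<le> exp H"
    proof -
      have "fib (m - n' + 1) \<le> fib (j + 2)" by (rule fib_mono) (use nn' in \<open>simp add: m_def\<close>)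
      then have "real (fib (m - n' + 1)) \<le> fib (j + 2)" by (simp only: of_nat_le_iff)
      then have "4 * sqrt V * fib (m - n' + 1) \<le> H" using V by (simp add: H_def)
      moreover have "0 \<le> sqrt V" using V by simp
      ultimately have "4 * sqrt V * fib (m - n' + 1) - sqrt V \<le> H" by linarith
      then show ?thesis by (simp only: exp_le_cancel_iff)
    qed
    finally show ?thesis .
  qed
  have "a \<in> Esc V m" "b \<in> Esc V m" using m(2) ab(1) by auto
  then have "\<bar>tr V m a\<bar> > 1" "\<bar>tr V m b\<bar> > 1" by (simp_all add: Esc_def)
  then have "1 * 1 \<le> \<bar>tr V m b\<bar> * \<bar>tr V m a\<bar>" by (intro mult_mono) auto
  also have "\<dots> = \<bar>tr V m (c + \<rho>) * tr V m (c - \<rho>)\<bar>" by (simp add: c\<rho> abs_mult)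
  also have "\<dots> \<le> (tr V m c)\<^sup>2 * exp (- (\<Sum>i<fib m. \<rho>\<^sup>2 / (c - troot V m i)\<^sup>2))"
    by (intro tr_second_difference m c\<rho> far)
  also have "\<dots> \<le> (exp H)\<^sup>2 * exp (- (card B * (\<rho>\<^sup>2 / (\<rho> + G)\<^sup>2)))"
    using power_mono[OF tc, of 2] S by (intro mult_mono) auto
  also have "\<dots> = exp (2 * H + - (card B * (\<rho>\<^sup>2 / (\<rho> + G)\<^sup>2)))"
    by (simp only: exp_double exp_add)
  finally have "card B * (\<rho>\<^sup>2 / (\<rho> + G)\<^sup>2) \<le> 2 * H" by simp
  \<comment> \<open>24 is \<open>2 * 4 * 3\<close>: the squared trace at the centre, the rate in
    \<open>tr_growth\<close>, and \<open>fib (j + 2) \<le> 3 * fib j\<close>.\<close>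
  also have "\<dots> \<le> card B * (24 * sqrt V)"
  proof -
    obtain l where l: "j = Suc l" by (simp add: j_def)
    have "fib (j + 2) \<le> 3 * fib j" using fib_mono[of l j] l by simp
    also have "\<dots> \<le> 3 * card B" using B by simp
    finally have "real (fib (j + 2)) \<le> real (3 * card B)" by (simp only: of_nat_le_iff)
    then have "real (fib (j + 2)) \<le> 3 * real (card B)" by (simp only: of_nat_mult of_nat_numeral)
    then have "8 * sqrt V * fib (j + 2) \<le> 8 * sqrt V * (3 * card B)" using V by (intro mult_left_mono) auto
    then show ?thesis by (simp add: H_def mult_ac)
  qed
  finally have "real (card B) * (\<rho>\<^sup>2 / (\<rho> + G)\<^sup>2) \<le> real (card B) * (24 * sqrt V)" .
  moreover have "0 < real (card B)" using \<open>card B > 0\<close> by simp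
  ultimately have "\<rho>\<^sup>2 / (\<rho> + G)\<^sup>2 \<le> 24 * sqrt V" by (rule mult_left_le_imp_le)
  \<comment> \<open>This gives \<open>5 * \<rho> \<le> \<rho> + G\<close>, hence
    \<open>4 * \<rho> \<le> G\<close>, and \<open>4 * \<rho>\<close> is twice the length of the
    gap.\<close>
  also have "sqrt V \<le> 1/1000" using V by (intro real_le_lsqrt) (simp_all add: power2_eq_square)
  then have "24 * sqrt V \<le> (1/5)\<^sup>2" by (simp add: power2_eq_square)
  finally have "(\<rho> / (\<rho> + G))\<^sup>2 \<le> (1/5)\<^sup>2" by (simp add: power_divide)
  then have "\<rho> / (\<rho> + G) \<le> 1/5" by (rule power2_le_imp_le) simp
  then show ?thesis using \<rho>G by (simp add: c_\<rho>_def field_simps)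
qed

text \<open>\<open>gap_core\<close> is applied to the gap with the later first escape, with
  \<open>G = c - b\<close>. It needs an escape time of at least 2; if both times are 1, the gaps
  belong to the two unbounded components of the complement.\<close>

lemma gap_distance:
  assumes V: "0 < V" "V \<le> 1/1000000"
    and abcd: "a < b" "b < c" "c < d"
    and gaps: "{a..b} \<inter> Sig V = {}" "{c..d} \<inter> Sig V = {}" "{b..c} \<inter> Sig V \<noteq> {}"
  shows "2 * min (b - a) (d - c) \<le> c - b \<or> ({..b} \<inter> Sig V = {} \<and> {c..} \<inter> Sig V = {})"
proof -
  define idx where "idx I = (LEAST n. I \<inter> Esc V n \<noteq> {})" for I
  have idx: "I \<inter> Esc V (idx I) \<noteq> {}" "idx I \<ge> 1" "I \<inter> Esc V (idx I - 1) = {}"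
    if I: "I \<inter> Sig V = {}" "I \<noteq> {}" for I
  proof -
    obtain x where x: "x \<in> I" using I(2) by blast
    then have "x \<notin> Sig V" using I(1) by blast
    then obtain n where "x \<in> Esc V n" by (auto simp: Sig_def)
    then have "I \<inter> Esc V n \<noteq> {}" using x by blast
    then show 1: "I \<inter> Esc V (idx I) \<noteq> {}" unfolding idx_def by (rule LeastI)
    then show "idx I \<ge> 1" using Esc_0 by (cases "idx I") auto
    then show "I \<inter> Esc V (idx I - 1) = {}"
      using not_less_Least[of "idx I - 1" "\<lambda>n. I \<inter> Esc V n \<noteq> {}"] by (auto simp: idx_def)
  qed
  define p q where "p = idx {a..b}" "q = idx {c..d}"
  have p: "{a..b} \<inter> Esc V p \<noteq> {}" "p \<ge> 1" "{a..b} \<inter> Esc V (p - 1) = {}"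
    unfolding p_q_def using gaps abcd by (intro idx; auto)+
  have q: "{c..d} \<inter> Esc V q \<noteq> {}" "q \<ge> 1" "{c..d} \<inter> Esc V (q - 1) = {}"
    unfolding p_q_def using gaps abcd by (intro idx; auto)+
  obtain e where e: "e \<in> {a..b} \<inter> Esc V p" using p(1) by blast
  obtain f where f: "f \<in> {c..d} \<inter> Esc V q" using q(1) by blast
  have ef: "min e f = e" "max e f = f" "min f e = e" "max f e = f" using e f abcd by auto
  have sig: "Sig V \<inter> {e..f} \<noteq> {}" using gaps(3) e f by fastforce
  consider "p \<ge> 2" "q \<le> p" | "q \<ge> 2" "p \<le> q" | "p = 1" "q = 1" using p q by linarith
  then show ?thesis
  proof cases
    case 1
    have f': "f \<in> {c..d} \<inter> Esc V p" using f Esc_mono[OF 1(2), of V] by auto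
    have "2 * (b - a) \<le> c - b"
    proof (rule gap_core[OF V 1(1) abcd(1) gaps(1) p(3) _ gaps(2) e f'])
      fix r assume "min e f < r" "r < max e f" "r \<notin> {c..d}" "r \<notin> {a..b}"
      then have "b < r" "r < c" using ef e f by auto
      then show "\<bar>(a + b) / 2 - r\<bar> \<le> (b - a) / 2 + (c - b)" using abcd by (simp add: abs_real_def field_simps)
    qed (use sig ef in auto)
    then have "2 * min (b - a) (d - c) \<le> c - b" by (simp add: min_def)
    then show ?thesis by blast
  next
    case 2
    have e': "e \<in> {a..b} \<inter> Esc V q" using e Esc_mono[OF 2(2), of V] by auto
    have "2 * (d - c) \<le> c - b"
    proof (rule gap_core[OF V 2(1) abcd(3) gaps(2) q(3) _ gaps(1) f e'])
      fix r assume "min f e < r" "r < max f e" "r \<notin> {a..b}" "r \<notin> {c..d}"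
      then have "b < r" "r < c" using ef e f by auto
      then show "\<bar>(c + d) / 2 - r\<bar> \<le> (d - c) / 2 + (c - b)" using abcd by (simp add: abs_real_def field_simps)
    qed (use sig ef in auto)
    then have "2 * min (b - a) (d - c) \<le> c - b" by (simp add: min_def)
    then show ?thesis by blast
  next
    \<comment> \<open>The point of \<open>Sig V\<close> between \<open>e\<close> and
      \<open>f\<close> forces them into different half-lines of \<open>Esc V 1\<close>.\<close>
    case 3
    have esc: "e \<in> {..<-2} \<union> {2+V<..}" "f \<in> {..<-2} \<union> {2+V<..}"
      using e f 3 Esc_1[of V] V by auto
    have bds: "Sig V \<subseteq> {-2..2+V}" using V by (intro Sig_bounds) auto
    obtain s where s: "s \<in> Sig V" "e \<le> s" "s \<le> f" using sig by auto
    then have "- 2 \<le> s" "s \<le> 2 + V" using bds by auto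
    then have ef': "e < - 2" "f > 2 + V" using esc s by auto
    have "x \<notin> Sig V" if "x \<le> b" for x
      using that gaps(1) e ef'(1) bds by (cases "e \<le> x") (auto simp: disjoint_iff)
    moreover have "x \<notin> Sig V" if "x \<ge> c" for x
      using that gaps(2) f ef'(2) bds by (cases "x \<le> f") (auto simp: disjoint_iff)
    ultimately have "{..b} \<inter> Sig V = {}" "{c..} \<inter> Sig V = {}" by auto
    then show ?thesis by blast
  qed
qed

section \<open>Sums of thick sets\<close>

text \<open>Newhouse thickness at least 2. An unbounded gap may play the role of \<open>{a<..<b}\<close> or \<open>{c<..<d}\<close>, which is why
  the case of two unbounded gaps is exempted.\<close>

definition thick :: "real set \<Rightarrow> bool" where
  "thick S \<longleftrightarrow> (\<forall>a b c d. a < b \<and> b \<le> c \<and> c < d \<and> {a<..<b} \<inter> S = {} \<and> {c<..<d} \<inter> S = {} \<and> b \<in> S \<and> c \<in> S \<longrightarrow>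
     2 * min (b - a) (d - c) \<le> c - b \<or> ({..<b} \<inter> S = {} \<and> {c<..} \<inter> S = {}))"

text \<open>Open gaps with an endpoint in \<open>S\<close> are approximated from inside by closed
  intervals disjoint from \<open>S\<close>, the form in which escape times apply.\<close>

lemma thickI:
  assumes "\<And>a b c d. \<lbrakk>a < b; b < c; c < d; {a..b} \<inter> S = {}; {c..d} \<inter> S = {}; {b..c} \<inter> S \<noteq> {}\<rbrakk> \<Longrightarrow>
     2 * min (b - a) (d - c) \<le> c - b \<or> ({..b} \<inter> S = {} \<and> {c..} \<inter> S = {})"
  shows "thick S"
  unfolding thick_def
proof (intro allI impI)
  fix a b c d
  assume H: "a < b \<and> b \<le> c \<and> c < d \<and> {a<..<b} \<inter> S = {} \<and> {c<..<d} \<inter> S = {} \<and> b \<in> S \<and> c \<in> S"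
  show "2 * min (b - a) (d - c) \<le> c - b \<or> ({..<b} \<inter> S = {} \<and> {c<..} \<inter> S = {})"
  proof (rule ccontr)
    assume neg: "\<not> ?thesis"
    define \<mu> where "\<mu> = min (b - a) (d - c)"
    \<comment> \<open>Shrinking takes \<open>2 * \<epsilon>\<close> from each gap and adds
      \<open>2 * \<epsilon>\<close> to their distance, a loss of \<open>6 * \<epsilon>\<close> in
      the inequality; an eighth of the excess keeps the violation strict.\<close>
    define \<epsilon> where "\<epsilon> = min (\<mu> / 4) ((2 * \<mu> - (c - b)) / 8)"
    have \<mu>: "\<mu> > 0" "\<mu> \<le> b - a" "\<mu> \<le> d - c" "2 * \<mu> > c - b" using H neg by (auto simp: \<mu>_def)
    then have \<epsilon>: "\<epsilon> > 0" "\<epsilon> \<le> \<mu> / 4" "8 * \<epsilon> \<le> 2 * \<mu> - (c - b)" by (auto simp: \<epsilon>_def min_def)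
    have 1: "a + \<epsilon> < b - \<epsilon>" "b - \<epsilon> < c + \<epsilon>" "c + \<epsilon> < d - \<epsilon>" using \<mu> \<epsilon> H by auto
    have 2: "{a + \<epsilon>..b - \<epsilon>} \<inter> S = {}" "{c + \<epsilon>..d - \<epsilon>} \<inter> S = {}"
      using H \<epsilon> by (auto simp: disjoint_iff)
    have 3: "{b - \<epsilon>..c + \<epsilon>} \<inter> S \<noteq> {}"
      using H \<epsilon> by (auto simp: disjoint_iff intro!: bexI[of _ b])
    have "\<not> 2 * min (b - \<epsilon> - (a + \<epsilon>)) (d - \<epsilon> - (c + \<epsilon>)) \<le> c + \<epsilon> - (b - \<epsilon>)"
      using \<mu> \<epsilon> by (auto simp: min_def)
    then have *: "{..b - \<epsilon>} \<inter> S = {}" "{c + \<epsilon>..} \<inter> S = {}" using assms[OF 1 2 3] by auto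
    have "x \<notin> S" if "x < b" for x
      using * that H \<mu> \<epsilon> by (cases "x \<le> b - \<epsilon>") (auto simp: disjoint_iff)
    moreover have "x \<notin> S" if "x > c" for x
      using * that H \<mu> \<epsilon> by (cases "x \<ge> c + \<epsilon>") (auto simp: disjoint_iff)
    ultimately show False using neg by auto
  qed
qed

lemma thickD:
  assumes "thick S" "a < b" "b \<le> c" "c < d" "{a<..<b} \<inter> S = {}" "{c<..<d} \<inter> S = {}" "b \<in> S" "c \<in> S"
  shows "2 * min (b - a) (d - c) \<le> c - b \<or> ({..<b} \<inter> S = {} \<and> {c<..} \<inter> S = {})"
  using assms unfolding thick_def by blast

lemma thick_uminus:
  assumes "thick S" shows "thick (uminus ` S)"
  unfolding thick_def
proof (intro allI impI)
  fix a b c d :: real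
  assume H: "a < b \<and> b \<le> c \<and> c < d \<and> {a<..<b} \<inter> uminus ` S = {} \<and> {c<..<d} \<inter> uminus ` S = {} \<and> b \<in> uminus ` S \<and> c \<in> uminus ` S"
  have neg: "X \<inter> uminus ` S = {} \<longleftrightarrow> uminus ` X \<inter> S = {}" for X :: "real set" by force
  have "2 * min (- c - - d) (- a - - b) \<le> - b - - c \<or> ({..<- c} \<inter> S = {} \<and> {- b<..} \<inter> S = {})"
    using H by (intro thickD[OF assms]) (auto simp: neg)
  then show "2 * min (b - a) (d - c) \<le> c - b \<or> ({..<b} \<inter> uminus ` S = {} \<and> {c<..} \<inter> uminus ` S = {})"
    by (auto simp: neg min_def split: if_splits)
qed

lemma closed_nearest_below:
  fixes S :: "real set"
  assumes "closed S" "a \<in> S" "a \<le> v" "v \<notin> S"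
  obtains x where "x \<in> S" "a \<le> x" "x < v" "{x<..<v} \<inter> S = {}"
proof -
  have "compact (S \<inter> {a..v})" "S \<inter> {a..v} \<noteq> {}" using assms by (auto intro: closed_Int_compact)
  then obtain x where x: "x \<in> S \<inter> {a..v}" "\<And>y. y \<in> S \<inter> {a..v} \<Longrightarrow> y \<le> x"
    using compact_attains_sup[of "S \<inter> {a..v}"] by metis
  have "y \<notin> S" if "x < y" "y < v" for y using x(1) x(2)[of y] that by auto
  moreover have "x < v" using x(1) assms(4) by (auto simp: order_le_less)
  ultimately show ?thesis using x(1) by (intro that[of x]) auto
qed

lemma closed_nearest_above:
  fixes S :: "real set"
  assumes "closed S" "b \<in> S" "v \<le> b" "v \<notin> S"
  obtains x where "x \<in> S" "v < x" "{v<..<x} \<inter> S = {}"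
proof -
  have "compact (S \<inter> {v..b})" "S \<inter> {v..b} \<noteq> {}" using assms by (auto intro: closed_Int_compact)
  then obtain x where x: "x \<in> S \<inter> {v..b}" "\<And>y. y \<in> S \<inter> {v..b} \<Longrightarrow> x \<le> y"
    using compact_attains_inf[of "S \<inter> {v..b}"] by metis
  have "y \<notin> S" if "v < y" "y < x" for y using x(1) x(2)[of y] that by auto
  moreover have "v < x" using x(1) assms(4) by (auto simp: order_le_less)
  ultimately show ?thesis using x(1) by (intro that[of x]) auto
qed

text \<open>A gap \<open>{u1<..<u2}\<close> of \<open>S\<close> and the gap \<open>{t-w2<..<t-w1}\<close> of \<open>t - S\<close> that are linked; unbounded
  gaps are cut off at length \<open>R\<close>.\<close>

definition linked :: "real set \<Rightarrow> real \<Rightarrow> real \<Rightarrow> real \<Rightarrow> real \<Rightarrow> real \<Rightarrow> real \<Rightarrow> bool" where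
  "linked S t m u1 u2 w1 w2 \<longleftrightarrow> u1 < u2 \<and> w1 < w2 \<and> {u1<..<u2} \<inter> S = {} \<and> {w1<..<w2} \<inter> S = {} \<and>
     u2 \<in> S \<and> w2 \<in> S \<and> (u1 \<in> S \<or> u1 = m) \<and> (w1 \<in> S \<or> w1 = m) \<and>
     u1 + w2 < t \<and> u2 + w1 < t \<and> t < u2 + w2"

lemma linked_swap: "linked S t m u1 u2 w1 w2 \<Longrightarrow> linked S t m w1 w2 u1 u2"
  by (auto simp: linked_def)

text \<open>Linking means \<open>u1 < t - w2 < u2 < t - w1\<close>. Since \<open>t - u1\<close> is
  not in \<open>S\<close>, it lies in a further gap \<open>{w1'<..<w2'}\<close> whose distance from
  \<open>w2\<close> is below \<open>u2 - u1\<close>, hence below \<open>w2 - w1\<close>. Thickness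
  then makes the new gap at most half as long as the old one. It is linked with the other gap at the
  opposite end, and the reflection restores the orientation.\<close>

lemma linked_step:
  assumes S: "closed S" "p \<in> S" "q \<in> S" "S \<subseteq> {p..q}" "thick S"
    and R: "R > q - p" and t: "2 * p \<le> t"
    and nosum: "\<And>x y. x \<in> S \<Longrightarrow> y \<in> S \<Longrightarrow> x + y \<noteq> t"
    and L: "linked S t (p - R) u1 u2 w1 w2" and le: "u2 - u1 \<le> w2 - w1"
  shows "\<exists>w1' w2'. linked (uminus ` S) (- t) (- q - R) (- u2) (- u1) (- w2') (- w1') \<and> 2 * (w2' - w1') \<le> w2 - w1"
proof -
  have l: "u1 < u2" "w1 < w2" "{u1<..<u2} \<inter> S = {}" "{w1<..<w2} \<inter> S = {}" "u2 \<in> S" "w2 \<in> S"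
    "u1 \<in> S \<or> u1 = p - R" "w1 \<in> S \<or> w1 = p - R" "u1 + w2 < t" "u2 + w1 < t" "t < u2 + w2"
    using L by (auto simp: linked_def)
  have bds: "p \<le> x" "x \<le> q" if "x \<in> S" for x using that S by auto
  have pq: "p \<le> q" using S bds by auto
  \<comment> \<open>A cut-off unbounded gap is longer than any bounded one, as
    \<open>R > q - p\<close>. If the shorter gap were unbounded, both would be, and linking would
    give \<open>t < 2 * p\<close>.\<close>
  have u1: "u1 \<in> S"
  proof (rule ccontr)
    assume "u1 \<notin> S"
    then have *: "u1 = p - R" using l by auto
    have "\<not> p < u2" using l(3) * S(2) R pq by (auto simp: disjoint_iff)
    then have "u2 = p" using bds[OF l(5)] by simp
    then have "w1 \<notin> S" using le * bds[of w1] bds[of w2] l R by auto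
    then have w: "w1 = p - R" using l by auto
    have "\<not> p < w2" using l(4) w S(2) R pq by (auto simp: disjoint_iff)
    then have "w2 = p" using bds[OF l(6)] by simp
    then show False using \<open>u2 = p\<close> l t by simp
  qed
  define v where "v = t - u1"
  have v: "w2 < v" "v \<notin> S" "v - w2 < u2 - u1" using l(9,11) nosum[OF u1, of v] by (auto simp: v_def)
  have vR: "v < q + R" using v bds[OF l(5)] bds[OF u1] bds[OF l(6)] R by linarith
  obtain w1' where w1': "w1' \<in> S" "w2 \<le> w1'" "w1' < v" "{w1'<..<v} \<inter> S = {}"
    using closed_nearest_below[OF S(1) l(6) less_imp_le[OF v(1)] v(2)] .
  obtain w2' where w2': "w2' \<in> S \<or> w2' = q + R" "v < w2'" "{v<..<w2'} \<inter> S = {}"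
  proof (cases "v \<le> q")
    case True
    obtain x where "x \<in> S" "v < x" "{v<..<x} \<inter> S = {}"
      using closed_nearest_above[OF S(1,3) True v(2)] .
    then show ?thesis using that by blast
  next
    case False
    show ?thesis
    proof (rule that[of "q + R"])
      have "x \<notin> S" if "v < x" for x using False bds(2)[of x] that by auto
      then show "{v<..<q + R} \<inter> S = {}" by auto
    qed (use vR in auto)
  qed
  have gap: "{w1'<..<w2'} \<inter> S = {}"
  proof -
    have "x \<notin> S" if "w1' < x" "x < w2'" for x
      using that w1' w2' v by (cases x v rule: linorder_cases) (auto simp: disjoint_iff)
    then show ?thesis by auto
  qed
  have "2 * min (w2 - w1) (w2' - w1') \<le> w1' - w2 \<or> ({..<w2} \<inter> S = {} \<and> {w1'<..} \<inter> S = {})"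
    using w1' w2' l gap by (intro thickD[OF S(5)]) auto
  moreover have "\<not> ({..<w2} \<inter> S = {} \<and> {w1'<..} \<inter> S = {})"
  proof
    assume "{..<w2} \<inter> S = {} \<and> {w1'<..} \<inter> S = {}"
    then have "w2 \<le> p" "q \<le> w1'" using S(2,3) by (auto simp flip: not_less)
    then show False using v w1' bds[OF u1] bds[OF l(5)] by linarith
  qed
  ultimately have "2 * min (w2 - w1) (w2' - w1') \<le> w1' - w2" by blast
  then have half: "2 * (w2' - w1') \<le> w2 - w1"
    using v(3) w1'(3) le l(2) unfolding min_def by (cases "w2 - w1 \<le> w2' - w1'") auto
  have neg: "X \<inter> uminus ` S = {} \<longleftrightarrow> uminus ` X \<inter> S = {}" for X :: "real set" by force
  have "linked (uminus ` S) (- t) (- q - R) (- u2) (- u1) (- w2') (- w1')"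
    unfolding linked_def neg
  proof (intro conjI)
    show "uminus ` {- u2<..<- u1} \<inter> S = {}" "uminus ` {- w2'<..<- w1'} \<inter> S = {}"
      using l(3) gap by auto
    show "- w2' \<in> uminus ` S \<or> - w2' = - q - R" using w2'(1) by auto
  qed (use l(1,5,11) u1 w1' w2'(2) in \<open>auto simp: v_def\<close>)
  then show ?thesis using half by blast
qed

text \<open>Each step at least halves the product of the two lengths. But both lengths of a linked
  pair exceed \<open>u2 + w2 - t\<close>, which is at least \<open>\<delta>\<close>. The induction
  generalises over \<open>S\<close> and \<open>t\<close> to allow for the reflection.\<close>

lemma no_linked:
  assumes "closed S" "p \<in> S" "q \<in> S" "S \<subseteq> {p..q}" "thick S"
    and "R > q - p" and "2 * p \<le> t" "t \<le> 2 * q" and "\<delta> > 0"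
    and "\<And>x y. x \<in> S \<Longrightarrow> y \<in> S \<Longrightarrow> \<delta> \<le> \<bar>x + y - t\<bar>"
    and "linked S t (p - R) u1 u2 w1 w2"
    and "(u2 - u1) * (w2 - w1) < \<delta>\<^sup>2 * 2 ^ k"
  shows False
  using assms
proof (induction k arbitrary: S p q t u1 u2 w1 w2)
  case 0
  have l: "u2 \<in> S" "w2 \<in> S" "u1 + w2 < t" "u2 + w1 < t" "t < u2 + w2" using 0 by (auto simp: linked_def)
  have "\<delta> \<le> u2 + w2 - t" using 0(10)[OF l(1,2)] l by auto
  then have "\<delta> * \<delta> \<le> (u2 - u1) * (w2 - w1)" using l 0 by (intro mult_mono) auto
  then show False using 0 by (simp add: power2_eq_square)
next
  case (Suc k)
  have nosum: "x + y \<noteq> t" if "x \<in> S" "y \<in> S" for x y using Suc.prems(9) Suc.prems(10)[OF that] by auto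
  have *: False if L: "linked S t (p - R) u1 u2 w1 w2" and le: "u2 - u1 \<le> w2 - w1"
    and prod: "(u2 - u1) * (w2 - w1) < \<delta>\<^sup>2 * 2 ^ Suc k" for u1 u2 w1 w2
  proof -
    obtain w1' w2' where w': "linked (uminus ` S) (- t) (- q - R) (- u2) (- u1) (- w2') (- w1')"
      "2 * (w2' - w1') \<le> w2 - w1"
      using linked_step[OF Suc.prems(1-7) nosum L le] by blast
    have "u1 < u2" using L by (simp add: linked_def)
    then have "(u2 - u1) * (2 * (w2' - w1')) \<le> (u2 - u1) * (w2 - w1)"
      using w' by (intro mult_left_mono) auto
    then have "2 * ((u2 - u1) * (w2' - w1')) < 2 * (\<delta>\<^sup>2 * 2 ^ k)" using prod by (simp add: algebra_simps)
    then have prod': "(- u1 - - u2) * (- w1' - - w2') < \<delta>\<^sup>2 * 2 ^ k" by simp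
    have dist:  "\<delta> \<le> \<bar>x + y - - t\<bar>" if xy: "x \<in> uminus ` S" "y \<in> uminus ` S" for x y
    proof -
      have "\<delta> \<le> \<bar>- x + - y - t\<bar>" using xy by (intro Suc.prems(10)) auto
      then show ?thesis by linarith
    qed
    show False
      by (rule Suc.IH[OF closed_negations[OF Suc.prems(1)] _ _ _ thick_uminus[OF Suc.prems(5)] _ _ _ Suc.prems(9) dist w'(1) prod'])
        (use Suc.prems(2-4,6-8) in auto)
  qed
  show False
  proof (cases "u2 - u1 \<le> w2 - w1")
    case True
    then show False using *[OF Suc.prems(11)] Suc.prems(12) by simp
  next
    case False
    then show False using *[OF linked_swap[OF Suc.prems(11)]] Suc.prems(12) by (simp add: mult.commute)
  qed
qed

text \<open>Otherwise \<open>t\<close> has a positive distance from the compact sum set. The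
  unbounded gap below \<open>p\<close> is then linked with the gap of \<open>S\<close> around
  \<open>t - p\<close> if \<open>t - p \<le> q\<close>; in the other case the reflected set is
  used.\<close>

lemma thick_sum:
  fixes S :: "real set"
  assumes S: "compact S" "p \<in> S" "q \<in> S" "S \<subseteq> {p..q}" "thick S" and t: "2 * p \<le> t" "t \<le> 2 * q"
  shows "\<exists>x\<in>S. \<exists>y\<in>S. x + y = t"
proof (rule ccontr)
  assume neg: "\<not> ?thesis"
  define R where "R = q - p + 1"
  have bds: "p \<le> x" "x \<le> q" if "x \<in> S" for x using that S by auto
  obtain \<delta> where \<delta>: "\<delta> > 0" "\<And>x y. x \<in> S \<Longrightarrow> y \<in> S \<Longrightarrow> \<delta> \<le> \<bar>x + y - t\<bar>"
  proof -
    have c: "compact (S \<times> S)" using S by (intro compact_Times)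
    have "\<exists>z\<in>S \<times> S. \<forall>w\<in>S \<times> S. \<bar>fst z + snd z - t\<bar> \<le> \<bar>fst w + snd w - t\<bar>"
      by (rule continuous_attains_inf[OF c]) (use S(2) in \<open>auto intro!: continuous_intros\<close>)
    then obtain z where z: "z \<in> S \<times> S" "\<And>w. w \<in> S \<times> S \<Longrightarrow> \<bar>fst z + snd z - t\<bar> \<le> \<bar>fst w + snd w - t\<bar>"
      by blast
    show ?thesis
    proof (rule that[of "\<bar>fst z + snd z - t\<bar>"])
      show "0 < \<bar>fst z + snd z - t\<bar>" using neg z(1) by (cases z) force
      show "\<bar>fst z + snd z - t\<bar> \<le> \<bar>x + y - t\<bar>" if "x \<in> S" "y \<in> S" for x y
        using z(2)[of "(x, y)"] that by simp
    qed
  qed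
  have no: False if Q: "closed Q" "a \<in> Q" "b \<in> Q" "Q \<subseteq> {a..b}" "thick Q" "R > b - a" "2 * a \<le> s" "s \<le> 2 * b"
    and \<delta>Q: "\<And>x y. x \<in> Q \<Longrightarrow> y \<in> Q \<Longrightarrow> \<delta> \<le> \<bar>x + y - s\<bar>" and "s - a \<le> b" for Q a b s
  proof -
    define v where "v = s - a"
    have v: "v \<notin> Q" "a < v" "v \<le> b"
    proof -
      show "v \<notin> Q" using \<delta>Q[of a v] Q \<delta> by (auto simp: v_def)
      show "v \<le> b" using that by (simp add: v_def)
      have "v \<noteq> a" using \<open>v \<notin> Q\<close> Q by auto
      then show "a < v" using Q by (simp add: v_def)
    qed
    obtain w1 where w1: "w1 \<in> Q" "w1 < v" "{w1<..<v} \<inter> Q = {}"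
      using closed_nearest_below[OF Q(1,2) less_imp_le[OF v(2)] v(1)] .
    obtain w2 where w2: "w2 \<in> Q" "v < w2" "{v<..<w2} \<inter> Q = {}"
      using closed_nearest_above[OF Q(1,3) v(3,1)] .
    have gap: "{w1<..<w2} \<inter> Q = {}"
    proof -
      have "x \<notin> Q" if "w1 < x" "x < w2" for x
        using that w1 w2 v by (cases x v rule: linorder_cases) (auto simp: disjoint_iff)
      then show ?thesis by auto
    qed
    have ab: "a \<le> x" "x \<le> b" if "x \<in> Q" for x using that Q by auto
    have link: "linked Q s (a - R) (a - R) a w1 w2"
      unfolding linked_def
    proof (intro conjI)
      show "{a - R<..<a} \<inter> Q = {}" using ab(1) by fastforce
      show "a - R + w2 < s" "a - R < a" using ab(2)[OF w2(1)] Q(6,7) ab[OF Q(2)] by linarith+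
    qed (use w1 w2 gap Q(2) v in \<open>auto simp: v_def\<close>)
    obtain k where "(a - (a - R)) * (w2 - w1) / \<delta>\<^sup>2 < 2 ^ k"
      using real_arch_pow[of 2] by auto
    then have prod: "(a - (a - R)) * (w2 - w1) < \<delta>\<^sup>2 * 2 ^ k" using \<delta> by (simp add: field_simps)
    show False by (rule no_linked[OF Q(1-8) \<delta>(1) _ link prod]) (rule \<delta>Q)
  qed
  have cl: "closed S" using S by (simp add: compact_imp_closed)
  show False
  proof (cases "t - p \<le> q")
    case True
    show False by (rule no[OF cl S(2-5) _ t \<delta>(2) True]) (auto simp: R_def)
  next
    case False
    have dist: "\<delta> \<le> \<bar>x + y - - t\<bar>" if xy: "x \<in> uminus ` S" "y \<in> uminus ` S" for x y
    proof -
      have "\<delta> \<le> \<bar>- x + - y - t\<bar>" using xy by (intro \<delta>) auto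
      then show ?thesis by linarith
    qed
    have "uminus ` S \<subseteq> {- q..- p}" using S(4) by auto
    show False
    proof (rule no[OF closed_negations[OF cl] _ _ \<open>uminus ` S \<subseteq> {- q..- p}\<close> thick_uminus[OF S(5)]])
      show "- q \<in> uminus ` S" "- p \<in> uminus ` S" using S(2,3) by auto
      show "\<delta> \<le> \<bar>x + y - (- t)\<bar>" if "x \<in> uminus ` S" "y \<in> uminus ` S" for x y
        using dist[OF that] .
      show "- p - - q < R" by (simp add: R_def)
      show "2 * - q \<le> - t" "- t \<le> 2 * - p" "- t - - q \<le> - p" using t False by linarith+
    qed
  qed
qed

section \<open>The Fibonacci Hamiltonian\<close>

lemma le_fib: "n \<le> fib n + 1"
proof (induction n rule: fib.induct)
  case (3 n)
  have "n = 0 \<or> fib n \<ge> 1" using fib_neq_0_nat[of n] by (cases n) auto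
  then show ?case using 3 by auto
qed auto

abbreviation fib_op :: "real \<Rightarrow> real \<Rightarrow> int l2 \<Rightarrow> int l2" where
  "fib_op V \<omega> \<equiv> l2_op (schr (\<lambda>n. V * fib_word \<omega> n))"

lemma fib_op_symmetric: "l2_symmetric (fib_op V \<omega>)"
  by (rule schr_symmetric[of _ "\<bar>V\<bar>"]) (rule potential_bounded)

lemma approx_ev_phase:
  assumes "approx_ev (fib_op V \<omega>) E" shows "approx_ev (fib_op V \<omega>') E"
proof (rule approx_ev_transfer[of "\<lambda>n. V * fib_word \<omega> n" "\<bar>V\<bar>" "\<lambda>n. V * fib_word \<omega>' n"])
  show "\<exists>k. \<forall>n\<in>F. V * fib_word \<omega>' (n + k) = V * fib_word \<omega> n" if F: "finite F" for F
    using fib_word_window[OF F, of 0 \<omega>' \<omega>] by auto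
qed (rule potential_bounded potential_bounded assms)+

text \<open>Right after position \<open>fib (k + 1)\<close> the prefix of length
  \<open>fib k\<close> occurs twice in succession, by \<open>fib_word_prefix\<close> at
  \<open>k + 1\<close> and \<open>k + 2\<close>; at the origin that lemma covers only
  \<open>fib (k - 1)\<close> sites of a second copy. An energy that never escapes has arbitrarily
  large \<open>k\<close> with trace in the band, so the error \<open>6 / fib k\<close> becomes
  small.\<close>

lemma Sig_approx_ev:
  assumes E: "E \<in> Sig V"
  shows "approx_ev (fib_op V 0) E"
  unfolding approx_ev_def
proof (intro allI impI)
  fix \<epsilon> :: real assume \<epsilon>: "\<epsilon> > 0"
  obtain K :: nat where K: "6 / \<epsilon> < real K" using reals_Archimedean2[of "6 / \<epsilon>"] ..
  have "E \<notin> Esc V (K + 2)" using E by (simp add: Sig_def)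
  then have "\<bar>tr V (K + 2) E\<bar> \<le> 1 \<or> \<bar>tr V (Suc (K + 2)) E\<bar> \<le> 1" unfolding Esc_def by auto
  then obtain k where k: "k \<ge> K + 2" "\<bar>tr V k E\<bar> \<le> 1" by (metis le_Suc_eq order_refl)
  define N where "N = fib k"
  have N: "N \<ge> 1" using fib_neq_0_nat[of k] k by (simp add: N_def)
  have "K \<le> N" using le_fib[of k] k by (simp add: N_def)
  then have "6 / \<epsilon> < real N" using K by linarith
  then have small: "6 / real N < \<epsilon>" using \<epsilon> N by (simp add: field_simps)
  define s where "s = int (fib (k + 1))"
  define q where "q n = V * fib_word 0 (n + s)" for n
  have w1: "fib_word 0 (int i + s) = fib_word 0 (int i)" if "1 \<le> i" "i \<le> N" for i
    using fib_word_prefix[of "k + 1" i] k that by (simp add: N_def s_def add.commute)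
  have w2: "fib_word 0 (int (i + N) + s) = fib_word 0 (int i)" if i: "1 \<le> i" "i \<le> N" for i
  proof -
    have "fib k \<le> fib (k + 1)" by (simp add: fib_mono)
    then have "fib_word 0 (int (fib (k + 2) + i)) = fib_word 0 (int i)"
      using i k by (intro fib_word_prefix) (auto simp: N_def)
    moreover have eq: "int (fib (k + 2) + i) = int (i + N) + s" by (simp add: N_def s_def)
    ultimately show ?thesis unfolding eq by blast
  qed
  have qb: "\<bar>q n\<bar> \<le> \<bar>V\<bar>" for n unfolding q_def by (rule potential_bounded)
  have "\<exists>u. u \<noteq> 0 \<and> norm (l2_op (schr q) u - cs (of_real E) u) \<le> 6 / N * norm u"
  proof (rule two_period_approx[OF qb N])
    show "q (int (i + N)) = q (int i)" if "1 \<le> i" "i \<le> N" for i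
      unfolding q_def using w1[OF that] w2[OF that] by simp
    have "tm q (of_real E) 1 N = tm (\<lambda>n. V * fib_word 0 n) (of_real E) 1 N"
    proof (rule tm_cong)
      fix j assume "j < N"
      then show "q (1 + int j) = V * fib_word 0 (1 + int j)" using w1[of "Suc j"] by (simp add: q_def)
    qed
    then show "trace (tm q (of_real E) 1 N) = 2 * of_real (tr V k E)"
      using trace_tm_fib[of k V "of_real E"] k by (simp add: N_def tr_of_real)
  qed (rule k)
  then obtain u where u: "u \<noteq> 0" "norm (l2_op (schr q) u - cs (of_real E) u) \<le> 6 / N * norm u" by blast
  define v where "v = reidx (\<lambda>n. n - s) u"
  have occ: "V * fib_word 0 (n + s) = q n" for n by (simp add: q_def)
  note tp = schr_transplant[where q = q and q' = "\<lambda>n. V * fib_word 0 n" and B = "\<bar>V\<bar>" and u = u and k = s, OF qb potential_bounded(1) occ]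
  have "norm (fib_op V 0 v - E *\<^sub>R v) = norm (l2_op (schr q) u - cs (of_real E) u)"
    using tp(2)[of "of_real E"] by (simp add: v_def cs_simps(6))
  also have "\<dots> \<le> 6 / N * norm v" using u(2) tp(1) by (simp add: v_def)
  also have "\<dots> < \<epsilon> * norm v" using small u(1) tp(1) by (intro mult_strict_right_mono) (auto simp: v_def)
  finally show "\<exists>u. norm (fib_op V 0 u - E *\<^sub>R u) < \<epsilon> * norm u" by blast
qed

text \<open>A truncated approximate eigenvector does not distinguish the Fibonacci potential from a
  long periodic approximant, which by \<open>approx_ev_near\<close> then has an approximate
  eigenvalue \<open>E'\<close> close to \<open>E\<close>. But a whole neighbourhood of
  \<open>E\<close> has escaped, and \<open>periodic_gap_below\<close> excludes
  \<open>E'\<close>.\<close>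

lemma approx_ev_Sig:
  assumes E: "approx_ev (fib_op V 0) E"
  shows "E \<in> Sig V"
proof (rule ccontr)
  assume "E \<notin> Sig V"
  then have "E \<in> - Sig V" by simp
  moreover have "open (- Sig V)" using closed_Sig by (simp add: open_closed)
  ultimately obtain \<delta> where \<delta>: "\<delta> > 0" "cball E \<delta> \<subseteq> - Sig V" by (meson open_contains_cball)
  then have "cball E \<delta> \<inter> Sig V = {}" by blast
  then obtain n0 where n0: "\<And>m. m \<ge> n0 \<Longrightarrow> cball E \<delta> \<subseteq> Esc V m"
    using compact_disjoint_Sig[OF compact_cball] by blast
  interpret H0: l2_symmetric "fib_op V 0" by (rule fib_op_symmetric)
  obtain u where u: "finite {x. l2_fun u x \<noteq> 0}" "norm (fib_op V 0 u - E *\<^sub>R u) < \<delta> * norm u"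
    using H0.approx_ev_finite_support[OF E \<delta>(1)] by blast
  define F where "F = {x. l2_fun u x \<noteq> 0}"
  define R where "R = Max (insert 0 (abs ` F))"
  have R: "\<bar>n\<bar> \<le> R" if "n \<in> F" for n unfolding R_def using u(1) that by (intro Max_ge) (auto simp: F_def)
  \<comment> \<open>The shift moves the support into the sites from 1 to \<open>fib m\<close>, where
    the periodic word agrees with the Fibonacci word.\<close>
  obtain k where k: "k \<ge> R + 1" "\<forall>n\<in>F. fib_word 0 (n + k) = fib_word 0 n"
    using fib_word_window[of F "R + 1" 0 0] u(1) by (auto simp: F_def)
  define m where "m = n0 + nat (R + k) + 2"
  have m: "m \<ge> 2" "m \<ge> n0" by (auto simp: m_def)
  have "R + k \<le> int (fib m)" using le_fib[of m] by (simp add: m_def)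
  define q where "q n = V * per_word (fib m) n" for n
  have qb: "\<bar>q n\<bar> \<le> \<bar>V\<bar>" for n unfolding q_def by (rule potential_bounded)
  have occ: "q (n + k) = V * fib_word 0 n" if "l2_fun u n \<noteq> 0" for n
  proof -
    have n: "n \<in> F" using that by (simp add: F_def)
    then have "1 \<le> n + k" "n + k \<le> int (fib m)" using R[OF n] k(1) \<open>R + k \<le> int (fib m)\<close> by linarith+
    then show ?thesis using k(2) n by (simp add: q_def per_word_eq)
  qed
  define v where "v = reidx (\<lambda>n. n - k) u"
  note tp = schr_transplant[where q = "\<lambda>n. V * fib_word 0 n" and q' = q and B = "\<bar>V\<bar>" and u = u and k = k, OF potential_bounded(1) qb occ]
  have "norm (l2_op (schr q) v - E *\<^sub>R v) < \<delta> * norm v"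
    using tp(2)[of "of_real E"] tp(1) u(2) by (simp add: v_def cs_simps(6))
  interpret H: l2_symmetric "l2_op (schr q)" by (rule schr_symmetric[of q "\<bar>V\<bar>"]) (rule qb)
  obtain E' where E': "\<bar>E' - E\<bar> < \<delta>" "approx_ev (l2_op (schr q)) E'"
    using H.approx_ev_near[OF \<open>norm (l2_op (schr q) v - E *\<^sub>R v) < \<delta> * norm v\<close>] by blast
  have "E' \<in> cball E \<delta>" using E' by (simp add: dist_real_def)
  then have t: "\<bar>tr V m E'\<bar> > 1" using n0[OF m(2)] by (auto simp: Esc_def)
  have "\<exists>\<epsilon>>0. \<forall>u. \<epsilon> * norm u \<le> norm (l2_op (schr q) u - cs (of_real E') u)"
  proof (rule periodic_gap_below[OF qb])
    show "q (n + int (fib m)) = q n" for n by (simp add: q_def per_word_periodic)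
    show "trace (tm q (of_real E') 1 (fib m)) = 2 * of_real (tr V m E')"
      using trace_per_word[OF m(1), of V "of_real E'"] by (simp add: q_def[abs_def] tr_of_real)
  qed (rule t)
  then obtain \<epsilon> where \<epsilon>: "\<epsilon> > 0" "\<And>u. \<epsilon> * norm u \<le> norm (l2_op (schr q) u - E' *\<^sub>R u)"
    by (auto simp: cs_simps(6))
  obtain u' where "norm (l2_op (schr q) u' - E' *\<^sub>R u') < \<epsilon> * norm u'"
    using E'(2) \<epsilon>(1) unfolding approx_ev_def by blast
  then show False using \<epsilon>(2)[of u'] by linarith
qed

lemma approx_ev_iff_Sig: "approx_ev (fib_op V \<omega>) E \<longleftrightarrow> E \<in> Sig V"
  using approx_ev_Sig Sig_approx_ev approx_ev_phase by blast

lemma spectrum_fib_hamiltonian: "spectrum (fib_hamiltonian V \<omega>) = complex_of_real ` Sig V"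
proof -
  have "spectrum (fib_hamiltonian V \<omega>) = complex_of_real ` {E. approx_ev (fib_op V \<omega>) E}"
    unfolding fib_hamiltonian_schr
  proof (rule spectrum_symmetric)
    show "schr (\<lambda>n. V * fib_word \<omega> n) f \<in> ell2" if "f \<in> ell2" for f
      by (rule schr_ell2[OF potential_bounded(1) that])
  qed (rule fib_op_symmetric)
  then show ?thesis by (simp add: approx_ev_iff_Sig)
qed

lemma fib_spectrum_eq: "fib_spectrum V = complex_of_real ` Sig V"
  unfolding fib_spectrum_def spectrum_fib_hamiltonian by simp

text \<open>Bottom and top of the numerical range are approximate eigenvalues. If they coincided,
  \<open>psd_norm_bound\<close> would make the operator scalar, which its hopping term
  contradicts.\<close>

lemma Sig_hull:
  obtains a b where "a < b" "a \<in> Sig V" "b \<in> Sig V" "Sig V \<subseteq> {a..b}"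
    "\<And>u. a * (norm u)\<^sup>2 \<le> inner (fib_op V 0 u) u" "\<And>u. inner (fib_op V 0 u) u \<le> b * (norm u)\<^sup>2"
proof -
  interpret l2_symmetric "fib_op V 0" by (rule fib_op_symmetric)
  obtain a where a: "approx_ev (fib_op V 0) a" "\<And>u. a * (norm u)\<^sup>2 \<le> inner (fib_op V 0 u) u"
    using approx_ev_bottom by blast
  obtain b where b: "approx_ev (fib_op V 0) b" "\<And>u. inner (fib_op V 0 u) u \<le> b * (norm u)\<^sup>2"
    using approx_ev_top by blast
  have ab: "a \<in> Sig V" "b \<in> Sig V" using a b by (simp_all add: approx_ev_Sig)
  have sub: "Sig V \<subseteq> {a..b}"
    using approx_ev_ge[OF Sig_approx_ev a(2)] approx_ev_le[OF Sig_approx_ev b(2)] by auto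
  have "a \<noteq> b"
  proof
    assume "a = b"
    define B where "B u = fib_op V 0 u - a *\<^sub>R u" for u
    note B = shift_props[where E = a, folded B_def]
    have iB: "inner (B u) u = 0" for u
      using a(2)[of u] b(2)[of u] \<open>a = b\<close> by (simp add: B_def inner_diff_left power2_norm_eq_inner)
    obtain C where C: "C > 0" "\<And>u. norm (B u) \<le> C * norm u" using B(4) by blast
    have B0: "B u = 0" for u
    proof -
      have "(norm (B u))\<^sup>2 \<le> C * inner (B u) u"
        by (rule psd_norm_bound[OF B(1,2,3) _ C]) (simp add: iB)
      then show ?thesis by (simp add: iB)
    qed
    define f :: "int \<Rightarrow> complex" where "f n = (if n = 0 then 1 else 0)" for n
    have "{x. f x \<noteq> 0} = {0}" by (auto simp: f_def)
    then have f: "f \<in> ell2" by (intro ell2_finite_support) simp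
    have "l2_fun (B (Abs_l2 f)) 1 = 1"
      by (simp add: B_def l2_fun_schr[OF potential_bounded(1)] Abs_l2_inverse[OF f] schr_def f_def)
    then show False by (simp add: B0)
  qed
  moreover have "a \<le> b" using sub ab by auto
  ultimately show ?thesis using that[of a b] ab sub a(2) b(2) by auto
qed

lemma thick_Sig: "0 < V \<Longrightarrow> V \<le> 1/1000000 \<Longrightarrow> thick (Sig V)"
  by (rule thickI) (rule gap_distance)

lemma compact_Sig: "0 < V \<Longrightarrow> V \<le> 1 \<Longrightarrow> compact (Sig V)"
  using Sig_bounds[of V] closed_Sig[of V] bounded_subset[of "{-2..2+V}" "Sig V"]
  by (simp add: compact_eq_bounded_closed)

section \<open>The square Fibonacci Hamiltonian\<close>

lemma reidx_add: "bij g \<Longrightarrow> reidx g (u + v) = reidx g u + reidx g v"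
  by (rule ell2_l2_fun_eqI) (simp add: l2_fun_reidx)

lemma reidx_cs: "bij g \<Longrightarrow> reidx g (cs z u) = cs z (reidx g u)"
  by (rule ell2_l2_fun_eqI) (simp add: l2_fun_reidx cs.rep_eq)

lemma inner_reidx_swap: "inner (reidx prod.swap u) v = inner u (reidx prod.swap v)"
  by (rule inner_reidx) simp_all

lemma l2_symmetric_swap:
  assumes "l2_symmetric T"
  shows "l2_symmetric (\<lambda>u. reidx prod.swap (T (reidx prod.swap u)))"
proof -
  interpret T: l2_symmetric T by fact
  show ?thesis
  proof
    fix u v :: "('a \<times> 'a) l2" and z :: complex
    show "reidx prod.swap (T (reidx prod.swap (u + v))) = reidx prod.swap (T (reidx prod.swap u)) + reidx prod.swap (T (reidx prod.swap v))"
      by (simp add: reidx_add T.T_add)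
    show "reidx prod.swap (T (reidx prod.swap (cs z u))) = cs z (reidx prod.swap (T (reidx prod.swap u)))"
      by (simp add: reidx_cs T.T_cs)
    show "inner (reidx prod.swap (T (reidx prod.swap u))) v = inner u (reidx prod.swap (T (reidx prod.swap v)))"
      by (simp add: inner_reidx_swap T.T_sym)
    show "\<exists>C. \<forall>u. norm (reidx prod.swap (T (reidx prod.swap u))) \<le> C * norm u"
    proof -
      obtain C where "\<And>u. norm (T u) \<le> C * norm u" using T.bound_ge by blast
      then have "norm (reidx prod.swap (T (reidx prod.swap u))) \<le> C * norm u" for u
        using norm_reidx[of prod.swap u] by (metis bij_swap norm_reidx)
      then show ?thesis by blast
    qed
  qed
qed

section \<open>Rows and tensor products\<close>

definition row :: "('a \<times> 'b) l2 \<Rightarrow> 'b \<Rightarrow> 'a l2" where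
  "row w n = Abs_l2 (\<lambda>m. l2_fun w (m, n))"

lemma l2_fun_row: "l2_fun (row w n) = (\<lambda>m. l2_fun w (m, n))"
  unfolding row_def
proof (intro Abs_l2_inverse ell2_boundedI(1))
  fix F :: "'a set" assume F: "finite F"
  have "(\<Sum>m\<in>F. (cmod (l2_fun w (m, n)))\<^sup>2) = (\<Sum>p\<in>(\<lambda>m. (m, n)) ` F. (cmod (l2_fun w p))\<^sup>2)"
    by (subst sum.reindex) (auto simp: inj_on_def)
  also have "\<dots> \<le> (norm w)\<^sup>2" by (intro finite_sum_le_norm finite_imageI F)
  finally show "(\<Sum>m\<in>F. (cmod (l2_fun w (m, n)))\<^sup>2) \<le> (norm w)\<^sup>2" .
qed simp

text \<open>Fubini for the inner product. It reduces the quadratic form of an operator in the first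
  variable to the forms on the rows.\<close>

lemma inner_rows:
  shows "(\<lambda>n. inner (row u n) (row v n)) summable_on UNIV"
    and "inner u v = (\<Sum>\<^sub>\<infinity>n. inner (row u n) (row v n))"
proof -
  define f where "f n m = Re (l2_fun u (m, n) * cnj (l2_fun v (m, n)))" for n m
  have r: "inner (row u n) (row v n) = infsum (f n) UNIV" for n
    by (simp add: inner_l2.rep_eq l2_fun_row f_def[abs_def])
  have sw: "(\<lambda>(n, m). f n m) = (\<lambda>p. Re (l2_fun u (prod.swap p) * cnj (l2_fun v (prod.swap p))))"
    by (auto simp: f_def)
  have "(\<lambda>p. Re (l2_fun u p * cnj (l2_fun v p))) summable_on UNIV"
    by (rule ell2_inner_summable) simp_all
  then have "(\<lambda>(n, m). f n m) summable_on UNIV"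
    unfolding sw by (subst summable_on_reindex_bij_betw) simp_all
  then have s: "(\<lambda>(n, m). f n m) summable_on (UNIV \<times> UNIV)" by simp
  show "(\<lambda>n. inner (row u n) (row v n)) summable_on UNIV"
    unfolding r by (rule summable_on_Sigma_banach[OF s])
  have "inner u v = (\<Sum>\<^sub>\<infinity>(n, m). f n m)"
    unfolding sw inner_l2.rep_eq by (subst infsum_reindex_bij_betw) simp_all
  also have "\<dots> = (\<Sum>\<^sub>\<infinity>n. infsum (f n) UNIV)" using infsum_Sigma'_banach[OF s] by simp
  finally show "inner u v = (\<Sum>\<^sub>\<infinity>n. inner (row u n) (row v n))" by (simp only: r)
qed

definition tensor :: "'a l2 \<Rightarrow> 'b l2 \<Rightarrow> ('a \<times> 'b) l2" where
  "tensor u v = Abs_l2 (\<lambda>p. l2_fun u (fst p) * l2_fun v (snd p))"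

lemma l2_fun_tensor: "l2_fun (tensor u v) = (\<lambda>p. l2_fun u (fst p) * l2_fun v (snd p))"
  unfolding tensor_def
proof (intro Abs_l2_inverse ell2_boundedI(1))
  fix F :: "('a \<times> 'b) set" assume F: "finite F"
  have "(\<Sum>p\<in>F. (cmod (l2_fun u (fst p) * l2_fun v (snd p)))\<^sup>2)
      \<le> (\<Sum>p\<in>fst ` F \<times> snd ` F. (cmod (l2_fun u (fst p) * l2_fun v (snd p)))\<^sup>2)"
    by (intro sum_mono2 finite_cartesian_product finite_imageI F) (auto simp: rev_image_eqI)
  also have "\<dots> = (\<Sum>m\<in>fst ` F. (cmod (l2_fun u m))\<^sup>2) * (\<Sum>n\<in>snd ` F. (cmod (l2_fun v n))\<^sup>2)"
    by (simp add: sum_product sum.cartesian_product norm_mult power_mult_distrib split_beta)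
  also have "\<dots> \<le> (norm u)\<^sup>2 * (norm v)\<^sup>2"
    by (intro mult_mono finite_sum_le_norm finite_imageI F) (auto intro: sum_nonneg)
  finally show "(\<Sum>p\<in>F. (cmod (l2_fun u (fst p) * l2_fun v (snd p)))\<^sup>2) \<le> (norm u * norm v)\<^sup>2"
    by (simp add: power_mult_distrib)
qed simp

lemma norm_tensor: "norm (tensor u v) = norm u * norm v"
proof -
  have "row (tensor u v) n = cs (l2_fun v n) u" for n
    by (rule ell2_l2_fun_eqI) (simp add: l2_fun_row l2_fun_tensor cs.rep_eq mult.commute)
  then have "(norm (tensor u v))\<^sup>2 = (\<Sum>\<^sub>\<infinity>n. (cmod (l2_fun v n))\<^sup>2 * (norm u)\<^sup>2)"
    unfolding power2_norm_eq_inner[of "tensor u v"] inner_rows(2)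
    by (simp add: power2_norm_eq_inner[symmetric] power_mult_distrib)
  also have "\<dots> = (norm u * norm v)\<^sup>2"
    by (simp add: infsum_cmult_left' norm_l2_sq[of v] power_mult_distrib)
  finally show ?thesis by (simp add: power2_eq_iff_nonneg)
qed

text \<open>The one-dimensional operator in the first variable. The second direction is its
  conjugate under the coordinate swap, so every estimate is proved once.\<close>

definition hor :: "(int \<Rightarrow> real) \<Rightarrow> (int \<times> int \<Rightarrow> complex) \<Rightarrow> int \<times> int \<Rightarrow> complex" where
  "hor q f = (\<lambda>p. schr q (\<lambda>m. f (m, snd p)) (fst p))"

lemma bij_shift_fst: "bij (\<lambda>p::int \<times> 'b. (fst p + k, snd p))" "bij (\<lambda>p::int \<times> 'b. (fst p - k, snd p))"
  by (rule o_bij[of "\<lambda>p. (fst p - k, snd p)"]; simp add: fun_eq_iff)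
     (rule o_bij[of "\<lambda>p. (fst p + k, snd p)"]; simp add: fun_eq_iff)

lemma hor_ell2:
  assumes q: "\<And>n. \<bar>q n\<bar> \<le> B" and f: "f \<in> ell2"
  shows "hor q f \<in> ell2"
proof -
  have "(\<lambda>p. f (fst p + 1, snd p) + f (fst p - 1, snd p) + of_real (q (fst p)) * f p) \<in> ell2"
    by (rule ell2_add[OF ell2_add[OF ell2_reindex[OF f bij_shift_fst(1)] ell2_reindex[OF f bij_shift_fst(2)]]
        ell2_bounded_mult[OF f, where B = B]]) (simp add: q)
  then show ?thesis by (simp add: hor_def schr_def)
qed

lemma l2_fun_hor:
  assumes "\<And>n. \<bar>q n\<bar> \<le> B"
  shows "l2_fun (l2_op (hor q) u) = hor q (l2_fun u)"
  unfolding l2_op_def by (rule Abs_l2_inverse[OF hor_ell2[OF assms l2_fun_ell2]])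

lemma hor_symmetric:
  assumes q: "\<And>n. \<bar>q n\<bar> \<le> B"
  shows "l2_symmetric (l2_op (hor q))"
proof -
  let ?R = "\<lambda>u. reidx (\<lambda>p. (fst p + 1, snd p)) u + reidx (\<lambda>p. (fst p - 1, snd p)) u + mulop (\<lambda>p. q (fst p)) u"
  have "l2_symmetric ?R"
    by (intro l2_symmetric_add l2_symmetric_hop l2_symmetric_mulop[of _ B] q) auto
  moreover have "l2_op (hor q) = ?R"
    by (rule ext, rule ell2_l2_fun_eqI)
       (simp add: l2_fun_hor[OF q] hor_def schr_def l2_fun_reidx bij_shift_fst l2_fun_mulop[of "\<lambda>p. q (fst p)" B, OF q])
  ultimately show ?thesis by simp
qed

lemma row_hor:
  assumes q: "\<And>n. \<bar>q n\<bar> \<le> B"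
  shows "row (l2_op (hor q) w) n = l2_op (schr q) (row w n)"
  by (rule ell2_l2_fun_eqI) (simp add: l2_fun_row l2_fun_hor[OF q] l2_fun_schr[OF q] hor_def)

lemma hor_tensor:
  assumes q: "\<And>n. \<bar>q n\<bar> \<le> B"
  shows "l2_op (hor q) (tensor u v) = tensor (l2_op (schr q) u) v"
  by (rule ell2_l2_fun_eqI)
     (simp add: l2_fun_tensor l2_fun_hor[OF q] l2_fun_schr[OF q] hor_def schr_def distrib_right mult.assoc)

lemma hor_range_ge:
  assumes q: "\<And>n. \<bar>q n\<bar> \<le> B" and a: "\<And>u. a * (norm u)\<^sup>2 \<le> inner (l2_op (schr q) u) u"
  shows "a * (norm w)\<^sup>2 \<le> inner (l2_op (hor q) w) w"
proof -
  have "a * (norm w)\<^sup>2 = (\<Sum>\<^sub>\<infinity>n. a * (norm (row w n))\<^sup>2)"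
    unfolding power2_norm_eq_inner inner_rows(2)[of w w] by (simp add: infsum_cmult_right')
  also have "\<dots> \<le> (\<Sum>\<^sub>\<infinity>n. inner (row (l2_op (hor q) w) n) (row w n))"
    unfolding row_hor[OF q]
  proof (rule infsum_mono)
    show "(\<lambda>n. a * (norm (row w n))\<^sup>2) summable_on UNIV"
      unfolding power2_norm_eq_inner by (intro summable_on_cmult_right inner_rows(1))
    show "(\<lambda>n. inner (l2_op (schr q) (row w n)) (row w n)) summable_on UNIV"
      using inner_rows(1)[of "l2_op (hor q) w" w] by (simp only: row_hor[OF q])
  qed (rule a)
  also have "\<dots> = inner (l2_op (hor q) w) w" by (rule inner_rows(2)[symmetric])
  finally show ?thesis .
qed

lemma hor_range_le:
  assumes q: "\<And>n. \<bar>q n\<bar> \<le> B" and b: "\<And>u. inner (l2_op (schr q) u) u \<le> b * (norm u)\<^sup>2"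
  shows "inner (l2_op (hor q) w) w \<le> b * (norm w)\<^sup>2"
proof -
  have "(\<Sum>\<^sub>\<infinity>n. inner (row (l2_op (hor q) w) n) (row w n)) \<le> (\<Sum>\<^sub>\<infinity>n. b * (norm (row w n))\<^sup>2)"
    unfolding row_hor[OF q]
  proof (rule infsum_mono)
    show "(\<lambda>n. b * (norm (row w n))\<^sup>2) summable_on UNIV"
      unfolding power2_norm_eq_inner by (intro summable_on_cmult_right inner_rows(1))
    show "(\<lambda>n. inner (l2_op (schr q) (row w n)) (row w n)) summable_on UNIV"
      using inner_rows(1)[of "l2_op (hor q) w" w] by (simp only: row_hor[OF q])
  qed (rule b)
  also have "(\<Sum>\<^sub>\<infinity>n. b * (norm (row w n))\<^sup>2) = b * (norm w)\<^sup>2"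
    unfolding power2_norm_eq_inner inner_rows(2)[of w w] by (simp add: infsum_cmult_right')
  finally show ?thesis by (simp only: inner_rows(2)[of "l2_op (hor q) w" w])
qed

abbreviation vert :: "(int \<Rightarrow> real) \<Rightarrow> (int \<times> int) l2 \<Rightarrow> (int \<times> int) l2" where
  "vert q w \<equiv> reidx prod.swap (l2_op (hor q) (reidx prod.swap w))"

lemma l2_fun_hor_vert:
  "l2_fun (l2_op (hor (\<lambda>n. V * fib_word 0 n)) w + vert (\<lambda>n. V * fib_word 0 n) w) = square_fib_hamiltonian V (l2_fun w)"
  by (simp add: l2_fun_hor[OF potential_bounded(1)] l2_fun_reidx hor_def schr_def
      square_fib_hamiltonian_def fun_eq_iff algebra_simps)

lemma square_fib_ell2: "f \<in> ell2 \<Longrightarrow> square_fib_hamiltonian V f \<in> ell2"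
  using l2_fun_hor_vert[of V "Abs_l2 f"] l2_fun_ell2 by (metis Abs_l2_inverse)

lemma square_fib_op:
  "l2_op (square_fib_hamiltonian V) = (\<lambda>w. l2_op (hor (\<lambda>n. V * fib_word 0 n)) w + vert (\<lambda>n. V * fib_word 0 n) w)"
  unfolding l2_op_def[of "square_fib_hamiltonian V"] l2_fun_hor_vert[symmetric] l2_fun_inverse by simp

lemma square_fib_symmetric: "l2_symmetric (l2_op (square_fib_hamiltonian V))"
  unfolding square_fib_op
  by (intro l2_symmetric_add l2_symmetric_swap hor_symmetric[of _ "\<bar>V\<bar>"] potential_bounded)

lemma spectrum_square_fib:
  "spectrum (square_fib_hamiltonian V) = complex_of_real ` {E. approx_ev (l2_op (square_fib_hamiltonian V)) E}"
  by (rule spectrum_symmetric[OF square_fib_ell2 square_fib_symmetric])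

lemma reidx_swap_tensor: "reidx prod.swap (tensor u v) = tensor v u"
  by (rule ell2_l2_fun_eqI) (simp add: l2_fun_reidx l2_fun_tensor mult.commute)

lemma square_fib_tensor:
  "l2_op (square_fib_hamiltonian V) (tensor u v) = tensor (fib_op V 0 u) v + tensor u (fib_op V 0 v)"
  unfolding square_fib_op by (simp add: hor_tensor[OF potential_bounded(1)] reidx_swap_tensor)

text \<open>The square operator acts on products by the Leibniz rule, so the residuals of the
  factors add, each weighted by the norm of the other factor.\<close>

lemma approx_ev_tensor:
  assumes x: "approx_ev (fib_op V 0) x" and y: "approx_ev (fib_op V 0) y"
  shows "approx_ev (l2_op (square_fib_hamiltonian V)) (x + y)"
  unfolding approx_ev_def
proof (intro allI impI)
  fix \<epsilon> :: real assume \<epsilon>: "\<epsilon> > 0"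
  obtain u where u: "norm (fib_op V 0 u - x *\<^sub>R u) < \<epsilon> / 2 * norm u"
    using x \<epsilon> unfolding approx_ev_def by (meson half_gt_zero)
  obtain v where v: "norm (fib_op V 0 v - y *\<^sub>R v) < \<epsilon> / 2 * norm v"
    using y \<epsilon> unfolding approx_ev_def by (meson half_gt_zero)
  have pos: "norm u > 0" "norm v > 0"
    using le_less_trans[OF norm_ge_zero u] le_less_trans[OF norm_ge_zero v] \<epsilon> by (simp_all add: zero_less_mult_iff)
  have "l2_op (square_fib_hamiltonian V) (tensor u v) - (x + y) *\<^sub>R tensor u v
      = tensor (fib_op V 0 u - x *\<^sub>R u) v + tensor u (fib_op V 0 v - y *\<^sub>R v)"
    unfolding square_fib_tensor
    by (rule ell2_l2_fun_eqI) (simp add: l2_fun_tensor fun_eq_iff scaleR_conv_of_real algebra_simps)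
  then have "norm (l2_op (square_fib_hamiltonian V) (tensor u v) - (x + y) *\<^sub>R tensor u v)
      \<le> norm (fib_op V 0 u - x *\<^sub>R u) * norm v + norm u * norm (fib_op V 0 v - y *\<^sub>R v)"
    using norm_triangle_ineq[of "tensor (fib_op V 0 u - x *\<^sub>R u) v" "tensor u (fib_op V 0 v - y *\<^sub>R v)"]
    by (simp only: norm_tensor)
  also have "\<dots> < \<epsilon> / 2 * norm u * norm v + norm u * (\<epsilon> / 2 * norm v)"
    by (intro add_strict_mono mult_strict_right_mono mult_strict_left_mono u v pos)
  also have "\<dots> = \<epsilon> * norm (tensor u v)" by (simp add: norm_tensor)
  finally show "\<exists>w. norm (l2_op (square_fib_hamiltonian V) w - (x + y) *\<^sub>R w) < \<epsilon> * norm w" by blast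
qed

lemma square_fib_range_ge:
  assumes a: "\<And>u. a * (norm u)\<^sup>2 \<le> inner (fib_op V 0 u) u"
  shows "2 * a * (norm w)\<^sup>2 \<le> inner (l2_op (square_fib_hamiltonian V) w) w"
  using hor_range_ge[OF potential_bounded(1) a, of w]
    hor_range_ge[OF potential_bounded(1) a, of "reidx prod.swap w"]
  by (simp add: square_fib_op inner_add_left inner_reidx_swap norm_reidx)

lemma square_fib_range_le:
  assumes b: "\<And>u. inner (fib_op V 0 u) u \<le> b * (norm u)\<^sup>2"
  shows "inner (l2_op (square_fib_hamiltonian V) w) w \<le> 2 * b * (norm w)\<^sup>2"
  using hor_range_le[OF potential_bounded(1) b, of w]
    hor_range_le[OF potential_bounded(1) b, of "reidx prod.swap w"]
  by (simp add: square_fib_op inner_add_left inner_reidx_swap norm_reidx)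

theorem theorem1p4:
  "\<exists>V0 > 0. \<forall>V :: real. 0 < V \<and> V < V0 \<longrightarrow>
     spectrum (square_fib_hamiltonian V) =
       {E1 + E2 | E1 E2. E1 \<in> fib_spectrum V \<and> E2 \<in> fib_spectrum V} \<and>
     (\<exists>a b :: real. a < b \<and>
       spectrum (square_fib_hamiltonian V) = complex_of_real ` {a..b})"
proof (rule exI[of _ "1/1000000"], intro conjI allI impI)
  fix V :: real assume "0 < V \<and> V < 1/1000000"
  then have V: "0 < V" "V \<le> 1" "V \<le> 1/1000000" by auto
  obtain a b where ab: "a < b" "a \<in> Sig V" "b \<in> Sig V" "Sig V \<subseteq> {a..b}"
    and range: "\<And>u. a * (norm u)\<^sup>2 \<le> inner (fib_op V 0 u) u" "\<And>u. inner (fib_op V 0 u) u \<le> b * (norm u)\<^sup>2"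
    using Sig_hull[of V] by blast
  define A where "A = {E. approx_ev (l2_op (square_fib_hamiltonian V)) E}"
  have A: "spectrum (square_fib_hamiltonian V) = complex_of_real ` A"
    unfolding A_def by (rule spectrum_square_fib)
  \<comment> \<open>Three inclusions close a circle: \<open>A\<close> in this interval, the interval
    in the sum set, the sum set in \<open>A\<close>.\<close>
  have "A \<subseteq> {2 * a..2 * b}"
    using approx_ev_ge[OF _ square_fib_range_ge[OF range(1)]] approx_ev_le[OF _ square_fib_range_le[OF range(2)]]
    by (auto simp: A_def)
  moreover have "\<exists>x\<in>Sig V. \<exists>y\<in>Sig V. x + y = t" if "t \<in> {2 * a..2 * b}" for t
    using that by (intro thick_sum[OF compact_Sig[OF V(1,2)] ab(2-4) thick_Sig[OF V(1,3)]]) auto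
  moreover have "x + y \<in> A" if "x \<in> Sig V" "y \<in> Sig V" for x y
    unfolding A_def using approx_ev_tensor[OF Sig_approx_ev[OF that(1)] Sig_approx_ev[OF that(2)]] by simp
  ultimately have eq: "A = {2 * a..2 * b}" "A = {x + y |x y. x \<in> Sig V \<and> y \<in> Sig V}"
    by (blast, blast)
  show "spectrum (square_fib_hamiltonian V) =
      {E1 + E2 | E1 E2. E1 \<in> fib_spectrum V \<and> E2 \<in> fib_spectrum V}"
    unfolding A eq(2) fib_spectrum_eq by (force simp: image_iff)
  show "\<exists>a b :: real. a < b \<and> spectrum (square_fib_hamiltonian V) = complex_of_real ` {a..b}"
    using ab(1) unfolding A eq(1) by (intro exI[of _ "2 * a"] exI[of _ "2 * b"]) simp
qed simp

end
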